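(* Let $\pmb k$ be an algebraically closed field of characteristic zero and let $B,d,n,g_1,\dots,g_n,I,\Psi,\mathcal C$ be as in the context. Consider the inclusion map $\pmb k[I_d]\subseteq B$ of homogeneous coordinate rings which is induced by the morphism $\Psi:\mathbb P^1\to\mathcal C$. The $\gcd$ of the zeroth Fitting ideal of the module of K\"ahler differentials $\Omega_{B/\pmb k[I_d]}$ is a polynomial in $B$. Let $$\gcd\operatorname{Fitt}_0(\Omega_{B/\pmb k[I_d]})=\prod_{i=1}^s\ell_i^{f_i},$$ where $(\ell_1),\dots,(\ell_s)$ are distinct height one linear ideals of $B$. If $(\ell)$ is an arbitrary height one linear ideal of $B$ and $\mathcal C(\ell)$ is the branch of $\mathcal C$ which corresponds to $\ell$, then the multiplicity of the branch $\mathcal C(\ell)$ is $$\begin{cases}f_i+1&\text{if }(\ell)=(\ell_i)\text{ for some }i,\\1&\text{otherwise.}\end{cases}$$ Furthermore, the Fitting ideal $\operatorname{Fitt}_0(\Omega_{B/\pmb k[I_d]})$ is equal to the ideal $I_2(N)$ of $B$, where $N$ is the $2\times n$ transposed Jacobian matrix $$N=\begin{bmatrix}\frac{\partial g_1}{\partial x}&\cdots&\frac{\partial g_n}{\partial x}\\[3pt]\frac{\partial g_1}{\partial y}&\cdots&\frac{\partial g_n}{\partial y}\end{bmatrix}.$$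
   Context: Setting: $B=\pmb k[x,y]$ is the standard graded polynomial ring, $g_1,\dots,g_n$ are homogeneous forms of degree $d$ in $B$, $I=(g_1,\dots,g_n)B$, $\Psi:\mathbb P^1\to\mathbb P^{n-1}$ is the morphism $[g_1:\dots:g_n]$, and $\mathcal C$ is the image of $\Psi$. Assume: $I$ is minimally generated by $g_1,\dots,g_n$; $I$ has height two; and $\Psi:\mathbb P^1\to\mathcal C$ is a birational morphism. $\pmb k[I_d]=\pmb k[g_1,\dots,g_n]$. $I_2(N)$ is the ideal generated by the $2\times2$ minors of $N$, and the $\gcd$ of an ideal is the greatest common divisor of a generating set. A height one linear ideal of $B$ is an ideal generated by one non-zero linear form. A branch of $\mathcal C$ at $p$ is a minimal prime ideal $\mathcal J$ of the completion $\widehat{\mathcal O_{\mathcal C,p}}$ of the local ring of $\mathcal C$ at $p$; its multiplicity is the multiplicity of the local ring $\widehat{\mathcal O_{\mathcal C,p}}/\mathcal J$. There is a one-to-one correspondence between height one linear ideals of $B$ (equivalently, points of $\mathbb P^1$) and branches of $\mathcal C$: if $q\in\mathbb P^1$ is the zero of $\ell$ and $p=\Psi(q)$, then the points of $\Psi^{-1}(p)$ correspond to the maximal ideals of the integral closure $\overline{\mathcal O_{\mathcal C,p}}$, which in turn correspond to the minimal primes of $\widehat{\mathcal O_{\mathcal C,p}}$; the branch $\mathcal C(\ell)$ is the kernel of the natural map $\widehat{\mathcal O_{\mathcal C,p}}\to\widehat{\mathcal O_{\mathbb P^1,q}}$. *)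

theory Defs
  imports
    "HOL-Library.Poly_Mapping"
    "HOL-Library.Extended_Nat"
    "HOL-Computational_Algebra.Polynomial_Factorial"
    "HOL-Algebra.Algebraic_Closure_Type"
    "HOL-Algebra.Ideal_Product"
    "HOL-Algebra.QuotRing"
    "HOL-Algebra.Module"
    "Jordan_Normal_Form.Determinant"
    "Jordan_Normal_Form.DL_Submatrix"
begin

section \<open>Commutative algebra\<close>

text \<open>Supremum of the lengths \<open>k\<close> of the strict chains \<open>c 0 \<subset> \<dots> \<subset> c k\<close> in a family of sets.\<close>

definition chain_sup :: "'a set set \<Rightarrow> enat" where
  "chain_sup F = Sup {enat k | k. \<exists>c :: nat \<Rightarrow> 'a set. (\<forall>i\<le>k. c i \<in> F) \<and> (\<forall>i<k. c i \<subset> c (Suc i))}"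

definition krull_dim :: "('a, 'm) ring_scheme \<Rightarrow> enat" where
  "krull_dim R = chain_sup {P. primeideal P R}"

definition prime_height :: "('a, 'm) ring_scheme \<Rightarrow> 'a set \<Rightarrow> enat" where
  "prime_height R P = chain_sup {Q. primeideal Q R \<and> Q \<subseteq> P}"

definition ideal_height :: "('a, 'm) ring_scheme \<Rightarrow> 'a set \<Rightarrow> enat" where
  "ideal_height R J = Inf {prime_height R P | P. primeideal P R \<and> J \<subseteq> P}"

text \<open>Length of a ring as a module over itself.  For \<open>R Quot J\<close> this is also the length as an
  \<open>R\<close>-module, since the \<open>R\<close>-submodules of \<open>R Quot J\<close> are its ideals.\<close>

definition ring_length :: "('a, 'm) ring_scheme \<Rightarrow> enat" where
  "ring_length R = chain_sup {J. ideal J R}"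

definition ideal_pow :: "('a, 'm) ring_scheme \<Rightarrow> 'a set \<Rightarrow> nat \<Rightarrow> 'a set" where
  "ideal_pow R J k = J [^]\<^bsub>ideals_set R\<^esub> k"

text \<open>For a local ring, the non-units are the maximal ideal.\<close>

definition max_ideal :: "('a, 'm) ring_scheme \<Rightarrow> 'a set" where
  "max_ideal R = carrier R - Units R"

text \<open>Hilbert--Samuel multiplicity of a Noetherian local ring \<open>(R, \<mm>)\<close> of dimension \<open>\<delta>\<close>: the limit
  of \<open>\<delta>! \<cdot> length (R / \<mm>\<^sup>k) / k\<^sup>\<delta>\<close>.\<close>

definition multiplicity_local :: "('a, 'm) ring_scheme \<Rightarrow> real" where
  "multiplicity_local R =
     (let \<delta> = the_enat (krull_dim R) in
      lim (\<lambda>k. fact \<delta> * real (the_enat (ring_length (R Quot ideal_pow R (max_ideal R) k))) / real k ^ \<delta>))"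

text \<open>The completion as the inverse limit of the rings \<open>R / J\<^sup>k\<close>; the transition map
  \<open>R / J\<^sup>k\<^sup>+\<^sup>1 \<rightarrow> R / J\<^sup>k\<close> enlarges a coset \<open>C\<close> to \<open>C + J\<^sup>k\<close>.\<close>

definition adic_completion :: "('a, 'm) ring_scheme \<Rightarrow> 'a set \<Rightarrow> (nat \<Rightarrow> 'a set) ring" where
  "adic_completion R J =
    \<lparr> carrier = {s. (\<forall>k. s k \<in> carrier (R Quot ideal_pow R J k)) \<and>
                    (\<forall>k. s k = s (Suc k) <+>\<^bsub>R\<^esub> ideal_pow R J k)},
      monoid.mult = (\<lambda>s t k. s k \<otimes>\<^bsub>R Quot ideal_pow R J k\<^esub> t k),
      one = (\<lambda>k. \<one>\<^bsub>R Quot ideal_pow R J k\<^esub>),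
      ring.zero = (\<lambda>k. \<zero>\<^bsub>R Quot ideal_pow R J k\<^esub>),
      add = (\<lambda>s t k. s k \<oplus>\<^bsub>R Quot ideal_pow R J k\<^esub> t k) \<rparr>"

definition local_completion :: "('a, 'm) ring_scheme \<Rightarrow> (nat \<Rightarrow> 'a set) ring" where
  "local_completion R = adic_completion R (max_ideal R)"

text \<open>The map induced on completions by a local homomorphism \<open>h\<close> into \<open>S\<close>: the coset of \<open>r\<close> modulo
  the \<open>k\<close>-th power of the maximal ideal goes to the coset of \<open>h r\<close>.\<close>

definition completion_map ::
    "('b, 'm) ring_scheme \<Rightarrow> ('a \<Rightarrow> 'b) \<Rightarrow> (nat \<Rightarrow> 'a set) \<Rightarrow> (nat \<Rightarrow> 'b set)" where
  "completion_map S h s = (\<lambda>k. (h ` s k) <+>\<^bsub>S\<^esub> ideal_pow S (max_ideal S) k)"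

definition minimally_generated_by ::
    "('a, 'm) ring_scheme \<Rightarrow> 'a set \<Rightarrow> nat \<Rightarrow> (nat \<Rightarrow> 'a) \<Rightarrow> bool" where
  "minimally_generated_by R J n g \<longleftrightarrow>
     Idl\<^bsub>R\<^esub> (g ` {..<n}) = J \<and> (\<forall>i<n. Idl\<^bsub>R\<^esub> (g ` ({..<n} - {i})) \<noteq> J)"


section \<open>Modules, Fitting ideals and differentials\<close>

definition submodule_gen ::
    "('a, 'm) ring_scheme \<Rightarrow> ('a, 'b, 'n) module_scheme \<Rightarrow> 'b set \<Rightarrow> 'b set" where
  "submodule_gen R M S = \<Inter>{N. submodule N R M \<and> S \<subseteq> N}"

text \<open>The record type of modules carries ring operations; the fields \<open>mult\<close> and \<open>one\<close> play no role
  for modules and are filled with dummies here and below.\<close>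

definition quotient_module :: "('a, 'b, 'n) module_scheme \<Rightarrow> 'b set \<Rightarrow> ('a, 'b set) module" where
  "quotient_module M N =
    \<lparr> carrier = a_rcosets\<^bsub>M\<^esub> N, monoid.mult = (\<lambda>_ _. N), one = N, ring.zero = N,
      add = set_add M, module.smult = (\<lambda>a C. ((\<lambda>x. a \<odot>\<^bsub>M\<^esub> x) ` C) <+>\<^bsub>M\<^esub> N) \<rparr>"

text \<open>The free module on the set of all elements of the type \<open>'x\<close>.\<close>

definition free_module :: "('r::comm_ring_1, 'x \<Rightarrow>\<^sub>0 'r) module" where
  "free_module =
    \<lparr> carrier = UNIV, monoid.mult = (\<lambda>_ _. 0), one = 0, ring.zero = 0,
      add = (+), module.smult = (\<lambda>a. Poly_Mapping.map ((*) a)) \<rparr>"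

text \<open>\<open>\<Omega>\<^bsub>R/A\<^esub>\<close> for a subring \<open>A\<close> of \<open>R\<close>: the symbol \<open>db\<close> is \<open>single b 1\<close>.  Linearity of \<open>d\<close> over
  \<open>A\<close> follows from the Leibniz rule and \<open>da = 0\<close> for \<open>a \<in> A\<close>.\<close>

definition kaehler_relations :: "'r::comm_ring_1 set \<Rightarrow> ('r \<Rightarrow>\<^sub>0 'r) set" where
  "kaehler_relations A =
     {Poly_Mapping.single (b + c) 1 - (Poly_Mapping.single b 1 + Poly_Mapping.single c 1) | b c. True}
   \<union> {Poly_Mapping.single (b * c) 1 - (Poly_Mapping.single c b + Poly_Mapping.single b c) | b c. True}
   \<union> {Poly_Mapping.single a 1 | a. a \<in> A}"

definition kaehler_differentials :: "'r::comm_ring_1 set \<Rightarrow> ('r, ('r \<Rightarrow>\<^sub>0 'r) set) module" where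
  "kaehler_differentials A =
     quotient_module free_module
       (submodule_gen (ring_of_type_algebra :: 'r ring) free_module (kaehler_relations A))"

definition module_generators :: "('r::comm_ring_1, 'm, 'n) module_scheme \<Rightarrow> nat \<Rightarrow> (nat \<Rightarrow> 'm) \<Rightarrow> bool" where
  "module_generators M r m \<longleftrightarrow>
     m ` {..<r} \<subseteq> carrier M \<and>
     submodule_gen (ring_of_type_algebra :: 'r ring) M (m ` {..<r}) = carrier M"

text \<open>The ideal of maximal minors of the presentation matrix of \<open>M\<close> with respect to the generators
  \<open>m 0, \<dots>, m (r - 1)\<close> in which all relations between these generators occur as rows.\<close>

definition presentation_minors_ideal ::
    "('r::comm_ring_1, 'm, 'n) module_scheme \<Rightarrow> nat \<Rightarrow> (nat \<Rightarrow> 'm) \<Rightarrow> 'r set" where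
  "presentation_minors_ideal M r m =
     Idl\<^bsub>ring_of_type_algebra\<^esub>
       {det (mat r r (\<lambda>(i, j). a i j)) | a.
          \<forall>i<r. (\<Oplus>\<^bsub>M\<^esub>j\<in>{..<r}. a i j \<odot>\<^bsub>M\<^esub> m j) = \<zero>\<^bsub>M\<^esub>}"

text \<open>For a finitely generated module this ideal does not depend on the generators.\<close>

definition Fitt0 :: "('r::comm_ring_1, 'm, 'n) module_scheme \<Rightarrow> 'r set" where
  "Fitt0 M = (THE J. \<exists>r m. module_generators M r m \<and> J = presentation_minors_ideal M r m)"

definition minors_ideal :: "nat \<Rightarrow> 'r::comm_ring_1 mat \<Rightarrow> 'r set" where
  "minors_ideal t U =
     Idl\<^bsub>ring_of_type_algebra\<^esub>
       {det (submatrix U I J) | I J.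
          I \<subseteq> {..<dim_row U} \<and> J \<subseteq> {..<dim_col U} \<and> card I = t \<and> card J = t}"

text \<open>The gcd of a generating set; it is only determined up to units, so this is a relation.\<close>

definition is_gcd_of_ideal :: "'r::comm_ring_1 set \<Rightarrow> 'r \<Rightarrow> bool" where
  "is_gcd_of_ideal J h \<longleftrightarrow>
     (\<exists>S. Idl\<^bsub>ring_of_type_algebra\<^esub> S = J \<and>
          (\<forall>a\<in>S. h dvd a) \<and> (\<forall>c. (\<forall>a\<in>S. c dvd a) \<longrightarrow> c dvd h))"


section \<open>The ring \<open>B = k[x, y]\<close> and the projective line\<close>

text \<open>\<open>B\<close> is \<open>k[x][y]\<close>: the coefficient of \<open>x\<^sup>i y\<^sup>j\<close> in \<open>h\<close> is \<open>coeff (coeff h j) i\<close>.\<close>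

abbreviation B_ring :: "'k::field poly poly ring" where
  "B_ring \<equiv> ring_of_type_algebra"

definition homogeneous :: "nat \<Rightarrow> 'k::field poly poly \<Rightarrow> bool" where
  "homogeneous e h \<longleftrightarrow> (\<forall>i j. coeff (coeff h j) i \<noteq> 0 \<longrightarrow> i + j = e)"

definition dx :: "'k::field poly poly \<Rightarrow> 'k poly poly" where
  "dx h = map_poly pderiv h"

definition dy :: "'k::field poly poly \<Rightarrow> 'k poly poly" where
  "dy h = pderiv h"

definition eval2 :: "'k::field poly poly \<Rightarrow> 'k \<times> 'k \<Rightarrow> 'k" where
  "eval2 h q = poly (poly h [:snd q:]) (fst q)"

definition linear_form :: "'k::field poly poly \<Rightarrow> bool" where
  "linear_form l \<longleftrightarrow> homogeneous 1 l \<and> l \<noteq> 0"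

text \<open>\<open>q\<close> is a pair of homogeneous coordinates of the zero of \<open>l\<close> in the projective line.\<close>

definition is_zero_of :: "'k::field \<times> 'k \<Rightarrow> 'k poly poly \<Rightarrow> bool" where
  "is_zero_of q l \<longleftrightarrow> q \<noteq> (0, 0) \<and> eval2 l q = 0"

text \<open>Function field and local rings of the projective line, as subrings of \<open>k(x, y)\<close>: quotients of
  forms of equal degree.\<close>

definition function_field_P1 :: "'k::field poly poly fract set" where
  "function_field_P1 = {Fract a b | a b e. homogeneous e a \<and> homogeneous e b \<and> b \<noteq> 0}"

definition local_ring_P1 :: "'k::field \<times> 'k \<Rightarrow> 'k poly poly fract ring" where
  "local_ring_P1 q = ring_of_type_algebra
     \<lparr> carrier := {Fract a b | a b e. homogeneous e a \<and> homogeneous e b \<and> eval2 b q \<noteq> 0} \<rparr>"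


section \<open>The parametrised curve\<close>

text \<open>Polynomials in \<open>T\<^sub>0, T\<^sub>1, \<dots>\<close> over \<open>k\<close> are finitely supported maps from exponent vectors to
  coefficients.\<close>

type_synonym 'k mpol = "(nat \<Rightarrow>\<^sub>0 nat) \<Rightarrow>\<^sub>0 'k"

definition in_vars :: "nat \<Rightarrow> 'k::field mpol \<Rightarrow> bool" where
  "in_vars n F \<longleftrightarrow> (\<forall>m\<in>Poly_Mapping.keys F. Poly_Mapping.keys m \<subseteq> {..<n})"

definition is_form :: "nat \<Rightarrow> nat \<Rightarrow> 'k::field mpol \<Rightarrow> bool" where
  "is_form n e F \<longleftrightarrow> in_vars n F \<and>
     (\<forall>m\<in>Poly_Mapping.keys F. (\<Sum>i\<in>Poly_Mapping.keys m. Poly_Mapping.lookup m i) = e)"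

text \<open>The value \<open>F(p)\<close> in a \<open>k\<close>-algebra with structure map \<open>\<phi>\<close>.\<close>

definition subst :: "('k::field \<Rightarrow> 'r::comm_ring_1) \<Rightarrow> 'k mpol \<Rightarrow> (nat \<Rightarrow> 'r) \<Rightarrow> 'r" where
  "subst \<phi> F p = (\<Sum>m\<in>Poly_Mapping.keys F. \<phi> (Poly_Mapping.lookup F m) *
                   (\<Prod>i\<in>Poly_Mapping.keys m. p i ^ Poly_Mapping.lookup m i))"

abbreviation at_forms :: "'k::field mpol \<Rightarrow> (nat \<Rightarrow> 'k poly poly) \<Rightarrow> 'k poly poly" where
  "at_forms F g \<equiv> subst (\<lambda>c. [:[:c:]:]) F g"

abbreviation at_point :: "'k::field mpol \<Rightarrow> (nat \<Rightarrow> 'k) \<Rightarrow> 'k" where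
  "at_point F p \<equiv> subst (\<lambda>c. c) F p"

definition Psi :: "(nat \<Rightarrow> 'k::field poly poly) \<Rightarrow> 'k \<times> 'k \<Rightarrow> (nat \<Rightarrow> 'k)" where
  "Psi g q = (\<lambda>i. eval2 (g i) q)"

text \<open>The homogeneous coordinate ring \<open>k[g\<^sub>0, \<dots>, g\<^sub>n\<^sub>-\<^sub>1]\<close> of the image curve.\<close>

definition coord_ring :: "nat \<Rightarrow> (nat \<Rightarrow> 'k::field poly poly) \<Rightarrow> 'k poly poly set" where
  "coord_ring n g = {at_forms F g | F. in_vars n F}"

text \<open>Function field and local rings of the image curve: quotients \<open>F/G\<close> of forms of equal degree,
  where two of them are identified if they agree as functions on the curve, that is, if \<open>F(g)/G(g)\<close>
  is the same element of \<open>k(x, y)\<close>.  In this description the pullback along the parametrisation is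
  an inclusion.\<close>

definition function_field_C :: "nat \<Rightarrow> (nat \<Rightarrow> 'k::field poly poly) \<Rightarrow> 'k poly poly fract set" where
  "function_field_C n g =
     {Fract (at_forms F g) (at_forms G g) | F G e.
        is_form n e F \<and> is_form n e G \<and> at_forms G g \<noteq> 0}"

definition local_ring_C ::
    "nat \<Rightarrow> (nat \<Rightarrow> 'k::field poly poly) \<Rightarrow> (nat \<Rightarrow> 'k) \<Rightarrow> 'k poly poly fract ring" where
  "local_ring_C n g p = ring_of_type_algebra
     \<lparr> carrier := {Fract (at_forms F g) (at_forms G g) | F G e.
                     is_form n e F \<and> is_form n e G \<and> at_point G p \<noteq> 0} \<rparr>"

text \<open>The morphism is birational onto its image if it induces an isomorphism of function fields.\<close>

definition birational_onto_image :: "nat \<Rightarrow> (nat \<Rightarrow> 'k::field poly poly) \<Rightarrow> bool" where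
  "birational_onto_image n g \<longleftrightarrow> function_field_C n g = function_field_P1"

text \<open>The branch of the curve that corresponds to the point \<open>q\<close> of the projective line: the kernel of
  the map of completed local rings induced by the pullback.\<close>

definition branch :: "nat \<Rightarrow> (nat \<Rightarrow> 'k::field poly poly) \<Rightarrow> 'k \<times> 'k \<Rightarrow> (nat \<Rightarrow> 'k poly poly fract set) set" where
  "branch n g q =
     a_kernel (local_completion (local_ring_C n g (Psi g q))) (local_completion (local_ring_P1 q))
       (completion_map (local_ring_P1 q) (\<lambda>u. u))"

definition branch_multiplicity :: "nat \<Rightarrow> (nat \<Rightarrow> 'k::field poly poly) \<Rightarrow> 'k \<times> 'k \<Rightarrow> real" where
  "branch_multiplicity n g q =
     multiplicity_local (local_completion (local_ring_C n g (Psi g q)) Quot branch n g q)"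

definition jacobian_transposed :: "nat \<Rightarrow> (nat \<Rightarrow> 'k::field poly poly) \<Rightarrow> 'k poly poly mat" where
  "jacobian_transposed n g = mat 2 n (\<lambda>(i, j). if i = 0 then dx (g j) else dy (g j))"

definition linear_ideals_factorization ::
    "nat \<Rightarrow> (nat \<Rightarrow> 'k::field poly poly) \<Rightarrow> (nat \<Rightarrow> nat) \<Rightarrow> 'k poly poly \<Rightarrow> bool" where
  "linear_ideals_factorization s l f h \<longleftrightarrow>
     (\<forall>i<s. linear_form (l i)) \<and> inj_on (\<lambda>i. PIdl\<^bsub>B_ring\<^esub> (l i)) {..<s} \<and>
     h = (\<Prod>i<s. l i ^ f i)"

end

theory Submission
  imports Defs
begin

text \<open>
  In \<open>\<Omega>\<close> every \<open>b \<in> k[x, y]\<close> satisfies \<open>db = b\<^sub>x dx + b\<^sub>y dy\<close>, and by the chain rule the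
  gradient of a polynomial in the \<open>g\<^sub>i\<close> is a combination of the gradients of the \<open>g\<^sub>i\<close>.  So \<open>\<Omega>\<close> is generated by
  \<open>dx\<close> and \<open>dy\<close> with the columns of the transposed Jacobian matrix \<open>N\<close> as relations, and its zeroth Fitting ideal is \<open>I\<^sub>2(N)\<close>
  (\<open>Fitt0_kaehler_differentials\<close>).  As the Fitting ideal is defined by a description, this uses that the
  ideal of maximal minors is the same for all finite families of generators (\<open>Ideal_relation_minors_eq\<close>).

  For the branches, let \<open>q\<close> be the zero of a linear form \<open>m\<close>.  Height two means that the \<open>g\<^sub>i\<close> have no common zero;
  so some \<open>g\<^sub>j\<close> does not vanish at \<open>q\<close>.  Let \<open>e\<close> be the smallest order of vanishing at \<open>q\<close> among the forms
  \<open>g\<^sub>j(q) g\<^sub>i - g\<^sub>i(q) g\<^sub>j\<close>.  The theorem follows from two computations, which identify \<open>e\<close> with the multiplicity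
  of the branch and \<open>e - 1\<close> with the exponent of \<open>m\<close> in the gcd.

  The multiplicity is \<open>e\<close> (\<open>branch_multiplicity_order\<close>).  Expansion along a line through \<open>q\<close> maps the local
  ring of the projective line at \<open>q\<close> into \<open>k[[t]]\<close>, and the completed local ring of the curve modulo the branch
  is isomorphic to its image \<open>S\<close> in \<open>k[[t]]\<close>, the ring of limits of expansions.  The non-units of \<open>S\<close> have
  order at least \<open>e\<close>, and one of them has order \<open>e\<close>.  If \<open>S\<close> contains \<open>t\<^sup>N k[[t]]\<close> for some \<open>N\<close>, then it is
  one-dimensional and the length of \<open>S / \<mm>\<^sup>k\<close> is \<open>e k + O(1)\<close> (\<open>cofinite_power_series_ring.multiplicity_eq\<close>).
  This containment is where birationality enters: a suitable quotient \<open>\<tau>\<close> of two linear forms with a zero of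
  order one at \<open>q\<close> satisfies an integral equation over the local ring of the curve, and since \<open>\<tau>\<close> is a rational
  function on the curve, its powers have a common denominator \<open>f\<close> in the local ring.  There is a polynomial
  \<open>W\<close> in \<open>\<tau>\<close> of order \<open>e\<close> at \<open>q\<close> such that \<open>f W\<^sup>k \<tau>\<^sup>i\<close> lies in the \<open>k\<close>-th power of the maximal ideal
  (\<open>adic_subring.common_denominator\<close>); sums of such elements converge to all multiples of the expansion
  of \<open>f\<close>.

  The exponent is \<open>e - 1\<close> (\<open>power_dvd_minors_iff\<close>).  Let \<open>\<gamma>\<^sub>i\<close> be the expansion of \<open>g\<^sub>i\<close>.  Euler's identity turns
  the Jacobian minors on the line into constant multiples of the Wronskians
  \<open>\<gamma>\<^sub>a \<gamma>\<^sub>b' - \<gamma>\<^sub>b \<gamma>\<^sub>a'\<close>.  In characteristic zero differentiation lowers positive orders by exactly one, so the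
  smallest order of the Wronskians is one less than that of the series \<open>g\<^sub>j(q) \<gamma>\<^sub>i - g\<^sub>i(q) \<gamma>\<^sub>j\<close>, which is \<open>e\<close>.
  Finally, the minors are binary forms over an algebraically closed field, so their gcd is a product of
  linear forms.
\<close>

\<comment> \<open>The infix is used for the coefficients of power series.\<close>
no_notation vec_index (infixl \<open>$\<close> 100)

section \<open>Lengths of chains\<close>

lemma chain_sup_mono:
  assumes "\<And>A. A \<in> F \<Longrightarrow> \<phi> A \<in> F'"
    and "\<And>A B. A \<in> F \<Longrightarrow> B \<in> F \<Longrightarrow> A \<subset> B \<Longrightarrow> \<phi> A \<subset> \<phi> B"
  shows "chain_sup F \<le> chain_sup F'"
  unfolding chain_sup_def
proof (rule Sup_subset_mono, clarify)
  fix k and c :: "nat \<Rightarrow> 'a set"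
  assume "\<forall>i\<le>k. c i \<in> F" "\<forall>i<k. c i \<subset> c (Suc i)"
  then have "(\<forall>i\<le>k. (\<phi> \<circ> c) i \<in> F') \<and> (\<forall>i<k. (\<phi> \<circ> c) i \<subset> (\<phi> \<circ> c) (Suc i))"
    using assms by (auto simp del: psubset_eq)
  then show "\<exists>k'. enat k = enat k' \<and>
      (\<exists>c. (\<forall>i\<le>k'. c i \<in> F') \<and> (\<forall>i<k'. c i \<subset> c (Suc i)))"
    by blast
qed

lemma chain_sup_le:
  fixes rank :: "'a set \<Rightarrow> nat"
  assumes "\<And>A. A \<in> F \<Longrightarrow> rank A \<le> M"
    and "\<And>A B. A \<in> F \<Longrightarrow> B \<in> F \<Longrightarrow> A \<subset> B \<Longrightarrow> rank A < rank B"
  shows "chain_sup F \<le> enat M"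
  unfolding chain_sup_def
proof (rule Sup_least, clarify)
  fix k and c :: "nat \<Rightarrow> 'a set"
  assume c: "\<forall>i\<le>k. c i \<in> F" "\<forall>i<k. c i \<subset> c (Suc i)"
  have "i \<le> rank (c i)" if "i \<le> k" for i
    using that
  proof (induction i)
    case (Suc i)
    then have "rank (c i) < rank (c (Suc i))"
      using assms(2) c by simp
    then show ?case using Suc by simp
  qed simp
  then show "enat k \<le> enat M"
    using assms(1) c(1) by (meson enat_ord_simps(1) le_refl le_trans)
qed

lemma chain_sup_ge:
  assumes "\<And>i. i \<le> k \<Longrightarrow> c i \<in> F" and "\<And>i. i < k \<Longrightarrow> c i \<subset> c (Suc i)"
  shows "enat k \<le> chain_sup F"
  unfolding chain_sup_def using assms by (intro Sup_upper) blast

section \<open>Ring isomorphisms preserve the multiplicity\<close>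

lemma ring_length_Quot:
  assumes "ring R" "ideal J R"
  shows "ring_length (R Quot J) = chain_sup {I. ideal I R \<and> J \<subseteq> I}"
proof -
  interpret ring R by fact
  let ?\<psi> = "\<lambda>I. a_r_coset R J ` I"
  have bij: "bij_betw ?\<psi> {I. ideal I R \<and> J \<subseteq> I} {I. ideal I (R Quot J)}"
    using quot_ideal_correspondence[OF assms(2)] .
  have un: "\<Union> (?\<psi> I) = I" if "ideal I R" "J \<subseteq> I" for I
    using ideal_incl_iff[OF assms(2) that(1)] that(2) by blast
  have ex: "\<exists>I. ideal I R \<and> J \<subseteq> I \<and> Z = ?\<psi> I" if "ideal Z (R Quot J)" for Z
    using bij that unfolding bij_betw_def by blast
  show ?thesis
    unfolding ring_length_def
  proof (rule antisym)
    show "chain_sup {I. ideal I (R Quot J)} \<le> chain_sup {I. ideal I R \<and> J \<subseteq> I}"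
    proof (rule chain_sup_mono[where \<phi> = Union])
      show "\<Union>Z \<in> {I. ideal I R \<and> J \<subseteq> I}" if "Z \<in> {I. ideal I (R Quot J)}" for Z
        using ex[of Z] that un by auto
      show "\<Union>Z \<subset> \<Union>Z'" if "Z \<in> {I. ideal I (R Quot J)}" "Z' \<in> {I. ideal I (R Quot J)}" "Z \<subset> Z'"
        for Z Z'
      proof -
        obtain I I' where "ideal I R" "J \<subseteq> I" "Z = ?\<psi> I" "ideal I' R" "J \<subseteq> I'" "Z' = ?\<psi> I'"
          using ex[of Z] ex[of Z'] \<open>Z \<in> _\<close> \<open>Z' \<in> _\<close> by auto
        then show ?thesis using \<open>Z \<subset> Z'\<close> un by (metis Union_mono psubset_eq)
      qed
    qed
    show "chain_sup {I. ideal I R \<and> J \<subseteq> I} \<le> chain_sup {I. ideal I (R Quot J)}"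
    proof (rule chain_sup_mono[where \<phi> = ?\<psi>])
      show "?\<psi> I \<in> {I. ideal I (R Quot J)}" if "I \<in> {I. ideal I R \<and> J \<subseteq> I}" for I
        using bij that unfolding bij_betw_def by blast
      show "?\<psi> I \<subset> ?\<psi> I'"
        if "I \<in> {I. ideal I R \<and> J \<subseteq> I}" "I' \<in> {I. ideal I R \<and> J \<subseteq> I}" "I \<subset> I'" for I I'
        using that un[of I] un[of I'] by (metis (no_types, lifting) image_mono mem_Collect_eq psubset_eq)
    qed
  qed
qed

context
  fixes T :: "('a, 'm) ring_scheme" and R :: "('b, 'n) ring_scheme" and h
  assumes T: "ring T" and R: "ring R" and h: "h \<in> ring_iso T R"
begin

lemma iso_image_eq_vimage:
  assumes "I \<subseteq> carrier T"
  shows "h ` I = {r \<in> carrier R. inv_into (carrier T) h r \<in> I}"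
proof -
  have "bij_betw h (carrier T) (carrier R)" using h by (simp add: ring_iso_def)
  then show ?thesis using assms
    by (auto simp: bij_betw_def inv_into_f_f subset_iff f_inv_into_f intro!: image_eqI)
qed

lemma iso_inverse_hom: "ring_hom_ring R T (inv_into (carrier T) h)"
  using ring_iso_set_sym[OF T h] T R
  by (simp add: ring_hom_ring_axioms_def ring_hom_ring_def ring_iso_def)

lemma iso_image_ideal:
  assumes "ideal I T"
  shows "ideal (h ` I) R"
proof -
  have "I \<subseteq> carrier T" using assms by (meson additive_subgroup.a_subset ideal.axioms(1))
  then show ?thesis
    using ring_hom_ring.ideal_vimage[OF iso_inverse_hom assms] by (simp add: iso_image_eq_vimage)
qed

lemma iso_image_primeideal:
  assumes "primeideal I T" "cring R"
  shows "primeideal (h ` I) R"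
proof -
  have "I \<subseteq> carrier T"
    using assms by (meson additive_subgroup.a_subset ideal.axioms(1) primeideal.axioms(1))
  then show ?thesis
    using ring_hom_ring.primeideal_vimage[OF iso_inverse_hom assms(2,1)]
    by (simp add: iso_image_eq_vimage)
qed

lemma iso_image_psubset:
  assumes "A \<subseteq> carrier T" "B \<subseteq> carrier T" "A \<subset> B"
  shows "h ` A \<subset> h ` B"
proof -
  have "inj_on h (carrier T)" using h by (simp add: ring_iso_def bij_betw_def)
  then show ?thesis using assms by (metis image_mono inj_on_image_eq_iff psubset_eq)
qed

lemma iso_krull_dim_le:
  assumes "cring R"
  shows "krull_dim T \<le> krull_dim R"
  unfolding krull_dim_def
proof (rule chain_sup_mono[where \<phi> = "(`) h"])
  show "h ` A \<in> {P. primeideal P R}" if "A \<in> {P. primeideal P T}" for A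
    using that iso_image_primeideal[OF _ assms] by simp
  show "h ` A \<subset> h ` B" if "A \<in> {P. primeideal P T}" "B \<in> {P. primeideal P T}" "A \<subset> B" for A B
    using that
    by (intro iso_image_psubset)
      (auto dest!: primeideal.axioms(1) ideal.axioms(1) dest: additive_subgroup.a_Hcarr)
qed

lemma iso_chain_sup_le:
  "chain_sup {I. ideal I T \<and> J \<subseteq> I} \<le> chain_sup {I. ideal I R \<and> h ` J \<subseteq> I}"
proof (rule chain_sup_mono[where \<phi> = "(`) h"])
  show "h ` A \<in> {I. ideal I R \<and> h ` J \<subseteq> I}" if "A \<in> {I. ideal I T \<and> J \<subseteq> I}" for A
    using that iso_image_ideal image_mono[of J A h] by simp
  show "h ` A \<subset> h ` B"
    if "A \<in> {I. ideal I T \<and> J \<subseteq> I}" "B \<in> {I. ideal I T \<and> J \<subseteq> I}" "A \<subset> B" for A B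
    using that
    by (intro iso_image_psubset) (auto dest!: ideal.axioms(1) dest: additive_subgroup.a_Hcarr)
qed

lemma iso_image_max_ideal: "h ` max_ideal T = max_ideal R"
proof -
  have inj: "inj_on h (carrier T)" and surj: "h ` carrier T = carrier R"
    using h by (auto simp: ring_iso_def bij_betw_def)
  have one: "h \<one>\<^bsub>T\<^esub> = \<one>\<^bsub>R\<^esub>" using ring_iso_memE(4)[OF h] .
  have mult: "h (x \<otimes>\<^bsub>T\<^esub> y) = h x \<otimes>\<^bsub>R\<^esub> h y" if "x \<in> carrier T" "y \<in> carrier T" for x y
    using ring_iso_memE(2)[OF h that] .
  have closed: "x \<otimes>\<^bsub>T\<^esub> y \<in> carrier T" "\<one>\<^bsub>T\<^esub> \<in> carrier T"
    if "x \<in> carrier T" "y \<in> carrier T" for x y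
    using that T by (simp_all add: ring.ring_simprules)
  have eq_one: "x \<otimes>\<^bsub>T\<^esub> y = \<one>\<^bsub>T\<^esub> \<longleftrightarrow> h x \<otimes>\<^bsub>R\<^esub> h y = \<one>\<^bsub>R\<^esub>"
    if "x \<in> carrier T" "y \<in> carrier T" for x y
    using inj_onD[OF inj, of "x \<otimes>\<^bsub>T\<^esub> y" "\<one>\<^bsub>T\<^esub>"] closed[OF that] mult[OF that] one by auto
  have "h x \<in> Units R \<longleftrightarrow> x \<in> Units T" if "x \<in> carrier T" for x
  proof -
    have "h x \<in> Units R \<longleftrightarrow>
        (\<exists>y \<in> h ` carrier T. y \<otimes>\<^bsub>R\<^esub> h x = \<one>\<^bsub>R\<^esub> \<and> h x \<otimes>\<^bsub>R\<^esub> y = \<one>\<^bsub>R\<^esub>)"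
      unfolding Units_def surj using that surj by auto
    also have "\<dots> \<longleftrightarrow> x \<in> Units T"
      unfolding Units_def using that eq_one by auto
    finally show ?thesis .
  qed
  then show ?thesis
    unfolding max_ideal_def surj[symmetric] by auto
qed

lemma iso_image_ideal_prod:
  assumes "I \<subseteq> carrier T" "J \<subseteq> carrier T"
  shows "h ` ideal_prod T I J = ideal_prod R (h ` I) (h ` J)"
proof -
  interpret T: ring T by (fact T)
  have carr: "x \<in> carrier T" if "x \<in> ideal_prod T I J" for x
    using that assms by induction auto
  have "h x \<in> ideal_prod R (h ` I) (h ` J)" if "x \<in> ideal_prod T I J" for x
    using that
  proof induction
    case (prod i j)
    then have "h (i \<otimes>\<^bsub>T\<^esub> j) = h i \<otimes>\<^bsub>R\<^esub> h j"
      using assms ring_iso_memE(2)[OF h, of i j] by blast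
    then show ?case using prod by (simp add: ideal_prod.prod)
  next
    case (sum s1 s2)
    then have "h (s1 \<oplus>\<^bsub>T\<^esub> s2) = h s1 \<oplus>\<^bsub>R\<^esub> h s2"
      using carr ring_iso_memE(3)[OF h, of s1 s2] by blast
    then show ?case using sum by (simp add: ideal_prod.sum)
  qed
  moreover have "y \<in> h ` ideal_prod T I J" if "y \<in> ideal_prod R (h ` I) (h ` J)" for y
    using that
  proof induction
    case (prod y1 y2)
    then obtain i j where "i \<in> I" "j \<in> J" "y1 = h i" "y2 = h j" by auto
    then have "h (i \<otimes>\<^bsub>T\<^esub> j) = y1 \<otimes>\<^bsub>R\<^esub> y2"
      using assms ring_iso_memE(2)[OF h, of i j] by blast
    then show ?case using ideal_prod.prod[OF \<open>i \<in> I\<close> \<open>j \<in> J\<close>] by (metis imageI)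
  next
    case (sum y1 y2)
    then obtain i j where ij: "i \<in> ideal_prod T I J" "j \<in> ideal_prod T I J" "y1 = h i" "y2 = h j"
      by auto
    then have "h (i \<oplus>\<^bsub>T\<^esub> j) = y1 \<oplus>\<^bsub>R\<^esub> y2"
      using carr ring_iso_memE(3)[OF h, of i j] by blast
    then show ?case using ideal_prod.sum[OF ij(1,2)] by (metis imageI)
  qed
  ultimately show ?thesis by blast
qed

end

lemma ideal_pow_0: "ideal_pow R J 0 = carrier R"
  by (simp add: ideal_pow_def ideals_set_def)

lemma ideal_pow_Suc: "ideal_pow R J (Suc k) = ideal_prod R (ideal_pow R J k) J"
  by (simp add: ideal_pow_def ideals_set_def)

lemma ideal_ideal_pow:
  assumes "ring R" "ideal J R"
  shows "ideal (ideal_pow R J k) R"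
proof (induction k)
  case 0
  then show ?case using ring.oneideal[OF assms(1)] by (simp add: ideal_pow_0)
next
  case (Suc k)
  then show ?case using ring.ideal_prod_is_ideal[OF assms(1) _ assms(2)] by (simp add: ideal_pow_Suc)
qed

lemma iso_image_ideal_pow:
  assumes "ring T" "ring R" "h \<in> ring_iso T R" "ideal J T"
  shows "h ` ideal_pow T J k = ideal_pow R (h ` J) k"
proof (induction k)
  case 0
  then show ?case using assms(3) by (simp add: ideal_pow_0 ring_iso_def bij_betw_def)
next
  case (Suc k)
  have "ideal_pow T J k \<subseteq> carrier T" "J \<subseteq> carrier T"
    using ideal_ideal_pow[OF assms(1,4)] assms(4)
    by (meson additive_subgroup.a_subset ideal.axioms(1))+
  then show ?case
    using iso_image_ideal_prod[OF assms(1-3)] Suc by (simp add: ideal_pow_Suc)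
qed

lemma multiplicity_local_iso:
  assumes "T \<simeq> R" "cring T" "cring R" "ideal (max_ideal R) R"
  shows "multiplicity_local T = multiplicity_local R"
proof -
  have T: "ring T" and R: "ring R" using assms by (auto intro: cring.axioms)
  obtain h where h: "h \<in> ring_iso T R" using assms(1) by (auto simp: is_ring_iso_def)
  define h' where "h' = inv_into (carrier T) h"
  have h': "h' \<in> ring_iso R T" using ring_iso_set_sym[OF T h] by (simp add: h'_def)
  have dim: "krull_dim T = krull_dim R"
    using iso_krull_dim_le[OF T R h assms(3)] iso_krull_dim_le[OF R T h' assms(2)] by (rule antisym)
  have m': "h' ` max_ideal R = max_ideal T" using iso_image_max_ideal[OF R T h'] .
  have m: "h ` max_ideal T = max_ideal R" using iso_image_max_ideal[OF T R h] .
  have mT: "ideal (max_ideal T) T"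
    using iso_image_ideal[OF R T h' assms(4)] m' by simp
  have "ring_length (T Quot ideal_pow T (max_ideal T) k) = ring_length (R Quot ideal_pow R (max_ideal R) k)"
    for k
    using iso_chain_sup_le[OF T R h, of "ideal_pow T (max_ideal T) k"]
      iso_chain_sup_le[OF R T h', of "ideal_pow R (max_ideal R) k"]
    unfolding ring_length_Quot[OF T ideal_ideal_pow[OF T mT]]
      ring_length_Quot[OF R ideal_ideal_pow[OF R assms(4)]]
      iso_image_ideal_pow[OF T R h mT] iso_image_ideal_pow[OF R T h' assms(4)] m m'
    by (rule antisym)
  then show ?thesis unfolding multiplicity_local_def dim by simp
qed

section \<open>Subrings of commutative rings\<close>

definition subring_on :: "'a::comm_ring_1 set \<Rightarrow> 'a ring" where
  "subring_on A = ring_of_type_algebra\<lparr>carrier := A\<rparr>"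

lemma subring_on_simps [simp]:
  "carrier (subring_on A) = A" "monoid.mult (subring_on A) = (*)" "monoid.one (subring_on A) = 1"
  "ring.zero (subring_on A) = 0" "add (subring_on A) = (+)"
  by (simp_all add: subring_on_def ring_of_type_algebra_def)

locale subring_set =
  fixes A :: "'a::comm_ring_1 set"
  assumes zero_mem: "0 \<in> A" and one_mem: "1 \<in> A"
    and add_mem: "a \<in> A \<Longrightarrow> b \<in> A \<Longrightarrow> a + b \<in> A"
    and uminus_mem: "a \<in> A \<Longrightarrow> - a \<in> A"
    and mult_mem: "a \<in> A \<Longrightarrow> b \<in> A \<Longrightarrow> a * b \<in> A"
begin

lemma diff_mem: "a \<in> A \<Longrightarrow> b \<in> A \<Longrightarrow> a - b \<in> A"
  using add_mem[of a "- b"] uminus_mem by simp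

lemma power_mem: "a \<in> A \<Longrightarrow> a ^ k \<in> A"
  by (induction k) (auto simp: one_mem mult_mem)

lemma sum_mem: "(\<And>i. i \<in> K \<Longrightarrow> a i \<in> A) \<Longrightarrow> sum a K \<in> A"
  by (induction K rule: infinite_finite_induct) (auto simp: zero_mem add_mem)

lemma cring_subring_on: "cring (subring_on A)"
proof (rule cringI)
  show "abelian_group (subring_on A)"
    by (rule abelian_groupI)
      (auto simp: add_mem zero_mem algebra_simps intro: bexI[OF _ uminus_mem])
  show "Group.comm_monoid (subring_on A)"
    by (rule comm_monoidI) (auto simp: mult_mem one_mem algebra_simps)
qed (auto simp: algebra_simps)

lemma ring_subring_on: "ring (subring_on A)"
  using cring_subring_on by (rule cring.axioms)

lemma ideal_subring_on_iff:
  "ideal I (subring_on A) \<longleftrightarrow>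
     I \<subseteq> A \<and> 0 \<in> I \<and> (\<forall>a\<in>I. \<forall>b\<in>I. a + b \<in> I) \<and> (\<forall>r\<in>A. \<forall>a\<in>I. r * a \<in> I)"
    (is "?L \<longleftrightarrow> ?R")
proof
  assume ?L
  then interpret ideal I "subring_on A" .
  show ?R
    using a_subset additive_subgroup.zero_closed[OF is_additive_subgroup]
      additive_subgroup.a_closed[OF is_additive_subgroup] I_l_closed by auto
next
  assume R: ?R
  interpret cring "subring_on A" by (rule cring_subring_on)
  show ?L
  proof (rule idealI)
    show "ring (subring_on A)" by (rule ring_subring_on)
    show "subgroup I (add_monoid (subring_on A))"
    proof (rule subgroup.intro)
      show "I \<subseteq> carrier (add_monoid (subring_on A))" "\<one>\<^bsub>add_monoid (subring_on A)\<^esub> \<in> I"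
        using R by auto
      show "inv\<^bsub>add_monoid (subring_on A)\<^esub> a \<in> I" if "a \<in> I" for a
      proof -
        have "a \<in> A" using that R by auto
        then have "inv\<^bsub>add_monoid (subring_on A)\<^esub> a = - a"
          unfolding a_inv_def[symmetric] using minus_equality[of "- a" a] uminus_mem by auto
        moreover have "- 1 * a \<in> I" using R that uminus_mem[OF one_mem] by blast
        ultimately show ?thesis by simp
      qed
      show "a \<otimes>\<^bsub>add_monoid (subring_on A)\<^esub> b \<in> I" if "a \<in> I" "b \<in> I" for a b
        using that R by simp
    qed
    show "a \<otimes>\<^bsub>subring_on A\<^esub> x \<in> I" if "a \<in> I" "x \<in> carrier (subring_on A)" for a x
      using R that by (simp add: mult.commute[of a])
  qed (use R in auto)
qed

lemma Units_subring_on: "Units (subring_on A) = {u \<in> A. \<exists>v\<in>A. u * v = 1}"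
  by (auto simp: Units_def mult.commute)

end

lemma rcoset_subring_on: "I +>\<^bsub>subring_on A\<^esub> x = (\<lambda>i. i + x) ` I"
  by (auto simp: a_r_coset_def')

section \<open>Subrings of finite codimension in the power series ring\<close>

lemma fps_X_power_dvd_iff: "fps_X ^ k dvd (\<alpha> :: 'k::field fps) \<longleftrightarrow> (\<forall>i<k. \<alpha> $ i = 0)"
proof
  assume "fps_X ^ k dvd \<alpha>"
  then show "\<forall>i<k. \<alpha> $ i = 0" by (auto simp: fps_X_power_mult_nth elim!: dvdE)
next
  assume "\<forall>i<k. \<alpha> $ i = 0"
  then have "\<alpha> = fps_X ^ k * fps_shift k \<alpha>"
    by (auto simp: fps_eq_iff fps_X_power_mult_nth)
  then show "fps_X ^ k dvd \<alpha>" by (metis dvd_triv_left)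
qed

lemma fps_X_power_dvd_Suc:
  assumes "fps_X ^ k dvd (\<alpha> :: 'k::field fps)" "\<alpha> $ k = 0"
  shows "fps_X ^ Suc k dvd \<alpha>"
  using assms unfolding fps_X_power_dvd_iff by (auto simp: less_Suc_eq)

lemma fps_decompose:
  assumes "(\<alpha> :: 'k::field fps) \<noteq> 0"
  obtains r \<beta> where "\<alpha> = fps_X ^ r * \<beta>" "\<beta> $ 0 \<noteq> 0"
proof
  show "\<alpha> = fps_X ^ subdegree \<alpha> * fps_shift (subdegree \<alpha>) \<alpha>"
    by (auto simp: fps_eq_iff fps_X_power_mult_nth)
  show "fps_shift (subdegree \<alpha>) \<alpha> $ 0 \<noteq> 0" using assms by simp
qed

text \<open>A strict inclusion of subspaces is seen by the set of orders of their elements: among the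
  elements of the larger space outside the smaller one, one of maximal order has an order that does
  not occur in the smaller space, because otherwise subtracting a multiple would raise it.\<close>

lemma card_orders_less:
  fixes I J :: "'k::field fps set"
  assumes sub: "\<And>a b. a \<in> I \<Longrightarrow> b \<in> I \<Longrightarrow> a + b \<in> I"
    and subJ: "\<And>a b. a \<in> J \<Longrightarrow> b \<in> J \<Longrightarrow> a + b \<in> J"
    and scI: "\<And>c a. a \<in> I \<Longrightarrow> fps_const c * a \<in> I"
    and scJ: "\<And>c a. a \<in> J \<Longrightarrow> fps_const c * a \<in> J"
    and M: "\<And>a. fps_X ^ M dvd a \<Longrightarrow> a \<in> I" and "I \<subset> J"
  shows "card {j. j < M \<and> (\<exists>a\<in>I. fps_X ^ j dvd a \<and> a $ j \<noteq> 0)}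
       < card {j. j < M \<and> (\<exists>a\<in>J. fps_X ^ j dvd a \<and> a $ j \<noteq> 0)}" (is "card ?v < card ?w")
proof (rule psubset_card_mono)
  show "finite ?w" by simp
  define P where "P j \<longleftrightarrow> (\<exists>a \<in> J - I. fps_X ^ j dvd a)" for j
  have "P 0" using \<open>I \<subset> J\<close> by (auto simp: P_def)
  moreover have bound: "j < M" if "P j" for j
    using that M by (meson DiffD2 P_def dvd_trans le_imp_power_dvd not_le)
  ultimately obtain j where j: "P j" "\<And>i. P i \<Longrightarrow> i \<le> j"
    by (metis (no_types, lifting) GreatestI_nat Greatest_le_nat less_imp_le)
  obtain a where a: "a \<in> J" "a \<notin> I" "fps_X ^ j dvd a" using j(1) by (auto simp: P_def)
  have aj: "a $ j \<noteq> 0"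
    using fps_X_power_dvd_Suc[of j a] a j(2)[of "Suc j"] by (force simp: P_def)
  have "j \<notin> ?v"
  proof
    assume "j \<in> ?v"
    then obtain b where b: "b \<in> I" "fps_X ^ j dvd b" "b $ j \<noteq> 0" by auto
    define c where "c = - a $ j / b $ j"
    define a' where "a' = a + fps_const c * b"
    have "a' \<in> J" using a b \<open>I \<subset> J\<close> by (auto simp: a'_def intro!: subJ scJ)
    moreover have "a' \<notin> I"
    proof
      assume "a' \<in> I"
      then have "a' + fps_const (- c) * b \<in> I" using b by (intro sub scI)
      moreover have "a' + fps_const (- c) * b = a"
        by (simp add: a'_def fps_const_neg[symmetric] del: fps_const_neg)
      ultimately show False using a by simp
    qed
    moreover have "fps_X ^ Suc j dvd a'"
      using a b by (intro fps_X_power_dvd_Suc) (auto simp: a'_def c_def)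
    ultimately have "P (Suc j)" by (auto simp: P_def)
    then show False using j(2)[of "Suc j"] by simp
  qed
  moreover have "j \<in> ?w" using a aj bound[OF j(1)] by auto
  moreover have "?v \<subseteq> ?w" using \<open>I \<subset> J\<close> by auto
  ultimately show "?v \<subset> ?w" by blast
qed

text \<open>A subalgebra of \<open>k[[t]]\<close> of finite codimension; \<open>e\<close> is the smallest order of a non-unit.\<close>

locale cofinite_power_series_ring = subring_set S
  for S :: "'k::field fps set" +
  fixes N e :: nat and z
  assumes const_mem: "fps_const c \<in> S"
    and conductor: "fps_X ^ N dvd \<alpha> \<Longrightarrow> \<alpha> \<in> S"
    and e_pos: "e > 0"
    and order_ge: "\<alpha> \<in> S \<Longrightarrow> \<alpha> $ 0 = 0 \<Longrightarrow> fps_X ^ e dvd \<alpha>"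
    and z_mem: "z \<in> S" and z_order: "fps_X ^ e dvd z" "z $ e \<noteq> 0"
begin

abbreviation "R \<equiv> subring_on S"

definition "\<mm> = {\<alpha> \<in> S. \<alpha> $ 0 = 0}"

text \<open>With \<open>s = c (1 - u)\<close> the inverse of \<open>s\<close> is up to \<open>c\<close> a geometric series in \<open>u\<close>; its tail is
  divisible by \<open>t\<^sup>N\<close>.\<close>

lemma inverse_mem:
  assumes "s \<in> S" "s $ 0 \<noteq> 0"
  shows "inverse s \<in> S"
proof -
  define c where "c = s $ 0"
  define u where "u = 1 - fps_const (inverse c) * s"
  have uS: "u \<in> S" using assms by (auto simp: u_def intro!: diff_mem one_mem mult_mem const_mem)
  have "u $ 0 = 0" using assms by (simp add: u_def c_def)
  then have "fps_X ^ 1 dvd u" using fps_X_power_dvd_iff[of 1 u] by simp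
  then have "fps_X ^ N dvd u ^ N" using dvd_power_same[of fps_X u N] by simp
  have s: "s = fps_const c * (1 - u)"
    using assms by (simp add: u_def c_def mult.assoc[symmetric])
  have u1: "(1 - u) $ 0 \<noteq> 0" using \<open>u $ 0 = 0\<close> by simp
  have inv: "inverse s = fps_const (inverse c) * inverse (1 - u)"
    unfolding s by (simp add: fps_inverse_mult fps_const_inverse)
  have one: "(1 - u) * (\<Sum>i<N. u ^ i) + u ^ N = 1"
    unfolding one_diff_power_eq[symmetric] by simp
  have "inverse (1 - u) = inverse (1 - u) * ((1 - u) * (\<Sum>i<N. u ^ i) + u ^ N)"
    unfolding one by simp
  also have "\<dots> = (inverse (1 - u) * (1 - u)) * (\<Sum>i<N. u ^ i) + u ^ N * inverse (1 - u)"
    by (simp only: algebra_simps)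
  also have "inverse (1 - u) * (1 - u) = 1" using inverse_mult_eq_1[OF u1] .
  finally have "inverse (1 - u) = (\<Sum>i<N. u ^ i) + u ^ N * inverse (1 - u)" by simp
  moreover have "(\<Sum>i<N. u ^ i) + u ^ N * inverse (1 - u) \<in> S"
    using \<open>fps_X ^ N dvd u ^ N\<close> by (intro add_mem sum_mem power_mem uS conductor) simp
  ultimately show ?thesis unfolding inv using const_mem mult_mem by metis
qed

lemma max_ideal_eq: "max_ideal R = \<mm>"
proof -
  have "(\<exists>v\<in>S. u * v = 1) \<longleftrightarrow> u $ 0 \<noteq> 0" if "u \<in> S" for u
  proof
    assume "\<exists>v\<in>S. u * v = 1"
    then obtain v where "u * v = 1" by blast
    then have "(u * v) $ 0 = 1" by simp
    then show "u $ 0 \<noteq> 0" by auto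
  next
    assume "u $ 0 \<noteq> 0"
    then show "\<exists>v\<in>S. u * v = 1"
      using inverse_mem[OF that] inverse_mult_eq_1'[of u] by blast
  qed
  then show ?thesis by (auto simp: max_ideal_def Units_subring_on \<mm>_def)
qed

lemma ideal_\<mm>: "ideal \<mm> R"
  unfolding ideal_subring_on_iff by (auto simp: \<mm>_def zero_mem add_mem mult_mem)

lemma order_pow_ge:
  assumes "\<alpha> \<in> ideal_pow R \<mm> k"
  shows "fps_X ^ (e * k) dvd \<alpha>"
  using assms
proof (induction k arbitrary: \<alpha>)
  case (Suc k)
  from Suc.prems have "\<alpha> \<in> ideal_prod R (ideal_pow R \<mm> k) \<mm>" by (simp add: ideal_pow_Suc)
  then show ?case
  proof induction
    case (prod i j)
    have "fps_X ^ (e * k) * fps_X ^ e dvd i * j"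
      using prod Suc.IH order_ge by (intro mult_dvd_mono) (auto simp: \<mm>_def)
    then show ?case by (simp add: power_add mult.commute)
  qed auto
qed simp

lemma z_power_mem: "z ^ k \<in> ideal_pow R \<mm> k"
proof (induction k)
  case (Suc k)
  have "z $ 0 = 0" using z_order e_pos by (auto simp: fps_X_power_dvd_iff)
  then have "z \<in> \<mm>" using z_mem by (auto simp: \<mm>_def)
  then show ?case using ideal_prod.prod[OF Suc, of z \<mm> R] by (simp add: ideal_pow_Suc mult.commute)
qed (simp add: ideal_pow_0 one_mem)

text \<open>As \<open>z\<close> is \<open>t\<^sup>e\<close> times a unit of the power series ring, dividing such a series by \<open>z\<^sup>k\<close> leaves a
  multiple of \<open>t\<^sup>N\<^sup>+\<^sup>1\<close>, which lies in \<open>\<mm>\<close>.\<close>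

lemma conductor_pow:
  assumes "fps_X ^ (e * k + N + 1) dvd \<alpha>"
  shows "\<alpha> \<in> ideal_pow R \<mm> (Suc k)"
proof -
  obtain u where u: "z = fps_X ^ e * u" using z_order(1) by (elim dvdE)
  have u0: "u $ 0 \<noteq> 0" using z_order(2) by (simp add: u fps_X_power_mult_nth)
  obtain \<beta> where "\<alpha> = fps_X ^ (e * k + N + 1) * \<beta>" using assms by (elim dvdE)
  define \<gamma> where "\<gamma> = fps_X ^ (N + 1) * inverse u ^ k * \<beta>"
  have "u ^ k * inverse u ^ k = 1"
    using inverse_mult_eq_1'[OF u0] by (simp add: power_mult_distrib[symmetric])
  have "z ^ k * \<gamma> = fps_X ^ (e * k) * fps_X ^ (N + 1) * (u ^ k * inverse u ^ k) * \<beta>"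
    by (simp add: u \<gamma>_def power_mult_distrib power_mult mult_ac)
  also have "\<dots> = \<alpha>"
    unfolding \<open>u ^ k * inverse u ^ k = 1\<close> by (simp add: \<open>\<alpha> = _\<close> power_add mult_ac)
  finally have \<alpha>: "\<alpha> = z ^ k * \<gamma>" ..
  have d: "fps_X ^ (N + 1) dvd \<gamma>" by (simp add: \<gamma>_def mult.assoc)
  then have "fps_X ^ N dvd \<gamma>" using le_imp_power_dvd dvd_trans by (metis le_add1)
  moreover have "\<gamma> $ 0 = 0" using d unfolding fps_X_power_dvd_iff by simp
  ultimately have "\<gamma> \<in> \<mm>" by (simp add: \<mm>_def conductor)
  then show ?thesis
    unfolding \<alpha> ideal_pow_Suc using ideal_prod.prod[OF z_power_mem[of k], where j = \<gamma> and J = \<mm> and R = R] by simp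
qed

text \<open>For \<open>0 \<noteq> a \<in> P\<close>, a high power of any element of \<open>\<mm>\<close> is \<open>a\<close> times a multiple of \<open>t\<^sup>N\<close>.\<close>

lemma nonzero_prime_eq_\<mm>:
  assumes "primeideal P R" "P \<noteq> {0}"
  shows "P = \<mm>"
proof -
  interpret primeideal P R by fact
  have id: "ideal P R" by (rule primeideal.axioms(1)[OF assms(1)])
  then have P: "P \<subseteq> S" "0 \<in> P" "\<And>r a. r \<in> S \<Longrightarrow> a \<in> P \<Longrightarrow> r * a \<in> P"
    by (auto simp: ideal_subring_on_iff)
  have one: "1 \<notin> P" using I_notcarr P(1,3) by fastforce
  have "P \<subseteq> \<mm>"
  proof
    fix s assume "s \<in> P"
    then show "s \<in> \<mm>"
      using P one inverse_mem[of s] inverse_mult_eq_1[of s] by (force simp: \<mm>_def)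
  qed
  moreover have "x \<in> P" if "x \<in> \<mm>" for x
  proof -
    obtain a where a: "a \<in> P" "a \<noteq> 0" using assms(2) P(2) by blast
    obtain r a' where a': "a = fps_X ^ r * a'" "a' $ 0 \<noteq> 0" using fps_decompose[OF a(2)] .
    have "fps_X ^ 1 dvd x" unfolding fps_X_power_dvd_iff using that by (auto simp: \<mm>_def)
    then have "fps_X ^ (r + N) dvd x ^ (r + N)" using dvd_power_same[of fps_X x] by simp
    then obtain y where y: "x ^ (r + N) = fps_X ^ (r + N) * y" by (elim dvdE)
    have "x ^ (r + N) = fps_X ^ r * fps_X ^ N * (a' * inverse a') * y"
      using inverse_mult_eq_1'[OF a'(2)] y by (simp add: power_add)
    then have "x ^ (r + N) = (fps_X ^ N * (inverse a' * y)) * a"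
      by (simp add: a'(1) mult_ac)
    moreover have "fps_X ^ N * (inverse a' * y) \<in> S" by (intro conductor) simp
    ultimately have "x ^ (r + N) \<in> P" using P(3) a(1) by simp
    moreover have "x \<in> S" using that by (simp add: \<mm>_def)
    ultimately show "x \<in> P"
    proof (induction "r + N" arbitrary: r N)
      case 0
      then show ?case using one by simp
    next
      case (Suc k)
      have "x * x ^ k \<in> P" using Suc by (simp add: Suc(2)[symmetric])
      then have "x \<in> P \<or> x ^ k \<in> P" using I_prime[of x "x ^ k"] Suc.prems(2) power_mem by simp
      then show ?case using Suc(1)[of k 0] Suc.prems by auto
    qed
  qed
  ultimately show ?thesis by blast
qed

lemma primeideal_zero: "primeideal {0} R"
proof (rule primeidealI)
  show "ideal {0} R" by (auto simp: ideal_subring_on_iff zero_mem)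
  show "carrier R \<noteq> {0}" using one_mem by auto
qed (auto simp: cring_subring_on)

lemma primeideal_\<mm>: "primeideal \<mm> R"
proof (rule primeidealI)
  have "1 \<notin> \<mm>" by (simp add: \<mm>_def)
  then show "carrier R \<noteq> \<mm>" using one_mem by auto
  show "ideal \<mm> R" by (rule ideal_\<mm>)
  show "cring R" by (rule cring_subring_on)
qed (auto simp: \<mm>_def)

lemma krull_dim_eq: "krull_dim R = enat 1"
proof -
  have F: "{P. primeideal P R} = {{0}, \<mm>}"
    using nonzero_prime_eq_\<mm> primeideal_zero primeideal_\<mm> by auto
  have "z \<in> \<mm>" "z \<noteq> 0"
    using z_power_mem[of 1] z_mem z_order e_pos by (auto simp: \<mm>_def fps_X_power_dvd_iff)
  then have strict: "{0} \<subset> \<mm>" by (auto simp: \<mm>_def zero_mem)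
  have "chain_sup {{0}, \<mm>} \<le> enat 1"
    by (rule chain_sup_le[where rank = "\<lambda>P. if P = {0} then 0 else 1"]) (use strict in auto)
  moreover have "enat 1 \<le> chain_sup {{0}, \<mm>}"
    by (rule chain_sup_ge[where c = "\<lambda>i. if i = 0 then {0} else \<mm>"]) (use strict in auto)
  ultimately show ?thesis unfolding krull_dim_def F by simp
qed

text \<open>A chain of ideals is a chain of subspaces that contain \<open>t\<^sup>M k[[t]]\<close> for \<open>M = e k + N + 1\<close>, and the
  number of orders below \<open>M\<close> grows along it.\<close>

lemma length_upper: "ring_length (R Quot ideal_pow R \<mm> (Suc k)) \<le> enat (e * k + N + 1)"
proof -
  let ?M = "e * k + N + 1"
  have *: "a + b \<in> I" "fps_const c * a \<in> I" if "ideal I R" "a \<in> I" "b \<in> I" for I a b c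
    using that const_mem by (auto simp: ideal_subring_on_iff)
  show ?thesis
    unfolding ring_length_Quot[OF ring_subring_on ideal_ideal_pow[OF ring_subring_on ideal_\<mm>]]
  proof (rule chain_sup_le[where rank =
          "\<lambda>I. card {j. j < ?M \<and> (\<exists>a\<in>I. fps_X ^ j dvd a \<and> a $ j \<noteq> 0)}"], goal_cases)
    case (1 I)
    have "card {j. j < ?M \<and> (\<exists>a\<in>I. fps_X ^ j dvd a \<and> a $ j \<noteq> 0)} \<le> card {..<?M}"
      by (intro card_mono) auto
    then show ?case by simp
  next
    case (2 I J)
    then show ?case
      using conductor_pow[of k] by (intro card_orders_less) (auto intro: *)
  qed
qed

text \<open>The ideals \<open>t\<^sup>i k[[t]]\<close> with \<open>N \<le> i \<le> e k\<close> contain \<open>\<mm>\<^sup>k\<close>.\<close>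

lemma length_lower: "enat (e * k - N) \<le> ring_length (R Quot ideal_pow R \<mm> k)"
proof (cases "N \<le> e * k")
  case True
  show ?thesis
    unfolding ring_length_Quot[OF ring_subring_on ideal_ideal_pow[OF ring_subring_on ideal_\<mm>]]
  proof (rule chain_sup_ge[where c = "\<lambda>i. {\<alpha>. fps_X ^ (e * k - i) dvd \<alpha>}"], goal_cases)
    case (1 i)
    have "fps_X ^ (e * k - i) dvd \<alpha>" if "fps_X ^ (e * k) dvd \<alpha>" for \<alpha> :: "'k fps"
      using that dvd_trans le_imp_power_dvd diff_le_self by metis
    moreover have "\<alpha> \<in> S" if "fps_X ^ (e * k - i) dvd \<alpha>" for \<alpha>
    proof -
      have "N \<le> e * k - i" using 1 True by auto
      then show ?thesis using that conductor dvd_trans le_imp_power_dvd by metis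
    qed
    ultimately show ?case using order_pow_ge by (auto simp: ideal_subring_on_iff)
  next
    case (2 i)
    have "fps_X ^ (e * k - Suc i) dvd \<alpha>" if "fps_X ^ (e * k - i) dvd \<alpha>" for \<alpha> :: "'k fps"
      using that dvd_trans le_imp_power_dvd diff_le_mono2 by (metis lessI less_imp_le)
    moreover have "\<not> fps_X ^ (e * k - i) dvd (fps_X ^ (e * k - Suc i) :: 'k fps)"
      using 2 by (auto simp: fps_X_power_dvd_iff)
    ultimately show ?case
      by (metis (mono_tags, lifting) Collect_mono dvd_refl mem_Collect_eq psubsetI)
  qed
qed (simp flip: zero_enat_def)

text \<open>The length of \<open>S / \<mm>\<^sup>k\<close> differs from \<open>e k\<close> by a bounded amount.\<close>

theorem multiplicity_eq: "multiplicity_local R = e"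
proof -
  define len where "len k = ring_length (R Quot ideal_pow R \<mm> k)" for k
  have up: "real (the_enat (len k)) \<le> e * real k + (real N + 1)" if "k > 0" for k
  proof -
    obtain k' where k': "k = Suc k'" using \<open>k > 0\<close> gr0_implies_Suc by blast
    obtain l where "len k = enat l" "l \<le> e * k' + N + 1"
      using length_upper[of k'] unfolding len_def k' by (metis enat_ile enat_ord_simps(1))
    moreover have "e * k' + N + 1 \<le> e * k + N + 1" by (simp add: k')
    ultimately have "the_enat (len k) \<le> e * k + N + 1" by (metis le_trans the_enat.simps)
    then have "real (the_enat (len k)) \<le> real (e * k + N + 1)" by (simp only: of_nat_le_iff)
    then show ?thesis by simp
  qed
  have low: "e * real k - real N \<le> real (the_enat (len k))" if "k > 0" for k
  proof -
    obtain k' where k': "k = Suc k'" using \<open>k > 0\<close> gr0_implies_Suc by blast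
    obtain l where "len k = enat l"
      using length_upper[of k'] unfolding len_def k' by (metis enat_ile)
    then have "e * k - N \<le> the_enat (len k)" using length_lower[of k] by (simp add: len_def)
    then have "real (e * k) \<le> real (the_enat (len k)) + real N"
      by (metis le_diff_conv of_nat_add of_nat_le_iff)
    then show ?thesis by simp
  qed
  have lim: "(\<lambda>k. real e + c / real k) \<longlonglongrightarrow> real e" for c
    using tendsto_add[OF tendsto_const lim_const_over_n[of c], of "real e"] by simp
  have "(\<lambda>k. real (the_enat (len k)) / real k) \<longlonglongrightarrow> real e"
  proof (rule tendsto_sandwich[OF _ _ lim[of "- real N"] lim[of "real N + 1"]])
    show "\<forall>\<^sub>F k in sequentially. real e + (- real N) / real k \<le> real (the_enat (len k)) / real k"
      using eventually_gt_at_top[of "0::nat"]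
    proof eventually_elim
      case (elim k)
      then have "real e + (- real N) / real k = (e * real k - real N) / real k"
        by (simp add: diff_divide_distrib)
      then show ?case using divide_right_mono[OF low[OF elim], of "real k"] by simp
    qed
    show "\<forall>\<^sub>F k in sequentially. real (the_enat (len k)) / real k \<le> real e + (real N + 1) / real k"
      using eventually_gt_at_top[of "0::nat"]
    proof eventually_elim
      case (elim k)
      then have "real e + (real N + 1) / real k = (e * real k + (real N + 1)) / real k"
        by (simp add: add_divide_distrib)
      then show ?case using divide_right_mono[OF up[OF elim], of "real k"] by simp
    qed
  qed
  then show ?thesis
    unfolding multiplicity_local_def krull_dim_eq max_ideal_eq Let_def len_def[symmetric]
    by (simp add: limI)
qed

end

section \<open>Completions of subrings\<close>

lemma coset_set_add:
  assumes "I \<subseteq> K" "0 \<in> I" and add: "\<And>a b. a \<in> K \<Longrightarrow> b \<in> K \<Longrightarrow> a + b \<in> K"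
  shows "(I +>\<^bsub>subring_on A\<^esub> a) <+>\<^bsub>subring_on A'\<^esub> K = K +>\<^bsub>subring_on A''\<^esub> a"
proof -
  have "x \<in> (I +>\<^bsub>subring_on A\<^esub> a) <+>\<^bsub>subring_on A'\<^esub> K \<longleftrightarrow> (\<exists>i\<in>I. \<exists>j\<in>K. x = i + a + j)" for x
    by (simp add: rcoset_subring_on set_add_def')
  moreover have "x \<in> K +>\<^bsub>subring_on A''\<^esub> a \<longleftrightarrow> (\<exists>j\<in>K. x = j + a)" for x
    by (auto simp: rcoset_subring_on)
  moreover have "(\<exists>i\<in>I. \<exists>j\<in>K. x = i + a + j) \<longleftrightarrow> (\<exists>j\<in>K. x = j + a)" for x
  proof
    assume "\<exists>i\<in>I. \<exists>j\<in>K. x = i + a + j"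
    then obtain i j where "i \<in> I" "j \<in> K" "x = i + a + j" by blast
    then show "\<exists>j\<in>K. x = j + a" using assms by (intro bexI[of _ "i + j"]) auto
  next
    assume "\<exists>j\<in>K. x = j + a"
    then obtain j where "j \<in> K" "x = 0 + a + j" by (auto simp: add.commute)
    then show "\<exists>i\<in>I. \<exists>j\<in>K. x = i + a + j" using assms(2) by blast
  qed
  ultimately show ?thesis by blast
qed

text \<open>Elements of the completion are represented by sequences whose consecutive differences lie in the
  powers of the ideal.\<close>

locale adic_subring = subring_set A for A :: "'a::comm_ring_1 set" +
  fixes J
  assumes ideal_J: "ideal J (subring_on A)"
begin

abbreviation "R \<equiv> subring_on A"
abbreviation "P k \<equiv> ideal_pow R J k"

definition "Seq = {r. (\<forall>k. r k \<in> A) \<and> (\<forall>k. r (Suc k) - r k \<in> P k)}"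

definition "cls r = (\<lambda>k. P k +>\<^bsub>R\<^esub> r k)"

abbreviation "C \<equiv> adic_completion R J"

lemma ideal_P: "ideal (P k) R"
  by (rule ideal_ideal_pow[OF ring_subring_on ideal_J])

lemma P_props:
  shows P_subset: "P k \<subseteq> A" and P_zero: "0 \<in> P k"
    and P_add: "a \<in> P k \<Longrightarrow> b \<in> P k \<Longrightarrow> a + b \<in> P k"
    and P_mult: "c \<in> A \<Longrightarrow> a \<in> P k \<Longrightarrow> c * a \<in> P k"
  using ideal_P[of k] by (auto simp: ideal_subring_on_iff)

lemma P_uminus: "a \<in> P k \<Longrightarrow> - a \<in> P k"
  using P_mult[of "- 1" a k] uminus_mem[OF one_mem] by simp

lemma P_diff: "a \<in> P k \<Longrightarrow> b \<in> P k \<Longrightarrow> a - b \<in> P k"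
  using P_add[of a k "- b"] P_uminus by simp

lemma P_sum: "(\<And>i. i \<in> K \<Longrightarrow> a i \<in> P k) \<Longrightarrow> sum a K \<in> P k"
  by (induction K rule: infinite_finite_induct) (auto simp: P_zero P_add)

lemma P_mult_right: "a \<in> P k \<Longrightarrow> c \<in> A \<Longrightarrow> a * c \<in> P k"
  using P_mult[of c a k] by (simp add: mult.commute)

lemma P_Suc_mult: "a \<in> P k \<Longrightarrow> b \<in> J \<Longrightarrow> a * b \<in> P (Suc k)"
  using ideal_prod.prod[of a "P k" b J R] by (simp add: ideal_pow_Suc)

lemma P_Suc_subset: "P (Suc k) \<subseteq> P k"
  using ring.ideal_prod_inter[OF ring_subring_on ideal_P ideal_J] by (auto simp: ideal_pow_Suc)

lemma P_antimono: "i \<le> k \<Longrightarrow> P k \<subseteq> P i"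
  by (rule lift_Suc_antimono_le[of P]) (rule P_Suc_subset)

lemma coset_eq_iff:
  assumes "a \<in> A" "b \<in> A"
  shows "P k +>\<^bsub>R\<^esub> a = P k +>\<^bsub>R\<^esub> b \<longleftrightarrow> a - b \<in> P k"
proof
  assume "P k +>\<^bsub>R\<^esub> a = P k +>\<^bsub>R\<^esub> b"
  then have "0 + a \<in> (\<lambda>i. i + b) ` P k" unfolding rcoset_subring_on using P_zero by blast
  then show "a - b \<in> P k" by auto
next
  assume ab: "a - b \<in> P k"
  have "x + a = (x + (a - b)) + b" "x + b = (x - (a - b)) + a" for x
    by simp_all
  then show "P k +>\<^bsub>R\<^esub> a = P k +>\<^bsub>R\<^esub> b"
    unfolding rcoset_subring_on using ab P_add P_diff by (blast intro: image_eqI)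
qed

lemma coset_add_P: "(P (Suc k) +>\<^bsub>R\<^esub> a) <+>\<^bsub>R\<^esub> P k = P k +>\<^bsub>R\<^esub> a"
  by (rule coset_set_add) (auto intro: P_zero P_add P_Suc_subset[THEN subsetD])

lemma carrier_Quot: "carrier (R Quot P k) = {P k +>\<^bsub>R\<^esub> a | a. a \<in> A}"
  by (auto simp: FactRing_def A_RCOSETS_def')

lemma Quot_ops:
  assumes "a \<in> A" "b \<in> A"
  shows "(P k +>\<^bsub>R\<^esub> a) \<oplus>\<^bsub>R Quot P k\<^esub> (P k +>\<^bsub>R\<^esub> b) = P k +>\<^bsub>R\<^esub> (a + b)"
    and "(P k +>\<^bsub>R\<^esub> a) \<otimes>\<^bsub>R Quot P k\<^esub> (P k +>\<^bsub>R\<^esub> b) = P k +>\<^bsub>R\<^esub> (a * b)"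
    and "\<zero>\<^bsub>R Quot P k\<^esub> = P k +>\<^bsub>R\<^esub> 0" "\<one>\<^bsub>R Quot P k\<^esub> = P k +>\<^bsub>R\<^esub> 1"
proof -
  note hom = ideal.rcos_ring_hom[OF ideal_P, of k]
  show "(P k +>\<^bsub>R\<^esub> a) \<oplus>\<^bsub>R Quot P k\<^esub> (P k +>\<^bsub>R\<^esub> b) = P k +>\<^bsub>R\<^esub> (a + b)"
    using ring_hom_add[OF hom, of a b] assms by simp
  show "(P k +>\<^bsub>R\<^esub> a) \<otimes>\<^bsub>R Quot P k\<^esub> (P k +>\<^bsub>R\<^esub> b) = P k +>\<^bsub>R\<^esub> (a * b)"
    using ring_hom_mult[OF hom, of a b] assms by simp
  show "\<one>\<^bsub>R Quot P k\<^esub> = P k +>\<^bsub>R\<^esub> 1" by (simp add: FactRing_def)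
  show "\<zero>\<^bsub>R Quot P k\<^esub> = P k +>\<^bsub>R\<^esub> 0" by (simp add: FactRing_def rcoset_subring_on)
qed

lemma Seq_telescope:
  assumes "r \<in> Seq" "k \<le> l"
  shows "r l - r k \<in> P k"
  using \<open>k \<le> l\<close>
proof (induction l rule: dec_induct)
  case base
  then show ?case by (simp add: P_zero)
next
  case (step m)
  have "r (Suc m) - r m \<in> P k" using assms(1) P_antimono[of k m] step by (auto simp: Seq_def)
  then show ?case using P_add[OF _ step.IH, of "r (Suc m) - r m"] by simp
qed

lemma Seq_closed:
  assumes "r \<in> Seq" "r' \<in> Seq"
  shows Seq_add: "(\<lambda>k. r k + r' k) \<in> Seq" and Seq_mult: "(\<lambda>k. r k * r' k) \<in> Seq"
    and Seq_uminus: "(\<lambda>k. - r k) \<in> Seq"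
proof -
  have r: "r k \<in> A" "r' k \<in> A" "r (Suc k) - r k \<in> P k" "r' (Suc k) - r' k \<in> P k" for k
    using assms by (auto simp: Seq_def)
  have "r (Suc k) + r' (Suc k) - (r k + r' k) \<in> P k" for k
    using P_add[OF r(3)[of k] r(4)[of k]] by (simp add: algebra_simps)
  then show "(\<lambda>k. r k + r' k) \<in> Seq" unfolding Seq_def using r by (auto simp: add_mem)
  have "r (Suc k) * r' (Suc k) - r k * r' k =
      r (Suc k) * (r' (Suc k) - r' k) + r' k * (r (Suc k) - r k)" for k
    by (simp add: algebra_simps)
  then show "(\<lambda>k. r k * r' k) \<in> Seq" unfolding Seq_def using r by (simp add: mult_mem P_add P_mult)
  have "- r (Suc k) - - r k \<in> P k" for k using P_uminus[OF r(3)[of k]] by simp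
  then show "(\<lambda>k. - r k) \<in> Seq" unfolding Seq_def using r by (simp add: uminus_mem)
qed

lemma Seq_const: "a \<in> A \<Longrightarrow> (\<lambda>_. a) \<in> Seq"
  by (simp add: Seq_def P_zero)

lemma carrier_completion: "carrier C = cls ` Seq"
proof -
  have C: "s \<in> carrier C \<longleftrightarrow> (\<forall>k. s k \<in> carrier (R Quot P k)) \<and> (\<forall>k. s k = s (Suc k) <+>\<^bsub>R\<^esub> P k)"
    for s
    by (simp only: adic_completion_def partial_object.simps mem_Collect_eq)
  have "s \<in> carrier C \<longleftrightarrow> s \<in> cls ` Seq" for s
  proof
    assume s: "s \<in> carrier C"
    then have "\<exists>a. a \<in> A \<and> s k = P k +>\<^bsub>R\<^esub> a" for k
      unfolding C carrier_Quot by blast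
    then obtain r where r: "\<And>k. r k \<in> A" "\<And>k. s k = P k +>\<^bsub>R\<^esub> r k" by metis
    have "r (Suc k) - r k \<in> P k" for k
    proof -
      have "s k = s (Suc k) <+>\<^bsub>R\<^esub> P k" using s unfolding C by blast
      then have "P k +>\<^bsub>R\<^esub> r k = P k +>\<^bsub>R\<^esub> r (Suc k)"
        using r(2)[of k] r(2)[of "Suc k"] coset_add_P[of k "r (Suc k)"] by simp
      then show ?thesis using coset_eq_iff[OF r(1) r(1)] by metis
    qed
    then have "r \<in> Seq" using r by (simp add: Seq_def)
    moreover have "s = cls r" using r by (auto simp: cls_def)
    ultimately show "s \<in> cls ` Seq" by blast
  next
    assume "s \<in> cls ` Seq"
    then obtain r where r: "r \<in> Seq" "s = cls r" by blast
    then have "r (Suc k) - r k \<in> P k" "r k \<in> A" "r (Suc k) \<in> A" for k by (auto simp: Seq_def)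
    then have "s k = s (Suc k) <+>\<^bsub>R\<^esub> P k" for k
      using coset_eq_iff[of "r (Suc k)" "r k" k] by (simp add: r cls_def coset_add_P)
    moreover have "s k \<in> carrier (R Quot P k)" for k
      using r by (auto simp: carrier_Quot cls_def Seq_def)
    ultimately show "s \<in> carrier C" unfolding C by blast
  qed
  then show ?thesis by blast
qed

lemma completion_ops:
  shows cls_add: "r \<in> Seq \<Longrightarrow> r' \<in> Seq \<Longrightarrow> cls r \<oplus>\<^bsub>C\<^esub> cls r' = cls (\<lambda>k. r k + r' k)"
    and cls_mult: "r \<in> Seq \<Longrightarrow> r' \<in> Seq \<Longrightarrow> cls r \<otimes>\<^bsub>C\<^esub> cls r' = cls (\<lambda>k. r k * r' k)"
    and cls_zero: "\<zero>\<^bsub>C\<^esub> = cls (\<lambda>_. 0)" and cls_one: "\<one>\<^bsub>C\<^esub> = cls (\<lambda>_. 1)"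
  using zero_mem one_mem
  by (auto simp: adic_completion_def cls_def Seq_def Quot_ops Quot_ops(3,4)[OF zero_mem zero_mem])

lemma cring_completion: "cring C"
proof (rule cringI)
  show "abelian_group C"
  proof (rule abelian_groupI)
    fix x assume "x \<in> carrier C"
    then obtain r where r: "r \<in> Seq" "x = cls r" by (auto simp: carrier_completion)
    then show "\<exists>y\<in>carrier C. y \<oplus>\<^bsub>C\<^esub> x = \<zero>\<^bsub>C\<^esub>"
      using Seq_uminus[OF r(1) r(1)]
      by (intro bexI[of _ "cls (\<lambda>k. - r k)"]) (simp_all add: carrier_completion cls_add cls_zero)
  qed (auto simp: carrier_completion cls_add cls_zero Seq_add Seq_const zero_mem algebra_simps)
  show "Group.comm_monoid C"
    by (rule comm_monoidI)
      (auto simp: carrier_completion cls_mult cls_one Seq_mult Seq_const one_mem algebra_simps)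
qed (auto simp: carrier_completion cls_add cls_mult Seq_add Seq_mult algebra_simps)

end

section \<open>The multiplicity of a branch\<close>

definition has_order :: "nat \<Rightarrow> 'k::field fps \<Rightarrow> bool" where
  "has_order j \<alpha> \<longleftrightarrow> fps_X ^ j dvd \<alpha> \<and> \<alpha> $ j \<noteq> 0"

lemma has_order_iff: "has_order j \<alpha> \<longleftrightarrow> (\<exists>u. \<alpha> = fps_X ^ j * u \<and> u $ 0 \<noteq> 0)"
  unfolding has_order_def by (auto simp: fps_X_power_mult_nth elim!: dvdE)

lemma has_order_mult: "has_order i \<alpha> \<Longrightarrow> has_order j \<beta> \<Longrightarrow> has_order (i + j) (\<alpha> * \<beta>)"
proof -
  assume "has_order i \<alpha>" "has_order j \<beta>"
  then obtain u v where "\<alpha> = fps_X ^ i * u" "u $ 0 \<noteq> 0" "\<beta> = fps_X ^ j * v" "v $ 0 \<noteq> 0"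
    unfolding has_order_iff by blast
  then have "\<alpha> * \<beta> = fps_X ^ (i + j) * (u * v) \<and> (u * v) $ 0 \<noteq> 0"
    by (simp add: power_add mult_ac)
  then show ?thesis unfolding has_order_iff by blast
qed

lemma has_order_power: "has_order i \<alpha> \<Longrightarrow> has_order (i * k) (\<alpha> ^ k)"
proof (induction k)
  case 0
  then show ?case by (simp add: has_order_def)
next
  case (Suc k)
  then show ?case using has_order_mult[of i \<alpha> "i * k" "\<alpha> ^ k"] by simp
qed

lemma fps_eq_if_congruent:
  assumes "\<And>k. fps_X ^ k dvd \<alpha> - (\<beta> k :: 'k::field fps)" "\<And>k. fps_X ^ k dvd \<alpha>' - \<beta> k"
  shows "\<alpha> = \<alpha>'"
proof (rule fps_ext)
  fix j
  have "(\<alpha> - \<beta> (Suc j)) $ j = 0" "(\<alpha>' - \<beta> (Suc j)) $ j = 0"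
    using assms[of "Suc j"] unfolding fps_X_power_dvd_iff by blast+
  then show "\<alpha> $ j = \<alpha>' $ j" by simp
qed

text \<open>The coefficients are determined one order at a time.\<close>

lemma fps_expansion:
  fixes \<alpha> :: "'k::field fps"
  assumes "\<And>j. has_order j (b j)"
  obtains c where "\<And>j. fps_X ^ j dvd \<alpha> - (\<Sum>i<j. fps_const (c i) * b i)"
proof -
  define rest where
    "rest = rec_nat \<alpha> (\<lambda>j \<beta>. \<beta> - fps_const (\<beta> $ j / b j $ j) * b j)"
  define c where "c j = rest j $ j / b j $ j" for j
  have rest_Suc: "rest (Suc j) = rest j - fps_const (c j) * b j" for j
    by (simp add: rest_def c_def)
  have "rest j = \<alpha> - (\<Sum>i<j. fps_const (c i) * b i)" for j
    by (induction j) (simp_all add: rest_Suc, simp add: rest_def)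
  moreover have "fps_X ^ j dvd rest j" for j
  proof (induction j)
    case (Suc j)
    show ?case
      using assms[of j] Suc
      by (intro fps_X_power_dvd_Suc) (auto simp: rest_Suc has_order_def c_def)
  qed simp
  ultimately show thesis using that by metis
qed

text \<open>The local ring \<open>A\<close> of a curve inside the local ring \<open>A'\<close> of its normalisation at one point,
  with the expansion \<open>\<phi>\<close> of its elements as power series in a local parameter.\<close>

locale parametrised_local_ring = A: subring_set A + A': subring_set A'
  for A A' :: "'a::comm_ring_1 set" +
  fixes \<phi> :: "'a \<Rightarrow> 'k::field fps" and \<tau> :: 'a
  assumes A_subset: "A \<subseteq> A'"
    and \<phi>_one: "\<phi> 1 = 1"
    and \<phi>_add: "u \<in> A' \<Longrightarrow> v \<in> A' \<Longrightarrow> \<phi> (u + v) = \<phi> u + \<phi> v"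
    and \<phi>_mult: "u \<in> A' \<Longrightarrow> v \<in> A' \<Longrightarrow> \<phi> (u * v) = \<phi> u * \<phi> v"
    and const_ex: "\<exists>a\<in>A. \<phi> a = fps_const c"
    and unit_A: "u \<in> A \<Longrightarrow> \<phi> u $ 0 \<noteq> 0 \<Longrightarrow> \<exists>v\<in>A. u * v = 1"
    and unit_A': "u \<in> A' \<Longrightarrow> \<phi> u $ 0 \<noteq> 0 \<Longrightarrow> \<exists>v\<in>A'. u * v = 1"
    and \<tau>_mem: "\<tau> \<in> A'" and \<tau>_order: "has_order 1 (\<phi> \<tau>)"
    and \<tau>_dvd: "u \<in> A' \<Longrightarrow> \<phi> u $ 0 = 0 \<Longrightarrow> \<exists>v\<in>A'. u = \<tau> * v"
begin

lemma \<phi>_zero: "\<phi> 0 = 0"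
proof -
  have "\<phi> 0 = \<phi> 0 + \<phi> 0" using \<phi>_add[OF A'.zero_mem A'.zero_mem] by (simp only: add_0_left)
  then show ?thesis by (metis add_cancel_right_right)
qed

lemma \<phi>_uminus: "u \<in> A' \<Longrightarrow> \<phi> (- u) = - \<phi> u"
  using \<phi>_add[of u "- u"] \<phi>_zero A'.uminus_mem by (simp add: eq_neg_iff_add_eq_0 add.commute)

lemma \<phi>_diff: "u \<in> A' \<Longrightarrow> v \<in> A' \<Longrightarrow> \<phi> (u - v) = \<phi> u - \<phi> v"
  using \<phi>_add[of u "- v"] \<phi>_uminus[of v] A'.uminus_mem by simp

lemma \<phi>_sum: "(\<And>i. i \<in> K \<Longrightarrow> u i \<in> A') \<Longrightarrow> \<phi> (sum u K) = (\<Sum>i\<in>K. \<phi> (u i))"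
proof (induction K rule: infinite_finite_induct)
  case (insert i K)
  then show ?case using A'.sum_mem[of K u] by (simp add: \<phi>_add)
qed (auto simp: \<phi>_zero)

lemma \<phi>_power: "u \<in> A' \<Longrightarrow> \<phi> (u ^ k) = \<phi> u ^ k"
  by (induction k) (auto simp: \<phi>_one \<phi>_mult A'.power_mem)

lemma max_ideal_A: "max_ideal (subring_on A) = {u \<in> A. \<phi> u $ 0 = 0}"
proof -
  have "\<phi> u $ 0 \<noteq> 0" if "u \<in> A" "v \<in> A" "u * v = 1" for u v
    using \<phi>_mult[of u v] that A_subset \<phi>_one by (metis fps_mult_nth_0 fps_one_nth mult_zero_left subsetD zero_neq_one)
  then show ?thesis
    using unit_A by (auto simp: max_ideal_def A.Units_subring_on)
qed

lemma max_ideal_A': "max_ideal (subring_on A') = {u \<in> A'. \<phi> u $ 0 = 0}"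
proof -
  have "\<phi> u $ 0 \<noteq> 0" if "u \<in> A'" "v \<in> A'" "u * v = 1" for u v
    using \<phi>_mult[of u v] that \<phi>_one by (metis fps_mult_nth_0 fps_one_nth mult_zero_left zero_neq_one)
  then show ?thesis
    using unit_A' by (auto simp: max_ideal_def A'.Units_subring_on)
qed

lemma ideal_max_ideal_A: "ideal (max_ideal (subring_on A)) (subring_on A)"
  unfolding A.ideal_subring_on_iff max_ideal_A using A_subset
  by (auto simp: A.zero_mem \<phi>_zero A.add_mem A.mult_mem \<phi>_add \<phi>_mult subset_iff)

lemma ideal_max_ideal_A': "ideal (max_ideal (subring_on A')) (subring_on A')"
  unfolding A'.ideal_subring_on_iff max_ideal_A'
  by (auto simp: A'.zero_mem \<phi>_zero A'.add_mem A'.mult_mem \<phi>_add \<phi>_mult)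

sublocale A: adic_subring A "max_ideal (subring_on A)"
  by (rule adic_subring.intro[OF A.subring_set_axioms adic_subring_axioms.intro[OF ideal_max_ideal_A]])

sublocale A': adic_subring A' "max_ideal (subring_on A')"
  by (rule adic_subring.intro[OF A'.subring_set_axioms adic_subring_axioms.intro[OF ideal_max_ideal_A']])

lemma P'_subset: "u \<in> A'.P k \<Longrightarrow> fps_X ^ k dvd \<phi> u"
proof (induction k arbitrary: u)
  case (Suc k)
  then have "u \<in> ideal_prod (subring_on A') (A'.P k) (max_ideal (subring_on A'))"
    by (simp add: ideal_pow_Suc)
  then have "u \<in> A' \<and> fps_X ^ Suc k dvd \<phi> u"
  proof induction
    case (prod i j)
    then have ij: "i \<in> A'" "fps_X ^ k dvd \<phi> i" "j \<in> A'" "\<phi> j $ 0 = 0"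
      using A'.P_subset Suc.IH by (auto simp: max_ideal_A')
    then have "fps_X ^ 1 dvd \<phi> j" by (simp only: fps_X_power_dvd_iff) simp
    then have "fps_X ^ k * fps_X dvd \<phi> i * \<phi> j" using ij by (intro mult_dvd_mono) auto
    then show ?case using ij by (simp add: \<phi>_mult A'.mult_mem mult.commute)
  qed (auto simp: A'.add_mem \<phi>_add)
  then show ?case by simp
qed simp

text \<open>In the local ring of the normalisation, \<open>\<tau>\<close> can be divided off from every non-unit.\<close>

lemma P'_eq: "A'.P k = {u \<in> A'. fps_X ^ k dvd \<phi> u}"
proof -
  have "u \<in> A'.P k" if "u \<in> A'" "fps_X ^ k dvd \<phi> u" for u
    using that
  proof (induction k arbitrary: u)
    case 0
    then show ?case by (simp add: ideal_pow_0)
  next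
    case (Suc k)
    have "\<phi> u $ 0 = 0" using Suc.prems(2) unfolding fps_X_power_dvd_iff by blast
    then obtain v where v: "v \<in> A'" "u = \<tau> * v" using \<tau>_dvd Suc.prems by blast
    obtain w where w: "\<phi> \<tau> = fps_X ^ 1 * w" "w $ 0 \<noteq> 0" using \<tau>_order unfolding has_order_iff by blast
    have "fps_X * fps_X ^ k dvd fps_X * (w * \<phi> v)"
      using Suc.prems v w \<tau>_mem by (simp add: \<phi>_mult mult_ac)
    then have "fps_X ^ k dvd w * \<phi> v" by simp
    then have "fps_X ^ k dvd inverse w * (w * \<phi> v)" by simp
    then have "fps_X ^ k dvd \<phi> v"
      using inverse_mult_eq_1[OF w(2)] by (simp add: mult.assoc[symmetric])
    then have "v \<in> A'.P k" using Suc.IH v by blast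
    moreover have "\<tau> \<in> max_ideal (subring_on A')"
      using \<tau>_mem w by (simp add: max_ideal_A')
    ultimately show ?case using A'.P_Suc_mult[of v k \<tau>] by (simp add: v mult.commute)
  qed
  then show ?thesis using P'_subset A'.P_subset by blast
qed

lemma P_subset_P': "A.P k \<subseteq> A'.P k"
proof (induction k)
  case 0
  then show ?case using A_subset by (simp add: ideal_pow_0)
next
  case (Suc k)
  have "u \<in> A'.P (Suc k)" if "u \<in> ideal_prod (subring_on A) (A.P k) (max_ideal (subring_on A))" for u
    using that
  proof induction
    case (prod i j)
    then show ?case
      using Suc A_subset A'.P_Suc_mult[of i k j] by (auto simp: max_ideal_A max_ideal_A')
  next
    case (sum s1 s2)
    then show ?case using A'.P_add by simp
  qed
  then show ?case by (auto simp: ideal_pow_Suc)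
qed

lemma \<phi>_P: "u \<in> A.P k \<Longrightarrow> fps_X ^ k dvd \<phi> u"
  using P_subset_P' P'_subset by blast

text \<open>The image of an element of the completion in \<open>k[[t]]\<close>: modulo \<open>t\<^sup>k\<close> it is the expansion of any
  representative of its \<open>k\<close>-th component.\<close>

definition limit :: "(nat \<Rightarrow> 'a set) \<Rightarrow> 'k fps" where
  "limit s = (THE \<alpha>. \<forall>k. \<forall>r \<in> s k. fps_X ^ k dvd \<alpha> - \<phi> r)"

lemma limit_eqI:
  assumes "r \<in> A.Seq" "\<And>k. fps_X ^ k dvd \<alpha> - \<phi> (r k)"
  shows "limit (A.cls r) = \<alpha>"
  unfolding limit_def
proof (rule the_equality)
  have r: "r k \<in> A" for k using assms(1) by (simp add: A.Seq_def)
  show "\<forall>k. \<forall>r\<in>A.cls r k. fps_X ^ k dvd \<alpha> - \<phi> r"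
  proof (intro allI ballI)
    fix k u assume "u \<in> A.cls r k"
    then obtain p where p: "p \<in> A.P k" "u = p + r k" by (auto simp: A.cls_def rcoset_subring_on)
    then have "\<phi> u = \<phi> p + \<phi> (r k)" using \<phi>_add[of p "r k"] A.P_subset A_subset r by blast
    then have "\<alpha> - \<phi> u = (\<alpha> - \<phi> (r k)) - \<phi> p" by simp
    then show "fps_X ^ k dvd \<alpha> - \<phi> u" using assms(2) \<phi>_P[OF p(1)] by (metis dvd_diff)
  qed
  fix \<beta> assume \<beta>: "\<forall>k. \<forall>r\<in>A.cls r k. fps_X ^ k dvd \<beta> - \<phi> r"
  have "r k \<in> A.cls r k" for k using A.P_zero by (force simp: A.cls_def rcoset_subring_on)
  then show "\<beta> = \<alpha>" using \<beta> assms(2) by (intro fps_eq_if_congruent[where \<beta> = "\<lambda>k. \<phi> (r k)"]) auto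
qed

lemma limit_congruent:
  assumes "r \<in> A.Seq"
  shows "fps_X ^ k dvd limit (A.cls r) - \<phi> (r k)"
proof -
  define \<alpha> where "\<alpha> = Abs_fps (\<lambda>j. \<phi> (r (Suc j)) $ j)"
  have "fps_X ^ k dvd \<alpha> - \<phi> (r k)" for k
    unfolding fps_X_power_dvd_iff
  proof (intro allI impI)
    fix j assume "j < k"
    have "r k \<in> A'" "r (Suc j) \<in> A'" using assms A_subset by (auto simp: A.Seq_def)
    then have "fps_X ^ Suc j dvd \<phi> (r k) - \<phi> (r (Suc j))"
      using \<phi>_P[OF A.Seq_telescope[OF assms, of "Suc j" k]] \<open>j < k\<close> by (simp add: \<phi>_diff)
    then have "(\<phi> (r k) - \<phi> (r (Suc j))) $ j = 0" unfolding fps_X_power_dvd_iff by blast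
    then show "(\<alpha> - \<phi> (r k)) $ j = 0" by (simp add: \<alpha>_def)
  qed
  then show ?thesis using limit_eqI[OF assms] by metis
qed

lemma limit_ops:
  assumes "r \<in> A.Seq" "r' \<in> A.Seq"
  shows "limit (A.cls (\<lambda>k. r k + r' k)) = limit (A.cls r) + limit (A.cls r')"
    and "limit (A.cls (\<lambda>k. r k * r' k)) = limit (A.cls r) * limit (A.cls r')"
    and "limit (A.cls (\<lambda>k. - r k)) = - limit (A.cls r)"
proof -
  let ?\<alpha> = "limit (A.cls r)" and ?\<beta> = "limit (A.cls r')"
  have mem: "r k \<in> A'" "r' k \<in> A'" for k using assms A_subset by (auto simp: A.Seq_def)
  have c: "fps_X ^ k dvd ?\<alpha> - \<phi> (r k)" "fps_X ^ k dvd ?\<beta> - \<phi> (r' k)" for k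
    using limit_congruent assms by auto
  show "limit (A.cls (\<lambda>k. r k + r' k)) = ?\<alpha> + ?\<beta>"
  proof (rule limit_eqI[OF A.Seq_add[OF assms]])
    fix k
    have "?\<alpha> + ?\<beta> - \<phi> (r k + r' k) = (?\<alpha> - \<phi> (r k)) + (?\<beta> - \<phi> (r' k))"
      using mem by (simp add: \<phi>_add)
    then show "fps_X ^ k dvd ?\<alpha> + ?\<beta> - \<phi> (r k + r' k)" using c[of k] by (metis dvd_add)
  qed
  show "limit (A.cls (\<lambda>k. r k * r' k)) = ?\<alpha> * ?\<beta>"
  proof (rule limit_eqI[OF A.Seq_mult[OF assms]])
    fix k
    have "?\<alpha> * ?\<beta> - \<phi> (r k * r' k) = ?\<alpha> * (?\<beta> - \<phi> (r' k)) + (?\<alpha> - \<phi> (r k)) * \<phi> (r' k)"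
      using mem by (simp add: \<phi>_mult algebra_simps)
    then show "fps_X ^ k dvd ?\<alpha> * ?\<beta> - \<phi> (r k * r' k)"
      using c[of k] by (metis dvd_add dvd_mult dvd_mult2)
  qed
  show "limit (A.cls (\<lambda>k. - r k)) = - ?\<alpha>"
  proof (rule limit_eqI[OF A.Seq_uminus[OF assms]])
    fix k
    have "- ?\<alpha> - \<phi> (- r k) = - (?\<alpha> - \<phi> (r k))" using mem by (simp add: \<phi>_uminus)
    then show "fps_X ^ k dvd - ?\<alpha> - \<phi> (- r k)" using c(1)[of k] by (metis dvd_minus_iff)
  qed
qed

lemma limit_const: "a \<in> A \<Longrightarrow> limit (A.cls (\<lambda>_. a)) = \<phi> a"
  by (rule limit_eqI[OF A.Seq_const]) auto

abbreviation "power_series_ring \<equiv> (ring_of_type_algebra :: 'k fps ring)"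

lemma limit_hom: "ring_hom_ring A.C power_series_ring limit"
proof (intro ring_hom_ring.intro ring_hom_ring_axioms.intro ring_hom_memI)
  show "ring A.C" using A.cring_completion by (rule cring.axioms)
  show "ring power_series_ring" by (rule ring_from_type_algebra)
qed (auto simp: A.carrier_completion A.cls_add A.cls_mult A.cls_one limit_ops limit_const A.one_mem
    \<phi>_one ring_of_type_algebra_def)

definition "S = limit ` carrier A.C"

lemma S_eq: "S = {limit (A.cls r) | r. r \<in> A.Seq}"
  by (auto simp: S_def A.carrier_completion)

end

text \<open>The elements \<open>W\<^sup>k \<tau>\<^sup>i\<close> with \<open>i < e\<close> take every order once, and \<open>f\<close> multiplies them into growing powers
  of the maximal ideal of \<open>A\<close>; so \<open>f\<close> times any power series is a limit of elements of \<open>A\<close>.\<close>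

locale parametrised_branch = parametrised_local_ring A A' \<phi> \<tau>
  for A A' :: "'a::comm_ring_1 set" and \<phi> :: "'a \<Rightarrow> 'k::field fps" and \<tau> +
  fixes f W z :: 'a and e :: nat
  assumes e_pos: "e > 0"
    and order_ge: "u \<in> A \<Longrightarrow> \<phi> u $ 0 = 0 \<Longrightarrow> fps_X ^ e dvd \<phi> u"
    and z_mem: "z \<in> A" and z_order: "has_order e (\<phi> z)"
    and W_mem: "W \<in> A'" and W_order: "has_order e (\<phi> W)"
    and f_mem: "f \<in> A" and f_nonzero: "\<phi> f \<noteq> 0"
    and fW_mem: "f * (W ^ k * \<tau> ^ i) \<in> ideal_pow (subring_on A) (max_ideal (subring_on A)) k"
begin

text \<open>A power series \<open>\<phi> f \<beta>\<close> is the limit of the partial sums of the expansion of \<open>\<beta>\<close> along the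
  elements \<open>W\<^sup>k \<tau>\<^sup>i\<close> with \<open>i < e\<close>, multiplied by \<open>f\<close>.\<close>

lemma multiple_of_f_mem: "\<phi> f * \<beta> \<in> S"
proof -
  define b where "b j = W ^ (j div e) * \<tau> ^ (j mod e)" for j
  have b_mem: "b j \<in> A'" for j
    by (simp add: b_def A'.mult_mem A'.power_mem W_mem \<tau>_mem)
  have fb: "f * b j \<in> A.P (j div e)" for j unfolding b_def by (rule fW_mem)
  have "\<phi> (b j) = \<phi> W ^ (j div e) * \<phi> \<tau> ^ (j mod e)" for j
    by (simp add: b_def \<phi>_mult \<phi>_power A'.power_mem W_mem \<tau>_mem)
  then have "has_order j (\<phi> (b j))" for j
    using has_order_mult[OF has_order_power[OF W_order, of "j div e"]
        has_order_power[OF \<tau>_order, of "j mod e"]] by simp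
  then obtain c where c: "\<And>j. fps_X ^ j dvd \<beta> - (\<Sum>i<j. fps_const (c i) * \<phi> (b i))"
    using fps_expansion[of "\<lambda>j. \<phi> (b j)" \<beta>] by metis
  obtain \<kappa> where \<kappa>: "\<And>c. \<kappa> c \<in> A" "\<And>c. \<phi> (\<kappa> c) = fps_const c" using const_ex by metis
  define r where "r k = (\<Sum>j<e * k. \<kappa> (c j) * (f * b j))" for k
  have fb_A: "f * b j \<in> A" for j using fb A.P_subset by blast
  have "{..<e * Suc k} = {..<e * k} \<union> {e * k..<e * Suc k}" for k by auto
  then have "r (Suc k) = r k + (\<Sum>j\<in>{e * k..<e * Suc k}. \<kappa> (c j) * (f * b j))" for k
    unfolding r_def by (subst sum.union_disjoint[symmetric]) auto
  moreover have "(\<Sum>j\<in>{e * k..<e * Suc k}. \<kappa> (c j) * (f * b j)) \<in> A.P k" for k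
  proof (rule A.P_sum)
    fix j assume j: "j \<in> {e * k..<e * Suc k}"
    then have "j div e = k" using e_pos by (intro div_nat_eqI) (auto simp: mult.commute)
    then show "\<kappa> (c j) * (f * b j) \<in> A.P k" using fb[of j] \<kappa> by (auto intro: A.P_mult)
  qed
  ultimately have r: "r \<in> A.Seq"
    by (auto simp: A.Seq_def r_def intro!: A.sum_mem A.mult_mem \<kappa> fb_A)
  have "\<phi> (r k) = \<phi> f * (\<Sum>i<e * k. fps_const (c i) * \<phi> (b i))" for k
  proof -
    have "\<phi> (\<kappa> (c j) * (f * b j)) = \<phi> f * (fps_const (c j) * \<phi> (b j))" for j
    proof -
      have "\<kappa> (c j) \<in> A'" "f \<in> A'" using \<kappa> A_subset f_mem by auto
      then show ?thesis
        using \<phi>_mult[of "\<kappa> (c j)" "f * b j"] \<phi>_mult[of f "b j"] b_mem \<kappa> A'.mult_mem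
        by (simp add: mult_ac)
    qed
    then show ?thesis
      unfolding r_def using \<kappa> A_subset fb_A f_mem b_mem
      by (subst \<phi>_sum) (auto simp: sum_distrib_left intro!: A'.mult_mem)
  qed
  then have diff: "\<phi> f * \<beta> - \<phi> (r k) = \<phi> f * (\<beta> - (\<Sum>i<e * k. fps_const (c i) * \<phi> (b i)))" for k
    by (simp add: right_diff_distrib)
  have "fps_X ^ k dvd \<phi> f * \<beta> - \<phi> (r k)" for k
  proof -
    have "k \<le> e * k" using e_pos by simp
    then have "fps_X ^ k dvd (fps_X ^ (e * k) :: 'k fps)" by (rule le_imp_power_dvd)
    then have "fps_X ^ k dvd \<beta> - (\<Sum>i<e * k. fps_const (c i) * \<phi> (b i))"
      using c[of "e * k"] by (rule dvd_trans)
    then show ?thesis unfolding diff by (rule dvd_mult)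
  qed
  then have "limit (A.cls r) = \<phi> f * \<beta>" by (rule limit_eqI[OF r])
  then show ?thesis using r unfolding S_eq by (metis (mono_tags, lifting) mem_Collect_eq)
qed

text \<open>A sequence in \<open>A\<close> whose limit has no constant term has its terms in the maximal ideal, so that the
  minimal order \<open>e\<close> passes to limits.\<close>

lemma cofinite_S: "cofinite_power_series_ring S (subdegree (\<phi> f)) e (\<phi> z)"
proof
  show "0 \<in> S" using limit_const[OF A.zero_mem] A.Seq_const[OF A.zero_mem] by (force simp: S_eq \<phi>_zero)
  show "1 \<in> S" using limit_const[OF A.one_mem] A.Seq_const[OF A.one_mem] by (force simp: S_eq \<phi>_one)
  show "fps_const c \<in> S" for c
  proof -
    obtain a where "a \<in> A" "\<phi> a = fps_const c" using const_ex by blast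
    then show ?thesis using limit_const[of a] A.Seq_const[of a] by (force simp: S_eq)
  qed
  show "\<phi> z \<in> S" using limit_const[OF z_mem] A.Seq_const[OF z_mem] by (force simp: S_eq)
  show "\<alpha> + \<beta> \<in> S" "\<alpha> * \<beta> \<in> S" if mem: "\<alpha> \<in> S" "\<beta> \<in> S" for \<alpha> \<beta>
  proof -
    obtain r r' where "r \<in> A.Seq" "r' \<in> A.Seq" "\<alpha> = limit (A.cls r)" "\<beta> = limit (A.cls r')"
      using mem unfolding S_eq by blast
    then show "\<alpha> + \<beta> \<in> S" "\<alpha> * \<beta> \<in> S"
      unfolding S_eq using limit_ops[of r r'] A.Seq_add A.Seq_mult by force+
  qed
  show "- \<alpha> \<in> S" if mem: "\<alpha> \<in> S" for \<alpha>
  proof -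
    obtain r where "r \<in> A.Seq" "\<alpha> = limit (A.cls r)" using mem by (auto simp: S_eq)
    then show ?thesis unfolding S_eq using limit_ops(3)[of r r] A.Seq_uminus[of r r] by force
  qed
  show "\<alpha> \<in> S" if dvd: "fps_X ^ subdegree (\<phi> f) dvd \<alpha>" for \<alpha>
  proof -
    obtain \<gamma> where \<gamma>: "\<alpha> = fps_X ^ subdegree (\<phi> f) * \<gamma>" using dvd by (elim dvdE)
    define u where "u = fps_shift (subdegree (\<phi> f)) (\<phi> f)"
    have u: "\<phi> f = fps_X ^ subdegree (\<phi> f) * u" "u $ 0 \<noteq> 0"
      using f_nonzero by (auto simp: u_def fps_eq_iff fps_X_power_mult_nth)
    have "\<phi> f * (inverse u * \<gamma>) = fps_X ^ subdegree (\<phi> f) * (u * inverse u) * \<gamma>"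
      using u(1) by (metis mult.assoc)
    then have "\<alpha> = \<phi> f * (inverse u * \<gamma>)"
      unfolding inverse_mult_eq_1'[OF u(2)] mult_1_right \<gamma> by (rule sym)
    then show ?thesis using multiple_of_f_mem by simp
  qed
  show "e > 0" by (rule e_pos)
  show "fps_X ^ e dvd \<phi> z" "\<phi> z $ e \<noteq> 0" using z_order by (auto simp: has_order_def)
  show "fps_X ^ e dvd \<alpha>" if \<alpha>: "\<alpha> \<in> S" "\<alpha> $ 0 = 0" for \<alpha>
  proof -
    obtain r where r: "r \<in> A.Seq" "\<alpha> = limit (A.cls r)" using \<alpha> by (auto simp: S_eq)
    have d: "fps_X ^ e dvd \<alpha> - \<phi> (r e)" using limit_congruent[OF r(1)] r(2) by simp
    then have "(\<alpha> - \<phi> (r e)) $ 0 = 0" using e_pos unfolding fps_X_power_dvd_iff by blast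
    then have "\<phi> (r e) $ 0 = 0" using \<alpha> by simp
    then have "fps_X ^ e dvd \<phi> (r e)" using order_ge r by (auto simp: A.Seq_def)
    then have "fps_X ^ e dvd \<alpha> - \<phi> (r e) + \<phi> (r e)" by (rule dvd_add[OF d])
    then show ?thesis by simp
  qed
qed

text \<open>A coherent sequence goes to zero in the completion of \<open>A'\<close> if its \<open>k\<close>-th term has order at least \<open>k\<close>
  for all \<open>k\<close>, and this means that its limit is zero.\<close>

lemma kernel_eq:
  "a_kernel A.C (local_completion (subring_on A')) (completion_map (subring_on A') (\<lambda>u. u)) =
   a_kernel A.C power_series_ring limit"
proof -
  have "completion_map (subring_on A') (\<lambda>u. u) (A.cls r) = \<zero>\<^bsub>A'.C\<^esub> \<longleftrightarrow> limit (A.cls r) = 0"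
    if r: "r \<in> A.Seq" for r
  proof -
    have r_mem: "r k \<in> A'" for k using r A_subset by (auto simp: A.Seq_def)
    have "A.cls r k <+>\<^bsub>subring_on A'\<^esub> A'.P k = A'.P k +>\<^bsub>subring_on A'\<^esub> r k" for k
      unfolding A.cls_def by (rule coset_set_add[OF P_subset_P' A.P_zero A'.P_add])
    then have "completion_map (subring_on A') (\<lambda>u. u) (A.cls r) = A'.cls r"
      unfolding completion_map_def A'.cls_def by simp
    then have "completion_map (subring_on A') (\<lambda>u. u) (A.cls r) = \<zero>\<^bsub>A'.C\<^esub> \<longleftrightarrow> (\<forall>k. r k \<in> A'.P k)"
      using A'.coset_eq_iff[OF r_mem A'.zero_mem] by (simp add: A'.cls_zero A'.cls_def fun_eq_iff)
    also have "\<dots> \<longleftrightarrow> (\<forall>k. fps_X ^ k dvd \<phi> (r k))" using r_mem by (simp add: P'_eq)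
    also have "\<dots> \<longleftrightarrow> limit (A.cls r) = 0"
    proof
      assume "\<forall>k. fps_X ^ k dvd \<phi> (r k)"
      then show "limit (A.cls r) = 0" by (intro limit_eqI[OF r]) simp
    next
      assume "limit (A.cls r) = 0"
      then show "\<forall>k. fps_X ^ k dvd \<phi> (r k)" using limit_congruent[OF r] by auto
    qed
    finally show ?thesis .
  qed
  then show ?thesis
    unfolding a_kernel_def' local_completion_def
    by (auto simp: A.carrier_completion ring_of_type_algebra_def)
qed

theorem branch_multiplicity_eq:
  "multiplicity_local (local_completion (subring_on A) Quot
     a_kernel (local_completion (subring_on A)) (local_completion (subring_on A'))
       (completion_map (subring_on A') (\<lambda>u. u))) = e"
proof -
  interpret hom: ring_hom_ring A.C power_series_ring limit by (rule limit_hom)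
  interpret S: cofinite_power_series_ring S "subdegree (\<phi> f)" e "\<phi> z" by (rule cofinite_S)
  have "A.C Quot a_kernel A.C power_series_ring limit \<simeq> subring_on S"
    using hom.FactRing_iso_set_aux unfolding is_ring_iso_def subring_on_def S_def by blast
  moreover have "cring (A.C Quot a_kernel A.C power_series_ring limit)"
    using ideal.quotient_is_cring[OF hom.kernel_is_ideal A.cring_completion] .
  moreover have "ideal (max_ideal (subring_on S)) (subring_on S)"
    using S.ideal_\<mm> by (simp add: S.max_ideal_eq)
  ultimately have "multiplicity_local (A.C Quot a_kernel A.C power_series_ring limit) =
      multiplicity_local (subring_on S)"
    using S.cring_subring_on by (intro multiplicity_local_iso)
  then show ?thesis
    using S.multiplicity_eq kernel_eq unfolding local_completion_def by simp
qed

end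

section \<open>Ideals of a commutative ring type\<close>

lemma subring_set_UNIV: "subring_set UNIV"
  by unfold_locales auto

lemma ring_of_type_algebra_eq: "ring_of_type_algebra = subring_on UNIV"
  by (simp add: subring_on_def ring_of_type_algebra_def)

abbreviation Ideal :: "'r::comm_ring_1 set \<Rightarrow> 'r set" where
  "Ideal S \<equiv> Idl\<^bsub>ring_of_type_algebra\<^esub> S"

lemma ideal_iff:
  "ideal I (ring_of_type_algebra :: 'r::comm_ring_1 ring) \<longleftrightarrow>
     0 \<in> I \<and> (\<forall>a\<in>I. \<forall>b\<in>I. a + b \<in> I) \<and> (\<forall>r. \<forall>a\<in>I. r * a \<in> I)"
  unfolding ring_of_type_algebra_eq subring_set.ideal_subring_on_iff[OF subring_set_UNIV] by auto

lemma Ideal_ideal: "ideal (Ideal S) (ring_of_type_algebra :: 'r::comm_ring_1 ring)"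
  by (rule ring.genideal_ideal[OF ring_from_type_algebra]) (simp add: ring_of_type_algebra_def)

lemma Ideal_superset: "S \<subseteq> Ideal (S :: 'r::comm_ring_1 set)"
  by (rule ring.genideal_self[OF ring_from_type_algebra]) (simp add: ring_of_type_algebra_def)

lemma Ideal_minimal: "S \<subseteq> I \<Longrightarrow> ideal I (ring_of_type_algebra :: 'r::comm_ring_1 ring) \<Longrightarrow> Ideal S \<subseteq> I"
  by (rule ring.genideal_minimal[OF ring_from_type_algebra])

lemma Ideal_subset: "S \<subseteq> Ideal S' \<Longrightarrow> Ideal S \<subseteq> Ideal (S' :: 'r::comm_ring_1 set)"
  by (rule Ideal_minimal[OF _ Ideal_ideal])

lemma Ideal_zero: "0 \<in> Ideal (S :: 'r::comm_ring_1 set)"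
  and Ideal_add: "a \<in> Ideal S \<Longrightarrow> b \<in> Ideal S \<Longrightarrow> a + b \<in> Ideal (S :: 'r::comm_ring_1 set)"
  and Ideal_mult: "a \<in> Ideal S \<Longrightarrow> r * a \<in> Ideal (S :: 'r::comm_ring_1 set)"
  using Ideal_ideal[of S] unfolding ideal_iff by auto

lemma Ideal_uminus: "- a \<in> Ideal S \<longleftrightarrow> a \<in> Ideal (S :: 'r::comm_ring_1 set)"
  using Ideal_mult[of a S "- 1"] Ideal_mult[of "- a" S "- 1"] by auto

lemma Ideal_sum: "(\<And>i. i \<in> K \<Longrightarrow> a i \<in> Ideal S) \<Longrightarrow> sum a K \<in> Ideal (S :: 'r::comm_ring_1 set)"
  by (induction K rule: infinite_finite_induct) (auto simp: Ideal_zero Ideal_add)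

section \<open>The zeroth Fitting ideal does not depend on the generators\<close>

context Modules.module
begin

context
  fixes L :: "'b set"
  assumes L: "subspace L"
begin

definition generating_mod :: "nat \<Rightarrow> (nat \<Rightarrow> 'b) \<Rightarrow> bool" where
  "generating_mod r v \<longleftrightarrow> (\<forall>x. \<exists>c. x - (\<Sum>j<r. c j *s v j) \<in> L)"

definition relation_minors :: "nat \<Rightarrow> (nat \<Rightarrow> 'b) \<Rightarrow> 'a set" where
  "relation_minors r v = {det (mat r r (\<lambda>(i, j). a i j)) | a. \<forall>i<r. (\<Sum>j<r. a i j *s v j) \<in> L}"

text \<open>If \<open>v\<^sub>r = \<Sum> c\<^sub>j v\<^sub>j\<close> modulo \<open>L\<close>, then adding \<open>c\<^sub>j\<close> times the last column of a matrix of relations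
  to column \<open>j\<close> leaves relations between the first \<open>r\<close> vectors in the first \<open>r\<close> columns; the expansion
  along the last column then gives one inclusion.  For the other one, border a matrix with the
  relation that expresses \<open>v\<^sub>r\<close>.\<close>

lemma Ideal_relation_minors_Suc:
  assumes c: "v r - (\<Sum>j<r. c j *s v j) \<in> L"
  shows "Ideal (relation_minors (Suc r) v) = Ideal (relation_minors r v)"
proof (rule antisym)
  show "Ideal (relation_minors (Suc r) v) \<subseteq> Ideal (relation_minors r v)"
  proof (rule Ideal_subset, rule subsetI)
    fix D assume "D \<in> relation_minors (Suc r) v"
    then obtain a where a: "D = det (mat (Suc r) (Suc r) (\<lambda>(i, j). a i j))"
      "\<And>i. i < Suc r \<Longrightarrow> (\<Sum>j<Suc r. a i j *s v j) \<in> L"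
      by (auto simp: relation_minors_def)
    define A where "A = mat (Suc r) (Suc r) (\<lambda>(i, j). a i j)"
    define U where "U = mat (Suc r) (Suc r) (\<lambda>(i, j). if i = j then 1 else if i = r then c j else 0)"
    define a' where "a' i j = a i j + a i r * c j" for i j
    define A' where "A' = mat (Suc r) (Suc r) (\<lambda>(i, j). if j = r then a i r else a' i j)"
    have carr: "A \<in> carrier_mat (Suc r) (Suc r)" "U \<in> carrier_mat (Suc r) (Suc r)"
      "A' \<in> carrier_mat (Suc r) (Suc r)"
      by (auto simp: A_def U_def A'_def)
    have "A' = A * U"
    proof (rule eq_matI)
      fix i j assume "i < dim_row (A * U)" "j < dim_col (A * U)"
      then have ij: "i < Suc r" "j < Suc r" using carr by auto
      have "(A * U) $$ (i, j) = (\<Sum>k<Suc r. a i k * (if k = j then 1 else if k = r then c j else 0))"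
        using ij by (simp add: A_def U_def scalar_prod_def atLeast0LessThan)
      also have "\<dots> = (if j = r then a i r else a i j + a i r * c j)"
        using ij by (auto simp: if_distrib sum.delta cong: if_cong)
      finally show "A' $$ (i, j) = (A * U) $$ (i, j)" using ij by (simp add: A'_def a'_def)
    qed (use carr in auto)
    moreover have "det U = 1"
    proof -
      have "det U = prod_list (diag_mat U)"
        using carr by (intro det_lower_triangular[of "Suc r"]) (auto simp: U_def)
      also have "diag_mat U = replicate (Suc r) 1"
        by (intro nth_equalityI) (auto simp: diag_mat_def U_def simp del: upt_Suc replicate_Suc)
      finally show ?thesis by simp
    qed
    ultimately have "det A' = det A" using det_mult[OF carr(1,2)] by simp
    moreover have "det A' = (\<Sum>i<Suc r. A' $$ (i, r) * cofactor A' i r)"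
      by (rule laplace_expansion_column[OF carr(3)]) simp
    moreover have "cofactor A' i r \<in> Ideal (relation_minors r v)" if i: "i < Suc r" for i
    proof -
      define b where "b k j = a' (insert_index i k) j" for k j
      have "mat_delete A' i r = mat r r (\<lambda>(k, j). b k j)"
      proof (rule eq_matI)
        fix k j assume "k < dim_row (mat r r (\<lambda>(k, j). b k j))" "j < dim_col (mat r r (\<lambda>(k, j). b k j))"
        then have kj: "k < r" "j < r" by auto
        have "insert_index i k < Suc r" using kj by (simp add: insert_index_def)
        moreover have "insert_index r j = j" using kj by (simp add: insert_index_def)
        ultimately show "mat_delete A' i r $$ (k, j) = mat r r (\<lambda>(k, j). b k j) $$ (k, j)"
          using mat_delete_index[OF carr(3) i, of r k j] kj by (simp add: A'_def b_def)
      qed (use carr in auto)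
      moreover have "(\<Sum>j<r. b k j *s v j) \<in> L" if "k < r" for k
      proof -
        let ?k = "insert_index i k"
        have k: "?k < Suc r" using that by (simp add: insert_index_def)
        have "(\<Sum>j<r. b k j *s v j) =
            (\<Sum>j<Suc r. a ?k j *s v j) - a ?k r *s (v r - (\<Sum>j<r. c j *s v j))"
          by (simp add: b_def a'_def scale_left_distrib scale_right_diff_distrib sum.distrib
              scale_sum_right)
        then show ?thesis using a(2)[OF k] subspace_scale[OF L c] subspace_diff[OF L] by metis
      qed
      ultimately have "det (mat_delete A' i r) \<in> relation_minors r v"
        unfolding relation_minors_def by auto
      then have "det (mat_delete A' i r) \<in> Ideal (relation_minors r v)" using Ideal_superset by blast
      then show ?thesis unfolding cofactor_def by (rule Ideal_mult)
    qed
    ultimately show "D \<in> Ideal (relation_minors r v)"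
      unfolding a(1) A_def[symmetric] by (metis (no_types, lifting) Ideal_mult Ideal_sum lessThan_iff)
  qed
  show "Ideal (relation_minors r v) \<subseteq> Ideal (relation_minors (Suc r) v)"
  proof (rule Ideal_subset, rule subsetI)
    fix D assume "D \<in> relation_minors r v"
    then obtain a where a: "D = det (mat r r (\<lambda>(i, j). a i j))"
      "\<And>i. i < r \<Longrightarrow> (\<Sum>j<r. a i j *s v j) \<in> L"
      by (auto simp: relation_minors_def)
    define b where "b i j = (if i < r then if j < r then a i j else 0 else if j < r then - c j else 1)"
      for i j
    define M where "M = mat (Suc r) (Suc r) (\<lambda>(i, j). b i j)"
    have carr: "M \<in> carrier_mat (Suc r) (Suc r)" by (simp add: M_def)
    have "(\<Sum>j<Suc r. b i j *s v j) \<in> L" if "i < Suc r" for i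
    proof (cases "i < r")
      case True
      then show ?thesis using a(2) by (simp add: b_def)
    next
      case False
      then have "(\<Sum>j<Suc r. b i j *s v j) = v r - (\<Sum>j<r. c j *s v j)"
        by (simp add: b_def sum_negf)
      then show ?thesis using c by simp
    qed
    then have "det M \<in> relation_minors (Suc r) v" by (auto simp: relation_minors_def M_def)
    moreover have "det M = (\<Sum>i<Suc r. M $$ (i, r) * cofactor M i r)"
      by (rule laplace_expansion_column[OF carr]) simp
    then have "det M = det (mat_delete M r r)" by (simp add: M_def b_def cofactor_def)
    moreover have "mat_delete M r r = mat r r (\<lambda>(i, j). a i j)"
    proof (rule eq_matI)
      fix i j assume "i < dim_row (mat r r (\<lambda>(i, j). a i j))" "j < dim_col (mat r r (\<lambda>(i, j). a i j))"
      then show "mat_delete M r r $$ (i, j) = mat r r (\<lambda>(i, j). a i j) $$ (i, j)"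
        using mat_delete_index[OF carr, of r r i j] by (simp add: insert_index_def M_def b_def)
    qed (use carr in auto)
    ultimately show "D \<in> Ideal (relation_minors (Suc r) v)" using a(1) Ideal_superset by auto
  qed
qed

lemma Ideal_relation_minors_extend:
  assumes "generating_mod r v"
  shows "Ideal (relation_minors (r + s) v) = Ideal (relation_minors r v)"
proof (induction s)
  case (Suc s)
  obtain c where c: "v (r + s) - (\<Sum>j<r. c j *s v j) \<in> L"
    using assms by (auto simp: generating_mod_def)
  define c' where "c' j = (if j < r then c j else 0)" for j
  have "(\<Sum>j<r + s. c' j *s v j) = (\<Sum>j<r. c j *s v j)"
    by (rule sum.mono_neutral_cong_right) (auto simp: c'_def)
  then have "Ideal (relation_minors (Suc (r + s)) v) = Ideal (relation_minors (r + s) v)"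
    using c by (intro Ideal_relation_minors_Suc[where c = c']) simp
  then show ?case using Suc by simp
qed simp

lemma relation_minors_cong:
  "(\<And>j. j < r \<Longrightarrow> v j = w j) \<Longrightarrow> relation_minors r v = relation_minors r w"
  by (simp add: relation_minors_def)

lemma generating_mod_cong:
  "(\<And>j. j < r \<Longrightarrow> v j = w j) \<Longrightarrow> generating_mod r v = generating_mod r w"
  by (simp add: generating_mod_def)

lemma Ideal_relation_minors_permute_subset:
  assumes p: "p permutes {0..<r}"
  shows "Ideal (relation_minors r v) \<subseteq> Ideal (relation_minors r (v \<circ> p))"
proof (rule Ideal_subset, rule subsetI)
  fix D assume "D \<in> relation_minors r v"
  then obtain a where a: "D = det (mat r r (\<lambda>(i, j). a i j))"
    "\<And>i. i < r \<Longrightarrow> (\<Sum>j<r. a i j *s v j) \<in> L"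
    by (auto simp: relation_minors_def)
  have p_less: "p j < r" if "j < r" for j using permutes_in_image[OF p, of j] that by simp
  let ?A = "mat r r (\<lambda>(i, j). a i j)" and ?B = "mat r r (\<lambda>(i, j). a i (p j))"
  have "det (mat r r (\<lambda>(i, j). ?A\<^sup>T $$ (p i, j))) = signof p * det ?A\<^sup>T"
    by (rule det_permute_rows[OF _ p]) simp
  moreover have "mat r r (\<lambda>(i, j). ?A\<^sup>T $$ (p i, j)) = ?B\<^sup>T"
    by (rule eq_matI) (auto simp: p_less)
  moreover have "det ?A\<^sup>T = det ?A" "det ?B\<^sup>T = det ?B" by (rule det_transpose[of _ r], simp)+
  ultimately have "det ?B = signof p * det ?A" by simp
  moreover have "signof p = (1 :: 'a) \<or> signof p = (- 1 :: 'a)" by (simp add: sign_def)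
  ultimately have D: "D = det ?B \<or> D = - det ?B" using a(1) by auto
  have "(\<Sum>j<r. a i (p j) *s (v \<circ> p) j) \<in> L" if "i < r" for i
  proof -
    have "(\<Sum>j<r. a i (p j) *s (v \<circ> p) j) = (\<Sum>j<r. a i j *s v j)"
      using sum.permute[OF p, of "\<lambda>j. a i j *s v j"] by (simp add: comp_def atLeast0LessThan)
    then show ?thesis using a(2)[OF that] by simp
  qed
  then have "det ?B \<in> relation_minors r (v \<circ> p)"
    unfolding relation_minors_def by (auto intro!: exI[of _ "\<lambda>i j. a i (p j)"])
  then have "det ?B \<in> Ideal (relation_minors r (v \<circ> p))" using Ideal_superset by blast
  then show "D \<in> Ideal (relation_minors r (v \<circ> p))" using D Ideal_uminus by auto
qed

lemma Ideal_relation_minors_permute: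
  assumes p: "p permutes {0..<r}"
  shows "Ideal (relation_minors r (v \<circ> p)) = Ideal (relation_minors r v)"
proof (rule antisym)
  have "Ideal (relation_minors r (v \<circ> p)) \<subseteq> Ideal (relation_minors r (v \<circ> p \<circ> Hilbert_Choice.inv p))"
    by (rule Ideal_relation_minors_permute_subset[OF permutes_inv[OF p]])
  also have "v \<circ> p \<circ> Hilbert_Choice.inv p = v" using permutes_inv_o(1)[OF p] by (simp add: comp_assoc)
  finally show "Ideal (relation_minors r (v \<circ> p)) \<subseteq> Ideal (relation_minors r v)" .
qed (rule Ideal_relation_minors_permute_subset[OF p])

text \<open>Both families can be extended by the other one; the two concatenations differ by a permutation.\<close>

theorem Ideal_relation_minors_eq:
  assumes v: "generating_mod r v" and w: "generating_mod s w"
  shows "Ideal (relation_minors r v) = Ideal (relation_minors s w)"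
proof -
  define vw where "vw j = (if j < r then v j else w (j - r))" for j
  define wv where "wv j = (if j < s then w j else v (j - s))" for j
  define p where "p j = (if j < s then r + j else if j < r + s then j - s else j)" for j
  have p: "p permutes {0..<r + s}"
  proof (rule bij_imp_permutes)
    show "bij_betw p {0..<r + s} {0..<r + s}"
      by (rule bij_betw_byWitness[where f' = "\<lambda>j. if j < r then s + j else j - r"])
        (auto simp: p_def)
  qed (auto simp: p_def)
  have "Ideal (relation_minors r v) = Ideal (relation_minors r vw)"
    using relation_minors_cong[of r v vw] by (simp add: vw_def)
  also have "\<dots> = Ideal (relation_minors (r + s) vw)"
    using v generating_mod_cong[of r v vw]
    by (subst Ideal_relation_minors_extend) (auto simp: vw_def)
  also have "\<dots> = Ideal (relation_minors (r + s) (vw \<circ> p))"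
    by (rule Ideal_relation_minors_permute[OF p, symmetric])
  also have "relation_minors (r + s) (vw \<circ> p) = relation_minors (s + r) wv"
    unfolding add.commute[of r s] by (rule relation_minors_cong) (auto simp: vw_def wv_def p_def)
  also have "Ideal (relation_minors (s + r) wv) = Ideal (relation_minors s wv)"
    using w generating_mod_cong[of s w wv]
    by (subst Ideal_relation_minors_extend) (auto simp: wv_def)
  also have "\<dots> = Ideal (relation_minors s w)"
    using relation_minors_cong[of s w wv] by (simp add: wv_def)
  finally show ?thesis .
qed

end

end

section \<open>Quotients of free modules\<close>

abbreviation fscale :: "'r::comm_ring_1 \<Rightarrow> ('x \<Rightarrow>\<^sub>0 'r) \<Rightarrow> ('x \<Rightarrow>\<^sub>0 'r)" where
  "fscale a \<equiv> Poly_Mapping.map ((*) a)"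

lemma lookup_fscale [simp]: "Poly_Mapping.lookup (fscale a F) b = a * Poly_Mapping.lookup F b"
  by (simp add: Poly_Mapping.map.rep_eq when_def)

interpretation free: Modules.module "fscale :: 'r::comm_ring_1 \<Rightarrow> ('x \<Rightarrow>\<^sub>0 'r) \<Rightarrow> _"
  by unfold_locales (auto intro!: poly_mapping_eqI simp: lookup_add algebra_simps)

lemma free_module_simps [simp]:
  "carrier free_module = UNIV" "add free_module = (+)" "ring.zero free_module = 0"
  "module.smult free_module = fscale"
  by (simp_all add: free_module_def)

lemma abelian_group_free_module: "abelian_group (free_module :: ('r::comm_ring_1, 'x \<Rightarrow>\<^sub>0 'r) module)"
proof (rule abelian_groupI)
  fix x :: "'x \<Rightarrow>\<^sub>0 'r"
  show "\<exists>y\<in>carrier free_module. y \<oplus>\<^bsub>free_module\<^esub> x = \<zero>\<^bsub>free_module\<^esub>"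
    by (rule bexI[of _ "- x"]) auto
qed (auto simp: algebra_simps)

lemma submodule_free_module_iff:
  "submodule N (ring_of_type_algebra :: 'r::comm_ring_1 ring)
     (free_module :: ('r, 'x \<Rightarrow>\<^sub>0 'r) module) \<longleftrightarrow> free.subspace N"
proof
  interpret G: abelian_group "free_module :: ('r, 'x \<Rightarrow>\<^sub>0 'r) module" by (rule abelian_group_free_module)
  {
    assume "submodule N (ring_of_type_algebra :: 'r ring) (free_module :: ('r, 'x \<Rightarrow>\<^sub>0 'r) module)"
    then interpret submodule N "ring_of_type_algebra :: 'r ring" "free_module :: ('r, 'x \<Rightarrow>\<^sub>0 'r) module" .
    show "free.subspace N"
      using one_closed m_closed smult_closed by (auto simp: free.subspace_def ring_of_type_algebra_def)
  }
  assume N: "free.subspace N"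
  show "submodule N (ring_of_type_algebra :: 'r ring) (free_module :: ('r, 'x \<Rightarrow>\<^sub>0 'r) module)"
  proof (intro submodule.intro submodule_axioms.intro subgroup.intro)
    fix x assume "x \<in> N"
    have "\<ominus>\<^bsub>free_module\<^esub> x = - x" using G.minus_equality[of "- x" x] by simp
    then show "inv\<^bsub>add_monoid free_module\<^esub> x \<in> N"
      using free.subspace_neg[OF N \<open>x \<in> N\<close>] by (simp add: a_inv_def)
  qed (use N in \<open>auto simp: free.subspace_def\<close>)
qed

locale free_quotient =
  fixes K :: "('x \<Rightarrow>\<^sub>0 'r::comm_ring_1) set"
  assumes K: "free.subspace K"
begin

abbreviation "Q \<equiv> quotient_module free_module K"

definition "proj x = K +>\<^bsub>free_module\<^esub> x"

lemma proj_eq: "proj x = (\<lambda>y. y + x) ` K"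
  by (auto simp: proj_def a_r_coset_def')

lemma mem_proj_iff: "u \<in> proj x \<longleftrightarrow> u - x \<in> K"
  by (force simp: proj_eq image_iff)

lemma proj_eq_iff: "proj x = proj y \<longleftrightarrow> x - y \<in> K"
proof
  assume "proj x = proj y"
  moreover have "x \<in> proj x" using free.subspace_0[OF K] by (simp add: mem_proj_iff)
  ultimately show "x - y \<in> K" by (simp add: mem_proj_iff)
next
  assume xy: "x - y \<in> K"
  have "u - y = (u - x) + (x - y)" "u - x = (u - y) - (x - y)" for u by simp_all
  then show "proj x = proj y"
    unfolding set_eq_iff mem_proj_iff
    using free.subspace_add[OF K _ xy] free.subspace_diff[OF K _ xy] by metis
qed

lemma carrier_Q: "carrier Q = Set.range proj"
  by (auto simp: quotient_module_def A_RCOSETS_def' proj_def)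

lemma zero_Q: "\<zero>\<^bsub>Q\<^esub> = proj 0"
  by (simp add: quotient_module_def proj_eq)

lemma add_Q: "proj x \<oplus>\<^bsub>Q\<^esub> proj y = proj (x + y)"
proof -
  have "u \<in> proj x <+>\<^bsub>free_module\<^esub> proj y \<longleftrightarrow> (\<exists>k\<in>K. \<exists>l\<in>K. u = (k + x) + (l + y))" for u
    by (simp add: set_add_def' proj_eq)
  moreover have "(\<exists>k\<in>K. \<exists>l\<in>K. u = (k + x) + (l + y)) \<longleftrightarrow> u \<in> proj (x + y)" for u
  proof
    assume "\<exists>k\<in>K. \<exists>l\<in>K. u = (k + x) + (l + y)"
    then obtain k l where "k \<in> K" "l \<in> K" "u = (k + l) + (x + y)" by (auto simp: algebra_simps)
    then show "u \<in> proj (x + y)" using free.subspace_add[OF K] by (auto simp: proj_eq)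
  next
    assume "u \<in> proj (x + y)"
    then obtain k where "k \<in> K" "u = (k + x) + (0 + y)" by (auto simp: proj_eq algebra_simps)
    then show "\<exists>k\<in>K. \<exists>l\<in>K. u = (k + x) + (l + y)" using free.subspace_0[OF K] by blast
  qed
  ultimately show ?thesis by (simp add: quotient_module_def set_eq_iff)
qed

lemma smult_Q: "a \<odot>\<^bsub>Q\<^esub> proj x = proj (fscale a x)"
proof -
  have "u \<in> (fscale a ` proj x) <+>\<^bsub>free_module\<^esub> K \<longleftrightarrow> (\<exists>k\<in>K. \<exists>l\<in>K. u = fscale a (k + x) + l)" for u
    by (simp add: set_add_def' proj_eq)
  moreover have "(\<exists>k\<in>K. \<exists>l\<in>K. u = fscale a (k + x) + l) \<longleftrightarrow> u \<in> proj (fscale a x)" for u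
  proof
    assume "\<exists>k\<in>K. \<exists>l\<in>K. u = fscale a (k + x) + l"
    then obtain k l where "k \<in> K" "l \<in> K" "u = (fscale a k + l) + fscale a x"
      by (auto simp: free.scale_right_distrib algebra_simps)
    then show "u \<in> proj (fscale a x)"
      using free.subspace_add[OF K free.subspace_scale[OF K]] by (auto simp: proj_eq)
  next
    assume "u \<in> proj (fscale a x)"
    then obtain k where "k \<in> K" "u = fscale a (0 + x) + k" by (auto simp: proj_eq algebra_simps)
    then show "\<exists>k\<in>K. \<exists>l\<in>K. u = fscale a (k + x) + l" using free.subspace_0[OF K] by blast
  qed
  ultimately show ?thesis by (simp add: quotient_module_def set_eq_iff)
qed

lemma abelian_group_Q: "abelian_group Q"
proof (rule abelian_groupI)
  fix x assume "x \<in> carrier Q"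
  then obtain u where "x = proj u" by (auto simp: carrier_Q)
  then show "\<exists>y\<in>carrier Q. y \<oplus>\<^bsub>Q\<^esub> x = \<zero>\<^bsub>Q\<^esub>"
    by (intro bexI[of _ "proj (- u)"]) (auto simp: carrier_Q add_Q zero_Q)
qed (auto simp: carrier_Q add_Q zero_Q algebra_simps)

lemma finsum_Q: "(\<Oplus>\<^bsub>Q\<^esub>j\<in>{..<r::nat}. a j \<odot>\<^bsub>Q\<^esub> proj (v j)) = proj (\<Sum>j<r. fscale (a j) (v j))"
proof (induction r)
  interpret abelian_group Q by (rule abelian_group_Q)
  case 0
  then show ?case by (simp add: zero_Q)
next
  interpret abelian_group Q by (rule abelian_group_Q)
  case (Suc r)
  have "(\<Oplus>\<^bsub>Q\<^esub>j\<in>insert r {..<r}. a j \<odot>\<^bsub>Q\<^esub> proj (v j)) =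
      a r \<odot>\<^bsub>Q\<^esub> proj (v r) \<oplus>\<^bsub>Q\<^esub> (\<Oplus>\<^bsub>Q\<^esub>j\<in>{..<r}. a j \<odot>\<^bsub>Q\<^esub> proj (v j))"
    by (rule finsum_insert) (auto simp: carrier_Q smult_Q)
  then show ?case unfolding lessThan_Suc Suc by (simp add: smult_Q add_Q)
qed

lemma submodule_Q_image:
  assumes "free.subspace V"
  shows "submodule (proj ` V) (ring_of_type_algebra :: 'r ring) Q"
proof (intro submodule.intro submodule_axioms.intro subgroup.intro)
  interpret abelian_group Q by (rule abelian_group_Q)
  fix x assume "x \<in> proj ` V"
  then obtain u where u: "x = proj u" "u \<in> V" by auto
  have "\<ominus>\<^bsub>Q\<^esub> x = proj (- u)"
    using minus_equality[of "proj (- u)" x] by (simp add: u add_Q zero_Q carrier_Q)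
  then show "inv\<^bsub>add_monoid Q\<^esub> x \<in> proj ` V"
    using free.subspace_neg[OF assms u(2)] by (simp add: a_inv_def)
qed (use assms in \<open>auto simp: carrier_Q add_Q zero_Q smult_Q free.subspace_def\<close>)

lemma module_generators_Q:
  assumes "\<And>j. j < r \<Longrightarrow> m j = proj (v j)"
  shows "module_generators Q r m \<longleftrightarrow> free.generating_mod K r v"
proof
  assume "module_generators Q r m"
  then have gen: "submodule_gen (ring_of_type_algebra :: 'r ring) Q (m ` {..<r}) = carrier Q"
    by (simp add: module_generators_def)
  define V where "V = Set.range (\<lambda>c. \<Sum>j<r. fscale (c j) (v j))"
  have "free.subspace V"
  proof (rule free.subspaceI)
    show "0 \<in> V" unfolding V_def by (rule range_eqI[of _ _ "\<lambda>_. 0"]) simp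
    show "x + y \<in> V" if xy: "x \<in> V" "y \<in> V" for x y
    proof -
      obtain c c' where "x = (\<Sum>j<r. fscale (c j) (v j))" "y = (\<Sum>j<r. fscale (c' j) (v j))"
        using xy by (auto simp: V_def)
      then show ?thesis unfolding V_def
        by (intro range_eqI[of _ _ "\<lambda>j. c j + c' j"])
          (simp add: free.scale_left_distrib sum.distrib)
    qed
    show "fscale a x \<in> V" if x: "x \<in> V" for a x
    proof -
      obtain c where "x = (\<Sum>j<r. fscale (c j) (v j))" using x by (auto simp: V_def)
      then show ?thesis unfolding V_def
        by (intro range_eqI[of _ _ "\<lambda>j. a * c j"])
          (simp add: free.scale_sum_right free.scale_scale)
    qed
  qed
  then have sub: "submodule (proj ` V) (ring_of_type_algebra :: 'r ring) Q" by (rule submodule_Q_image)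
  moreover have "m ` {..<r} \<subseteq> proj ` V"
  proof (rule image_subsetI)
    fix j assume "j \<in> {..<r}"
    then have "(\<Sum>i<r. fscale (if i = j then 1 else 0) (v i)) = v j"
      by (subst sum.remove[of _ j]) auto
    then have "v j \<in> V" unfolding V_def by (intro range_eqI[of _ _ "\<lambda>i. if i = j then 1 else 0"]) simp
    then show "m j \<in> proj ` V" using assms[of j] \<open>j \<in> {..<r}\<close> by simp
  qed
  ultimately have "carrier Q \<subseteq> proj ` V" unfolding gen[symmetric] submodule_gen_def by blast
  then have "\<exists>u\<in>V. proj x = proj u" for x by (auto simp: carrier_Q)
  then show "free.generating_mod K r v"
    unfolding free.generating_mod_def[OF K] proj_eq_iff V_def by auto
next
  assume gen: "free.generating_mod K r v"
  have "x \<in> N" if N: "submodule N (ring_of_type_algebra :: 'r ring) Q" "m ` {..<r} \<subseteq> N"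
    and x: "x \<in> carrier Q" for N x
  proof -
    interpret submodule N "ring_of_type_algebra :: 'r ring" Q by (rule N(1))
    obtain u where u: "x = proj u" using x by (auto simp: carrier_Q)
    obtain c where c: "u - (\<Sum>j<r. fscale (c j) (v j)) \<in> K"
      using gen unfolding free.generating_mod_def[OF K] by blast
    have "proj (\<Sum>j<k. fscale (c j) (v j)) \<in> N" if "k \<le> r" for k
      using that
    proof (induction k)
      case 0
      then show ?case using one_closed by (simp add: zero_Q)
    next
      case (Suc k)
      have "proj (v k) \<in> N" using N(2) assms[of k] Suc.prems by (metis Suc_le_lessD imageI lessThan_iff subsetD)
      then have "c k \<odot>\<^bsub>Q\<^esub> proj (v k) \<in> N"
        by (intro smult_closed) (simp_all add: ring_of_type_algebra_def)
      then show ?case using m_closed[OF Suc.IH, of "proj (fscale (c k) (v k))"] Suc.prems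
        by (simp add: smult_Q add_Q)
    qed
    then have "proj (\<Sum>j<r. fscale (c j) (v j)) \<in> N" by simp
    moreover have "proj u = proj (\<Sum>j<r. fscale (c j) (v j))" using c proj_eq_iff by blast
    ultimately show ?thesis using u by simp
  qed
  moreover have "submodule (carrier Q) (ring_of_type_algebra :: 'r ring) Q"
    using submodule_Q_image[OF free.subspace_UNIV] by (simp add: carrier_Q)
  moreover have "m ` {..<r} \<subseteq> carrier Q" using assms by (auto simp: carrier_Q)
  ultimately show "module_generators Q r m"
    unfolding module_generators_def submodule_gen_def by blast
qed

lemma presentation_minors_ideal_Q:
  assumes "\<And>j. j < r \<Longrightarrow> m j = proj (v j)"
  shows "presentation_minors_ideal Q r m = Ideal (free.relation_minors K r v)"
proof -
  interpret abelian_group Q by (rule abelian_group_Q)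
  have "(\<Oplus>\<^bsub>Q\<^esub>j\<in>{..<r}. a j \<odot>\<^bsub>Q\<^esub> m j) = \<zero>\<^bsub>Q\<^esub> \<longleftrightarrow> (\<Sum>j<r. fscale (a j) (v j)) \<in> K" for a
  proof -
    have "(\<Oplus>\<^bsub>Q\<^esub>j\<in>{..<r}. a j \<odot>\<^bsub>Q\<^esub> m j) = (\<Oplus>\<^bsub>Q\<^esub>j\<in>{..<r}. a j \<odot>\<^bsub>Q\<^esub> proj (v j))"
      by (rule finsum_cong') (auto simp: assms carrier_Q smult_Q)
    then show ?thesis by (simp add: finsum_Q zero_Q proj_eq_iff)
  qed
  then show ?thesis
    unfolding presentation_minors_ideal_def free.relation_minors_def[OF K] by simp
qed

theorem Fitt0_Q:
  assumes "free.generating_mod K r v"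
  shows "Fitt0 Q = Ideal (free.relation_minors K r v)"
  unfolding Fitt0_def
proof (rule the_equality)
  show "\<exists>r' m. module_generators Q r' m \<and>
      Ideal (free.relation_minors K r v) = presentation_minors_ideal Q r' m"
    using assms module_generators_Q[of r "proj \<circ> v" v] presentation_minors_ideal_Q[of r "proj \<circ> v" v]
    by (intro exI[of _ r] exI[of _ "proj \<circ> v"]) simp
  fix J assume "\<exists>r' m. module_generators Q r' m \<and> J = presentation_minors_ideal Q r' m"
  then obtain r' m where m: "module_generators Q r' m" "J = presentation_minors_ideal Q r' m" by blast
  then have "\<forall>j. \<exists>w. j < r' \<longrightarrow> m j = proj w"
    unfolding module_generators_def carrier_Q by blast
  then obtain w where w: "\<And>j. j < r' \<Longrightarrow> m j = proj (w j)" by metis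
  then have "free.generating_mod K r' w" using m(1) module_generators_Q by blast
  then show "J = Ideal (free.relation_minors K r v)"
    using free.Ideal_relation_minors_eq[OF K assms] presentation_minors_ideal_Q[OF w] m(2) by simp
qed

end

section \<open>Differentials of \<open>k[x, y]\<close>\<close>

lemma coeff_dx [simp]: "coeff (dx h) j = pderiv (coeff h j)"
  by (simp add: dx_def coeff_map_poly)

lemma dx_add: "dx (a + b) = dx a + dx b"
  by (rule poly_eqI) (simp add: pderiv_add)

lemma dx_mult: "dx (a * b) = a * dx b + b * dx a"
proof (rule poly_eqI)
  fix j
  have "coeff (dx (a * b)) j = (\<Sum>i\<le>j. coeff a i * pderiv (coeff b (j - i)) + pderiv (coeff a i) * coeff b (j - i))"
    by (simp add: coeff_mult higher_pderiv_sum[where n = 1, simplified] pderiv_mult mult.commute)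
  also have "\<dots> = coeff (a * dx b) j + coeff (dx a * b) j"
    by (simp add: coeff_mult sum.distrib)
  finally show "coeff (dx (a * b)) j = coeff (a * dx b + b * dx a) j"
    by (simp add: mult.commute[of b])
qed

lemma dy_add: "dy (a + b) = dy a + dy b"
  by (simp add: dy_def pderiv_add)

lemma dy_mult: "dy (a * b) = a * dy b + b * dy a"
  by (simp add: dy_def pderiv_mult)

abbreviation const2 :: "'k::field \<Rightarrow> 'k poly poly" where "const2 c \<equiv> [:[:c:]:]"

definition var_x :: "'k::field poly poly" where "var_x = [:[:0, 1:]:]"

definition var_y :: "'k::field poly poly" where "var_y = [:0, 1:]"

lemma dx_const2 [simp]: "dx (const2 c) = 0" and dy_const2 [simp]: "dy (const2 c) = 0"
  by (simp_all add: dx_def dy_def map_poly_pCons pderiv_pCons)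

lemma dx_dy_vars [simp]:
  "dx var_x = 1" "dy var_x = 0" "dx var_y = 0" "dy var_y = 1"
  by (simp_all add: dx_def dy_def var_x_def var_y_def map_poly_pCons pderiv_pCons one_pCons)

text \<open>As a \<open>k\<close>-algebra, \<open>k[x, y]\<close> is generated by \<open>x\<close> and \<open>y\<close>.\<close>

lemma poly2_induct [case_names const x y add mult]:
  fixes h :: "'k::field poly poly"
  assumes const: "\<And>c. P (const2 c)" and "P var_x" "P var_y"
    and add: "\<And>a b. P a \<Longrightarrow> P b \<Longrightarrow> P (a + b)" and mult: "\<And>a b. P a \<Longrightarrow> P b \<Longrightarrow> P (a * b)"
  shows "P h"
proof (induction h)
  case 0
  then show ?case using const[of 0] by simp
next
  case (pCons a p)
  have "P [:a:]"
  proof (induction a)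
    case 0
    then show ?case using const[of 0] by simp
  next
    case (pCons c a)
    have "[:pCons c a:] = const2 c + var_x * [:a:]" by (simp add: var_x_def)
    then show ?case using add[OF const[of c] mult[OF \<open>P var_x\<close> pCons.IH]] by simp
  qed
  moreover have "pCons a p = [:a:] + var_y * p" by (simp add: var_y_def)
  ultimately show ?case using add[of "[:a:]" "var_y * p"] mult[OF \<open>P var_y\<close> pCons.IH] by simp
qed

section \<open>Values of polynomials in several variables\<close>

lemma subst_closed:
  fixes p :: "nat \<Rightarrow> 'r::comm_ring_1"
  assumes const: "\<And>c. P (\<phi> c)" and "P 0" "P 1"
    and add: "\<And>a b. P a \<Longrightarrow> P b \<Longrightarrow> P (a + b)" and mult: "\<And>a b. P a \<Longrightarrow> P b \<Longrightarrow> P (a * b)"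
    and gen: "\<And>i. i < n \<Longrightarrow> P (p i)" and F: "in_vars n F"
  shows "P (subst \<phi> F p)"
proof -
  have pow: "P (a ^ k)" if "P a" for a k
    by (induction k) (auto intro: mult that \<open>P 1\<close>)
  have prod: "P (prod a K)" if "\<And>i. i \<in> K \<Longrightarrow> P (a i)" for a and K :: "nat set"
    using that by (induction K rule: infinite_finite_induct) (auto intro: mult \<open>P 1\<close>)
  have sum: "P (sum a K)" if "\<And>i. i \<in> K \<Longrightarrow> P (a i)" for a and K :: "(nat \<Rightarrow>\<^sub>0 nat) set"
    using that by (induction K rule: infinite_finite_induct) (auto intro: add \<open>P 0\<close>)
  show ?thesis
    unfolding subst_def
    using F by (intro sum mult const prod pow gen) (auto simp: in_vars_def)
qed

lemma coord_ring_const: "const2 c \<in> coord_ring n g"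
proof -
  have "at_forms (Poly_Mapping.single 0 c) g = const2 c"
    by (cases "c = 0") (simp_all add: subst_def)
  moreover have "in_vars n (Poly_Mapping.single 0 c)" by (simp add: in_vars_def)
  ultimately show ?thesis unfolding coord_ring_def by (metis (mono_tags, lifting) mem_Collect_eq)
qed

lemma coord_ring_gen:
  assumes "i < n"
  shows "g i \<in> coord_ring n g"
proof -
  have "at_forms (Poly_Mapping.single (Poly_Mapping.single i 1) 1) g = g i"
    by (simp add: subst_def one_pCons[symmetric])
  moreover have "in_vars n (Poly_Mapping.single (Poly_Mapping.single i 1) 1)"
    using assms by (simp add: in_vars_def)
  ultimately show ?thesis unfolding coord_ring_def by (metis (mono_tags, lifting) mem_Collect_eq)
qed

section \<open>The module of differentials and the Jacobian matrix\<close>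

text \<open>The linear map on the free module that sends the symbol \<open>db\<close> to \<open>\<delta> b\<close>.\<close>

definition lin :: "('r \<Rightarrow> 'r) \<Rightarrow> ('r \<Rightarrow>\<^sub>0 'r) \<Rightarrow> 'r::comm_ring_1" where
  "lin \<delta> F = (\<Sum>b\<in>Poly_Mapping.keys F. Poly_Mapping.lookup F b * \<delta> b)"

lemma lin_superset:
  assumes "finite S" "Poly_Mapping.keys F \<subseteq> S"
  shows "lin \<delta> F = (\<Sum>b\<in>S. Poly_Mapping.lookup F b * \<delta> b)"
  unfolding lin_def using assms
  by (intro sum.mono_neutral_left) (auto simp: in_keys_iff)

lemma lin_add: "lin \<delta> (F + G) = lin \<delta> F + lin \<delta> G"
proof -
  let ?S = "Poly_Mapping.keys F \<union> Poly_Mapping.keys G"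
  have "Poly_Mapping.keys (F + G) \<subseteq> ?S" by (rule Poly_Mapping.keys_add)
  then show ?thesis
    using lin_superset[of ?S F \<delta>] lin_superset[of ?S G \<delta>] lin_superset[of ?S "F + G" \<delta>]
    by (simp add: lookup_add distrib_right sum.distrib)
qed

lemma lin_fscale: "lin \<delta> (fscale a F) = a * lin \<delta> F"
proof -
  have "Poly_Mapping.keys (fscale a F) \<subseteq> Poly_Mapping.keys F" by (auto simp: in_keys_iff)
  then show ?thesis
    by (simp add: lin_superset[of "Poly_Mapping.keys F"] sum_distrib_left mult.assoc)
qed

lemma lin_single [simp]: "lin \<delta> (Poly_Mapping.single b a) = a * \<delta> b"
  by (cases "a = 0") (simp_all add: lin_def)

lemma lin_zero [simp]: "lin \<delta> 0 = 0" by (simp add: lin_def)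

lemma lin_diff: "lin \<delta> (F - G) = lin \<delta> F - lin \<delta> G"
  using lin_add[of \<delta> "F - G" G] by simp

lemma poly_mapping_eq_sum_fscale:
  "F = (\<Sum>b\<in>Poly_Mapping.keys F. fscale (Poly_Mapping.lookup F b) (Poly_Mapping.single b 1))"
proof (rule poly_mapping_eqI)
  fix b
  have "Poly_Mapping.lookup (\<Sum>b\<in>Poly_Mapping.keys F. fscale (Poly_Mapping.lookup F b) (Poly_Mapping.single b 1)) b
      = (\<Sum>c\<in>Poly_Mapping.keys F. Poly_Mapping.lookup F c * (if c = b then 1 else 0))"
    unfolding lookup_sum by (rule sum.cong) (simp_all add: lookup_single when_def)
  also have "\<dots> = Poly_Mapping.lookup F b"
    by (simp add: if_distrib sum.delta in_keys_iff cong: if_cong)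
  finally show "Poly_Mapping.lookup F b = Poly_Mapping.lookup
      (\<Sum>b\<in>Poly_Mapping.keys F. fscale (Poly_Mapping.lookup F b) (Poly_Mapping.single b 1)) b" ..
qed

definition gradient_span :: "nat \<Rightarrow> (nat \<Rightarrow> 'k::field poly poly) \<Rightarrow> ('k poly poly \<times> 'k poly poly) set" where
  "gradient_span n g = Set.range (\<lambda>c. (\<Sum>i<n. c i * dx (g i), \<Sum>i<n. c i * dy (g i)))"

lemma gradient_span_zero: "(0, 0) \<in> gradient_span n g"
  unfolding gradient_span_def by (rule range_eqI[of _ _ "\<lambda>_. 0"]) simp

lemma gradient_span_add:
  assumes "(u, v) \<in> gradient_span n g" "(u', v') \<in> gradient_span n g"
  shows "(u + u', v + v') \<in> gradient_span n g"
proof -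
  obtain c c' where "u = (\<Sum>i<n. c i * dx (g i))" "v = (\<Sum>i<n. c i * dy (g i))"
    "u' = (\<Sum>i<n. c' i * dx (g i))" "v' = (\<Sum>i<n. c' i * dy (g i))"
    using assms by (auto simp: gradient_span_def)
  then show ?thesis unfolding gradient_span_def
    by (intro range_eqI[of _ _ "\<lambda>i. c i + c' i"]) (simp add: distrib_right sum.distrib)
qed

lemma gradient_span_mult:
  assumes "(u, v) \<in> gradient_span n g"
  shows "(a * u, a * v) \<in> gradient_span n g"
proof -
  obtain c where "u = (\<Sum>i<n. c i * dx (g i))" "v = (\<Sum>i<n. c i * dy (g i))"
    using assms by (auto simp: gradient_span_def)
  then show ?thesis unfolding gradient_span_def
    by (intro range_eqI[of _ _ "\<lambda>i. a * c i"]) (simp add: sum_distrib_left mult.assoc)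
qed

lemma gradient_span_gen:
  assumes "i < n"
  shows "(dx (g i), dy (g i)) \<in> gradient_span n g"
proof -
  have "(\<Sum>j<n. (if j = i then 1 else 0) * a j) = a i" for a :: "nat \<Rightarrow> 'a poly poly"
    using assms by (subst sum.remove[of _ i]) auto
  then show ?thesis unfolding gradient_span_def
    by (intro range_eqI[of _ _ "\<lambda>j. if j = i then 1 else 0"]) simp
qed

text \<open>By the product rule, the polynomials whose gradient lies in the span form a subalgebra; it contains the \<open>g\<^sub>i\<close>.\<close>

lemma gradient_coord_ring:
  assumes "h \<in> coord_ring n g"
  shows "(dx h, dy h) \<in> gradient_span n g"
proof -
  obtain F where F: "in_vars n F" "h = at_forms F g" using assms by (auto simp: coord_ring_def)
  let ?P = "\<lambda>h. (dx h, dy h) \<in> gradient_span n g"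
  have const: "?P (const2 c)" for c by (simp add: gradient_span_zero)
  show ?thesis unfolding F(2)
  proof (rule subst_closed[OF _ _ _ _ _ _ F(1), where P = ?P])
    show "?P (const2 c)" for c by (rule const)
    show "?P 0" using const[of 0] by simp
    show "?P 1" using const[of 1] by (simp add: one_pCons)
    show "?P (a + b)" if "?P a" "?P b" for a b
      using gradient_span_add[OF that] by (simp add: dx_add dy_add)
    show "?P (a * b)" if "?P a" "?P b" for a b
      using gradient_span_add[OF gradient_span_mult[OF that(2), of a] gradient_span_mult[OF that(1), of b]]
      by (simp add: dx_mult dy_mult)
    show "?P (g i)" if "i < n" for i by (rule gradient_span_gen[OF that])
  qed
qed

definition jac_minor :: "(nat \<Rightarrow> 'k::field poly poly) \<Rightarrow> nat \<Rightarrow> nat \<Rightarrow> 'k poly poly" where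
  "jac_minor g a b = dx (g a) * dy (g b) - dx (g b) * dy (g a)"

lemma det_mat_2: "det (mat 2 2 f) = f (0, 0) * f (1, 1) - f (0, 1) * f (1, 0 :: nat)"
  for f :: "nat \<times> nat \<Rightarrow> 'r::comm_ring_1"
proof -
  have "det (mat 2 2 f) = (\<Sum>i<2. mat 2 2 f $$ (i, 0) * cofactor (mat 2 2 f) i 0)"
    by (rule laplace_expansion_column[of _ 2]) auto
  also have "\<dots> = f (0, 0) * f (1, 1) - f (0, 1) * f (1, 0)"
    by (simp add: numeral_2_eq_2 cofactor_def mat_delete_def det_single)
  finally show ?thesis .
qed

lemma minors_ideal_jacobian:
  "minors_ideal 2 (jacobian_transposed n g) = Ideal {jac_minor g a b | a b. a < b \<and> b < n}"
proof -
  let ?N = "jacobian_transposed n g"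
  have dims: "dim_row ?N = 2" "dim_col ?N = n" by (simp_all add: jacobian_transposed_def)
  have I: "I = {0, 1}" if "I \<subseteq> {..<2}" "card I = 2" for I :: "nat set"
    using card_subset_eq[of "{..<2}" I] that by (auto simp: numeral_2_eq_2)
  have pickI: "pick I 0 = 0" "pick I (Suc 0) = Suc 0" if I: "I = {0, 1}" for I :: "nat set"
  proof -
    have "card I = 2" by (simp add: I)
    then have "pick I 0 \<in> I" "pick I 1 \<in> I" and less: "pick I 0 < pick I 1"
      by (auto intro!: pick_in_set_le pick_mono_le simp del: pick.simps)
    then have "pick I 0 = 0 \<or> pick I 0 = 1" "pick I 1 = 0 \<or> pick I 1 = 1"
      unfolding I by (auto simp del: pick.simps)
    then show "pick I 0 = 0" "pick I (Suc 0) = Suc 0" using less unfolding One_nat_def by linarith+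
  qed
  have minor: "pick J 0 \<in> J" "pick J 1 \<in> J" "pick J 0 < pick J 1"
    "det (submatrix ?N {0, 1} J) = jac_minor g (pick J 0) (pick J 1)"
    if J: "J \<subseteq> {..<n}" "card J = 2" for J
  proof -
    show *: "pick J 0 \<in> J" "pick J 1 \<in> J" "pick J 0 < pick J 1"
      using J by (auto intro!: pick_in_set_le pick_mono_le simp del: pick.simps)
    have sets: "{j. j < n \<and> j \<in> J} = J" "{i. i < 2 \<and> i \<in> {0, 1::nat}} = {0, 1}" "card {0, 1::nat} = 2"
      using J by auto
    then have "submatrix ?N {0, 1} J = mat 2 2 (\<lambda>(i, j). ?N $$ (pick {0, 1} i, pick J j))"
      by (simp only: submatrix_def dims sets J(2))
    moreover have "pick J 0 < n" "pick J 1 < n" using * J by auto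
    ultimately show "det (submatrix ?N {0, 1} J) = jac_minor g (pick J 0) (pick J 1)"
      by (simp add: det_mat_2 pickI[OF refl, unfolded One_nat_def] jacobian_transposed_def jac_minor_def del: pick.simps)
  qed
  have "{det (submatrix ?N I J) | I J. I \<subseteq> {..<2} \<and> J \<subseteq> {..<n} \<and> card I = 2 \<and> card J = 2} =
    {jac_minor g a b | a b. a < b \<and> b < n}" (is "?S = ?T")
  proof (intro equalityI subsetI)
    fix D assume "D \<in> ?S"
    then obtain I J where IJ: "D = det (submatrix ?N I J)" "I \<subseteq> {..<2}" "J \<subseteq> {..<n}" "card I = 2" "card J = 2"
      by blast
    then have "D = jac_minor g (pick J 0) (pick J 1)" using minor(4)[of J] I[of I] by simp
    moreover have "pick J 0 < pick J 1" "pick J 1 < n" using minor[of J] IJ by auto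
    ultimately show "D \<in> ?T" by blast
  next
    fix D assume "D \<in> ?T"
    then obtain a b where ab: "D = jac_minor g a b" "a < b" "b < n" by blast
    then have J: "{a, b} \<subseteq> {..<n}" "card {a, b} = 2" by auto
    then have "pick {a, b} 0 = a" "pick {a, b} 1 = b" using minor[OF J] ab(2) by auto
    then have "D = det (submatrix ?N {0, 1} {a, b})" using minor(4)[OF J] ab(1) by simp
    moreover have "{0, 1} \<subseteq> {..<2::nat}" "card {0, 1::nat} = 2" by auto
    ultimately show "D \<in> ?S" using J by blast
  qed
  then show ?thesis unfolding minors_ideal_def dims by simp
qed

text \<open>Modulo the relations, the symbol \<open>db\<close> is \<open>b\<^sub>x dx + b\<^sub>y dy\<close>: this holds for the generators of the
  algebra and passes to sums and products.  Hence \<open>\<Omega>\<close> is the free module on \<open>dx\<close> and \<open>dy\<close> modulo the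
  gradients of the elements of the subring.\<close>

theorem Fitt0_kaehler_differentials:
  fixes g :: "nat \<Rightarrow> 'k::field poly poly"
  shows "Fitt0 (kaehler_differentials (coord_ring n g)) = minors_ideal 2 (jacobian_transposed n g)"
proof -
  define K where "K = free.span (kaehler_relations (coord_ring n g))"
  have K: "free.subspace K" unfolding K_def by (rule free.subspace_span)
  have kaehler: "kaehler_differentials (coord_ring n g) = quotient_module free_module K"
    unfolding kaehler_differentials_def submodule_gen_def K_def free.span_def hull_def
      submodule_free_module_iff ..
  interpret free_quotient K by unfold_locales (rule K)
  let ?d = "\<lambda>b :: 'k poly poly. Poly_Mapping.single b (1 :: 'k poly poly)"
  define T where "T b = fscale (dx b) (?d var_x) + fscale (dy b) (?d var_y)" for b
  have rel: "r \<in> K" if "r \<in> kaehler_relations (coord_ring n g)" for r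
    unfolding K_def using that by (rule free.span_base)
  have rel_add: "?d (b + c) - (?d b + ?d c) \<in> K" for b c
    by (rule rel) (auto simp: kaehler_relations_def)
  have rel_mult: "?d (b * c) - (fscale b (?d c) + fscale c (?d b)) \<in> K" for b c
    by (rule rel) (auto simp: kaehler_relations_def)
  have rel_sub: "?d a \<in> K" if "a \<in> coord_ring n g" for a
    using that by (intro rel) (auto simp: kaehler_relations_def)
  have d_T: "?d b - T b \<in> K" for b
  proof (induction b rule: poly2_induct)
    case (const c)
    then show ?case using rel_sub[OF coord_ring_const] by (simp add: T_def)
  next
    case (add a b)
    have "?d (a + b) - T (a + b) = (?d (a + b) - (?d a + ?d b)) + (?d a - T a) + (?d b - T b)"
      by (simp add: T_def dx_add dy_add free.scale_left_distrib)
    then show ?case using add rel_add free.subspace_add[OF K] by metis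
  next
    case (mult a b)
    have "?d (a * b) - T (a * b) = (?d (a * b) - (fscale a (?d b) + fscale b (?d a)))
        + fscale a (?d b - T b) + fscale b (?d a - T a)"
      by (simp add: T_def dx_mult dy_mult free.scale_left_distrib free.scale_right_distrib
          free.scale_right_diff_distrib free.scale_scale)
    then show ?case
      using mult rel_mult free.subspace_add[OF K] free.subspace_scale[OF K] by metis
  qed (simp_all add: T_def free.subspace_0[OF K])
  define v where "v j = (if j = 0 then ?d var_x else ?d var_y)" for j :: nat
  have reduce: "F - (fscale (lin dx F) (?d var_x) + fscale (lin dy F) (?d var_y)) \<in> K" for F
  proof -
    have "fscale (lin dx F) (?d var_x) + fscale (lin dy F) (?d var_y) =
        (\<Sum>b\<in>Poly_Mapping.keys F. fscale (Poly_Mapping.lookup F b) (T b))"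
      by (simp add: lin_def T_def free.scale_sum_left free.scale_right_distrib sum.distrib
          free.scale_scale)
    then have eq: "F - (fscale (lin dx F) (?d var_x) + fscale (lin dy F) (?d var_y)) =
        (\<Sum>b\<in>Poly_Mapping.keys F. fscale (Poly_Mapping.lookup F b) (?d b - T b))"
      using poly_mapping_eq_sum_fscale[of F]
      by (simp add: free.scale_right_diff_distrib sum_subtractf)
    show ?thesis unfolding eq by (intro free.subspace_sum[OF K] free.subspace_scale[OF K] d_T)
  qed
  have lin_K: "(lin dx F, lin dy F) \<in> gradient_span n g" if "F \<in> K" for F
  proof -
    have "free.subspace {F. (lin dx F, lin dy F) \<in> gradient_span n g}"
      by (rule free.subspaceI)
        (auto simp: gradient_span_zero lin_add lin_fscale gradient_span_add gradient_span_mult)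
    moreover have "kaehler_relations (coord_ring n g) \<subseteq> {F. (lin dx F, lin dy F) \<in> gradient_span n g}"
      unfolding kaehler_relations_def
      by (auto simp: lin_diff lin_add dx_add dy_add dx_mult dy_mult gradient_span_zero
          intro: gradient_coord_ring)
    ultimately show ?thesis using that free.span_minimal unfolding K_def by blast
  qed
  have mem_K: "fscale a (?d var_x) + fscale b (?d var_y) \<in> K \<longleftrightarrow> (a, b) \<in> gradient_span n g" for a b
  proof
    assume "fscale a (?d var_x) + fscale b (?d var_y) \<in> K"
    then show "(a, b) \<in> gradient_span n g" using lin_K by (force simp: lin_add lin_fscale)
  next
    assume "(a, b) \<in> gradient_span n g"
    then obtain c where c: "a = (\<Sum>i<n. c i * dx (g i))" "b = (\<Sum>i<n. c i * dy (g i))"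
      by (auto simp: gradient_span_def)
    have "T (g i) \<in> K" if "i < n" for i
      using free.subspace_diff[OF K rel_sub[OF coord_ring_gen[OF that, of g]] d_T[of "g i"]] by simp
    then have "(\<Sum>i<n. fscale (c i) (T (g i))) \<in> K"
      by (intro free.subspace_sum[OF K] free.subspace_scale[OF K]) simp
    moreover have "(\<Sum>i<n. fscale (c i) (T (g i))) = fscale a (?d var_x) + fscale b (?d var_y)"
      by (simp add: c T_def free.scale_sum_left free.scale_right_distrib sum.distrib free.scale_scale)
    ultimately show "fscale a (?d var_x) + fscale b (?d var_y) \<in> K" by simp
  qed
  have sum2: "(\<Sum>j<2. fscale (c j) (v j)) = fscale (c 0) (?d var_x) + fscale (c 1) (?d var_y)" for c
    by (simp add: numeral_2_eq_2 v_def)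
  have "free.generating_mod K 2 v"
    unfolding free.generating_mod_def[OF K] sum2
  proof
    fix F
    show "\<exists>c :: nat \<Rightarrow> _. F - (fscale (c 0) (?d var_x) + fscale (c 1) (?d var_y)) \<in> K"
      using reduce[of F] by (intro exI[of _ "\<lambda>j. if j = 0 then lin dx F else lin dy F"]) simp
  qed
  then have "Fitt0 (kaehler_differentials (coord_ring n g)) = Ideal (free.relation_minors K 2 v)"
    unfolding kaehler by (rule Fitt0_Q)
  also have "free.relation_minors K 2 v = {a 0 0 * a 1 1 - a 0 1 * a 1 0 | a :: nat \<Rightarrow> nat \<Rightarrow> 'k poly poly.
      (a 0 0, a 0 1) \<in> gradient_span n g \<and> (a 1 0, a 1 1) \<in> gradient_span n g}"
    unfolding free.relation_minors_def[OF K] sum2 mem_K det_mat_2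
    by (simp add: numeral_2_eq_2 less_Suc_eq all_conj_distrib)
  also have "Ideal \<dots> = Ideal {jac_minor g a b | a b. a < b \<and> b < n}"
  proof (rule antisym)
    show "Ideal {a 0 0 * a 1 1 - a 0 1 * a 1 0 | a :: nat \<Rightarrow> nat \<Rightarrow> 'k poly poly.
        (a 0 0, a 0 1) \<in> gradient_span n g \<and> (a 1 0, a 1 1) \<in> gradient_span n g}
      \<subseteq> Ideal {jac_minor g a b | a b. a < b \<and> b < n}" (is "Ideal ?S \<subseteq> Ideal ?J")
    proof (rule Ideal_subset, rule subsetI)
      fix D assume "D \<in> ?S"
      then obtain a :: "nat \<Rightarrow> nat \<Rightarrow> 'k poly poly" and c c' where D: "D = a 0 0 * a 1 1 - a 0 1 * a 1 0"
        and a: "a 0 0 = (\<Sum>i<n. c i * dx (g i))" "a 0 1 = (\<Sum>i<n. c i * dy (g i))"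
          "a 1 0 = (\<Sum>i<n. c' i * dx (g i))" "a 1 1 = (\<Sum>i<n. c' i * dy (g i))"
        by (auto simp: gradient_span_def)
      have "D = (\<Sum>i<n. \<Sum>j<n. c i * c' j * jac_minor g i j)"
        unfolding D a sum_product sum_subtractf[symmetric] jac_minor_def
        by (intro sum.cong) (simp_all add: algebra_simps)
      moreover have "jac_minor g i j \<in> Ideal ?J" if ij: "i < n" "j < n" for i j
      proof -
        consider "i < j" | "i = j" | "j < i" by linarith
        then show ?thesis
        proof cases
          case 1
          then show ?thesis using ij Ideal_superset[of ?J] by blast
        next
          case 2
          then show ?thesis by (simp add: jac_minor_def Ideal_zero)
        next
          case 3
          then have "jac_minor g j i \<in> Ideal ?J" using ij Ideal_superset[of ?J] by blast
          moreover have "jac_minor g i j = - jac_minor g j i" by (simp add: jac_minor_def)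
          ultimately show ?thesis by (simp only: Ideal_uminus)
        qed
      qed
      ultimately show "D \<in> Ideal ?J" by (auto intro!: Ideal_sum Ideal_mult)
    qed
    show "Ideal ?J \<subseteq> Ideal ?S"
    proof (rule Ideal_subset, rule subsetI)
      fix D assume "D \<in> ?J"
      then obtain i j where ij: "D = jac_minor g i j" "i < n" "j < n" by auto
      define a where "a k l = (if l = 0 then dx (g (if k = 0 then i else j))
        else dy (g (if k = 0 then i else j)))" for k l :: nat
      have "D = a 0 0 * a 1 1 - a 0 1 * a 1 0"
        "(a 0 0, a 0 1) \<in> gradient_span n g" "(a 1 0, a 1 1) \<in> gradient_span n g"
        using ij gradient_span_gen by (auto simp: a_def jac_minor_def mult.commute)
      then have "D \<in> ?S" by blast
      then show "D \<in> Ideal ?S" using Ideal_superset[of ?S] by blast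
    qed
  qed
  also have "\<dots> = minors_ideal 2 (jacobian_transposed n g)" by (rule minors_ideal_jacobian[symmetric])
  finally show ?thesis .
qed

section \<open>Binary forms\<close>

lemma homogeneous_zero: "homogeneous e 0"
  by (simp add: homogeneous_def)

lemma homogeneous_add: "homogeneous e a \<Longrightarrow> homogeneous e b \<Longrightarrow> homogeneous e (a + b)"
  unfolding homogeneous_def coeff_add by (metis add_0)

lemma homogeneous_uminus: "homogeneous e a \<Longrightarrow> homogeneous e (- a)"
  by (simp add: homogeneous_def)

lemma homogeneous_diff: "homogeneous e a \<Longrightarrow> homogeneous e b \<Longrightarrow> homogeneous e (a - b)"
  using homogeneous_add[of e a "- b"] homogeneous_uminus[of e b] by simp

lemma homogeneous_mult:
  assumes "homogeneous e a" "homogeneous e' b"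
  shows "homogeneous (e + e') (a * b)"
  unfolding homogeneous_def
proof (intro allI impI)
  fix i j assume "coeff (coeff (a * b) j) i \<noteq> 0"
  then have "(\<Sum>k\<le>j. \<Sum>l\<le>i. coeff (coeff a k) l * coeff (coeff b (j - k)) (i - l)) \<noteq> 0"
    by (simp add: coeff_mult coeff_sum)
  then obtain k l where kl: "k \<le> j" "l \<le> i" "coeff (coeff a k) l * coeff (coeff b (j - k)) (i - l) \<noteq> 0"
    by (metis (no_types, lifting) atMost_iff sum.neutral)
  then have "l + k = e" "(i - l) + (j - k) = e'" using assms by (auto simp: homogeneous_def)
  then show "i + j = e + e'" using kl by linarith
qed

lemma is_unit_const2: "c \<noteq> 0 \<Longrightarrow> is_unit (const2 (c :: 'k::field))"
  by (simp add: is_unit_const_poly_iff dvd_field_iff)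

lemma smult_const_add: "smult [:a + b:] p = smult [:a:] p + smult [:b:] (p :: 'k::field poly poly)"
  by (simp flip: smult_add_left)

lemma homogeneous_const2: "homogeneous 0 (const2 c)"
  by (auto simp: homogeneous_def coeff_pCons split: nat.splits)

lemma homogeneous_vars: "homogeneous 1 var_x" "homogeneous 1 var_y"
  by (auto simp: homogeneous_def var_x_def var_y_def coeff_pCons split: nat.splits)

lemma homogeneous_one: "homogeneous 0 1"
  using homogeneous_const2[of 1] by (simp add: one_pCons)

lemma homogeneous_power: "homogeneous e a \<Longrightarrow> homogeneous (e * k) (a ^ k)"
proof (induction k)
  case (Suc k)
  then show ?case using homogeneous_mult[of e a "e * k" "a ^ k"] by simp
qed (simp add: homogeneous_one)

lemma homogeneous_const_mult: "homogeneous e a \<Longrightarrow> homogeneous e (const2 c * a)"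
  using homogeneous_mult[OF homogeneous_const2] by fastforce

lemma homogeneous_0E:
  assumes "homogeneous 0 h"
  obtains c where "h = const2 c"
proof
  show "h = const2 (coeff (coeff h 0) 0)"
  proof (rule poly_eqI, rule poly_eqI)
    fix i j
    show "coeff (coeff h j) i = coeff (coeff (const2 (coeff (coeff h 0) 0)) j) i"
      using assms by (cases i; cases j) (auto simp: homogeneous_def)
  qed
qed

lemma homogeneous_SucE:
  assumes "homogeneous (Suc e) h"
  obtains u v where "homogeneous e u" "homogeneous e v" "h = var_x * u + var_y * v"
proof -
  obtain a p where h: "h = pCons a p" by (rule pCons_cases)
  have a: "coeff a i = 0" if "i \<noteq> Suc e" for i
    using assms that unfolding homogeneous_def h by (metis add.right_neutral coeff_pCons_0)
  have "a = [:0, 1:] * monom (coeff a (Suc e)) e"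
  proof (rule poly_eqI)
    fix i
    show "coeff a i = coeff ([:0, 1:] * monom (coeff a (Suc e)) e) i"
      using a[of i] by (cases i) auto
  qed
  then have "h = var_x * [:monom (coeff a (Suc e)) e:] + var_y * p"
    unfolding h var_x_def var_y_def by simp
  moreover have "homogeneous e [:monom (coeff a (Suc e)) e:]"
    by (auto simp: homogeneous_def coeff_pCons split: nat.splits if_splits)
  moreover have "homogeneous e p"
    unfolding homogeneous_def
  proof (intro allI impI)
    fix i j assume "coeff (coeff p j) i \<noteq> 0"
    then have "coeff (coeff h (Suc j)) i \<noteq> 0" by (simp add: h)
    then have "i + Suc j = Suc e" using assms unfolding homogeneous_def by blast
    then show "i + j = e" by simp
  qed
  ultimately show thesis using that by blast
qed

text \<open>By induction on the degree, writing a form of positive degree as \<open>x u + y v\<close>.\<close>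

lemma euler_identity:
  "homogeneous e h \<Longrightarrow> var_x * dx h + var_y * dy h = const2 (of_nat e) * h"
proof (induction e arbitrary: h)
  case 0
  then obtain c where "h = const2 c" by (rule homogeneous_0E)
  then show ?case by simp
next
  case (Suc e)
  obtain u v where uv: "homogeneous e u" "homogeneous e v" "h = var_x * u + var_y * v"
    using homogeneous_SucE[OF Suc.prems] .
  have c: "const2 (of_nat (Suc e)) = 1 + const2 (of_nat e :: 'a)" by (simp add: one_pCons)
  have "var_x * dx h + var_y * dy h = h + var_x * (var_x * dx u + var_y * dy u)
      + var_y * (var_x * dx v + var_y * dy v)"
    by (simp add: uv(3) dx_add dx_mult dy_add dy_mult algebra_simps)
  also have "\<dots> = const2 (of_nat (Suc e)) * h"
    unfolding Suc.IH[OF uv(1)] Suc.IH[OF uv(2)] c by (simp only: uv(3) algebra_simps mult_1_left)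
  finally show ?case .
qed

lemma eval2_simps [simp]:
  "eval2 (a + b) q = eval2 a q + eval2 b q" "eval2 (a * b) q = eval2 a q * eval2 b q"
  "eval2 (- a) q = - eval2 a q" "eval2 (a - b) q = eval2 a q - eval2 b q"
  "eval2 (a ^ k) q = eval2 a q ^ k" "eval2 0 q = 0" "eval2 1 q = 1"
  "eval2 (const2 c) q = c" "eval2 (smult [:c:] a) q = c * eval2 a q" "eval2 var_x q = fst q" "eval2 var_y q = snd q"
  by (simp_all add: eval2_def var_x_def var_y_def)

lemma linear_formE:
  assumes "linear_form m"
  obtains \<alpha> \<beta> where "m = const2 \<alpha> * var_x + const2 \<beta> * var_y" "(\<alpha>, \<beta>) \<noteq> (0, 0)"
proof -
  have "homogeneous (Suc 0) m" using assms by (simp add: linear_form_def)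
  then obtain u v where uv: "homogeneous 0 u" "homogeneous 0 v" "m = var_x * u + var_y * v"
    by (rule homogeneous_SucE)
  obtain \<alpha> \<beta> where "u = const2 \<alpha>" "v = const2 \<beta>" using uv(1,2) by (metis homogeneous_0E)
  then have "m = const2 \<alpha> * var_x + const2 \<beta> * var_y" using uv(3) by (simp add: mult.commute)
  moreover from this have "(\<alpha>, \<beta>) \<noteq> (0, 0)" using assms by (auto simp: linear_form_def)
  ultimately show thesis using that by blast
qed

lemma linear_form_of_coeffs:
  assumes "(\<alpha>, \<beta>) \<noteq> (0, 0)"
  shows "linear_form (const2 \<alpha> * var_x + const2 \<beta> * var_y)"
proof -
  have "eval2 (const2 \<alpha> * var_x + const2 \<beta> * var_y) (1, 0) = \<alpha>"
    "eval2 (const2 \<alpha> * var_x + const2 \<beta> * var_y) (0, 1) = \<beta>" by simp_all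
  then have "const2 \<alpha> * var_x + const2 \<beta> * var_y \<noteq> 0" using assms by (metis eval2_simps(6))
  then show ?thesis
    unfolding linear_form_def
    using homogeneous_add homogeneous_const_mult homogeneous_vars by blast
qed

text \<open>Up to a unit, \<open>m\<close> is \<open>y - c\<close> with \<open>c \<in> k[x]\<close>, so that divisibility means vanishing at \<open>y = c\<close>, or it
  is the prime element \<open>x\<close> of \<open>k[x]\<close>.\<close>

lemma prime_elem_linear_form:
  assumes "linear_form (m :: 'k::field poly poly)"
  shows "prime_elem m"
proof -
  obtain \<alpha> \<beta> where m: "m = const2 \<alpha> * var_x + const2 \<beta> * var_y" "(\<alpha>, \<beta>) \<noteq> (0, 0)"
    using linear_formE[OF assms] .
  show ?thesis
  proof (cases "\<beta> = 0")
    case True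
    then have "m = [:[:0, \<alpha>:]:]" using m by (simp add: var_x_def)
    then show ?thesis
      using prime_elem_linear_field_poly[of \<alpha> 0] m True by (simp add: prime_elem_const_poly_iff)
  next
    case False
    define c where "c = [:0, - \<alpha> / \<beta>:]"
    have "m = [:- c, 1:] * const2 \<beta>"
      using False by (simp add: m(1) c_def var_x_def var_y_def)
    then have dvd: "m dvd h \<longleftrightarrow> poly h c = 0" for h
      using mult_unit_dvd_iff[OF is_unit_const2[OF False]] poly_eq_0_iff_dvd by metis
    show ?thesis
    proof (rule prime_elemI)
      show "m \<noteq> 0" using assms by (simp add: linear_form_def)
      show "\<not> is_unit m" by (simp add: dvd)
      show "m dvd a \<or> m dvd b" if "m dvd a * b" for a b using that by (simp add: dvd)
    qed
  qed
qed

lemma ex_eval2_nonzero: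
  fixes h :: "'k::field_char_0 poly poly"
  assumes "h \<noteq> 0"
  obtains q where "eval2 h q \<noteq> 0"
proof -
  have "finite {a. poly h a = 0}" using assms by (rule poly_roots_finite)
  then have "finite ((\<lambda>c. [:c:]) -` {a. poly h a = 0})"
    by (rule finite_vimageI) (simp add: inj_def)
  then have "finite {c. poly h [:c:] = 0}" by (simp add: vimage_def)
  then obtain c where c: "poly h [:c:] \<noteq> 0" using ex_new_if_finite infinite_UNIV_char_0 by blast
  then have "finite {a. poly (poly h [:c:]) a = 0}" by (rule poly_roots_finite)
  then obtain a where "poly (poly h [:c:]) a \<noteq> 0" using ex_new_if_finite infinite_UNIV_char_0 by blast
  then show thesis using that[of "(a, c)"] by (simp add: eval2_def)
qed

section \<open>Expansion along a line\<close>

text \<open>The power series in \<open>t\<close> of \<open>h\<close> at the point \<open>q + t q'\<close>.\<close>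

definition expand :: "'k::field \<times> 'k \<Rightarrow> 'k \<times> 'k \<Rightarrow> 'k poly poly \<Rightarrow> 'k fps" where
  "expand q q' h = fps_of_poly
     (poly (map_poly (\<lambda>a. pcompose a [:fst q, fst q':]) h) [:snd q, snd q':])"

lemma expand_0 [simp]: "expand q q' 0 = 0" by (simp add: expand_def)

lemma expand_pCons: "expand q q' (pCons a p) = fps_of_poly (pcompose a [:fst q, fst q':])
    + fps_of_poly [:snd q, snd q':] * expand q q' p"
  by (simp add: expand_def map_poly_pCons fps_of_poly_add fps_of_poly_mult)

lemma expand_add [simp]: "expand q q' (a + b) = expand q q' a + expand q q' b"
proof (induction a b rule: poly_induct2)
  case (pCons a p b q)
  then show ?case by (simp add: expand_pCons pcompose_add fps_of_poly_add algebra_simps)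
qed simp

lemma expand_smult: "expand q q' (smult a h) = fps_of_poly (pcompose a [:fst q, fst q':]) * expand q q' h"
  by (induction h) (simp_all add: expand_pCons pcompose_mult fps_of_poly_mult algebra_simps)

lemma expand_mult [simp]: "expand q q' (a * b) = expand q q' a * expand q q' b"
proof (induction a)
  case (pCons a p)
  show ?case
    unfolding mult_pCons_left expand_add expand_smult expand_pCons pCons.IH
    by (simp add: algebra_simps)
qed simp

lemma expand_const2 [simp]: "expand q q' (const2 c) = fps_const c"
  by (simp add: expand_pCons fps_of_poly_const)

lemma expand_smult_const [simp]: "expand q q' (smult [:c:] a) = fps_const c * expand q q' a"
  by (simp add: expand_smult fps_of_poly_const)

lemma expand_1 [simp]: "expand q q' 1 = 1"
  using expand_const2[of q q' 1] by (simp add: one_pCons)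

lemma expand_var_x: "expand q q' var_x = fps_const (fst q) + fps_const (fst q') * fps_X"
  and expand_var_y: "expand q q' var_y = fps_const (snd q) + fps_const (snd q') * fps_X"
  by (simp_all add: var_x_def var_y_def expand_pCons pcompose_pCons fps_of_poly_pCons
      fps_of_poly_const mult.commute pcompose_1 flip: one_pCons)

lemma expand_power [simp]: "expand q q' (a ^ k) = expand q q' a ^ k"
  by (induction k) simp_all

lemma expand_uminus [simp]: "expand q q' (- a) = - expand q q' a"
  using expand_add[of q q' a "- a"] by (simp del: expand_add add: eq_neg_iff_add_eq_0 add.commute)

lemma expand_diff [simp]: "expand q q' (a - b) = expand q q' a - expand q q' b"
  using expand_add[of q q' a "- b"] by (simp del: expand_add)

lemma expand_nth_0: "expand q q' h $ 0 = eval2 h q"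
  by (induction h rule: poly2_induct) (simp_all add: expand_var_x expand_var_y)

lemma fps_deriv_expand:
  "fps_deriv (expand q q' h) =
     fps_const (fst q') * expand q q' (dx h) + fps_const (snd q') * expand q q' (dy h)"
  by (induction h rule: poly2_induct)
    (simp_all add: expand_var_x expand_var_y dx_add dy_add dx_mult dy_mult algebra_simps)

text \<open>A linear form with its zero \<open>q\<close>, a second point \<open>q'\<close> of the projective line, and the linear form
  \<open>b\<close> that vanishes there.\<close>

locale linear_frame =
  fixes q q' :: "'k::field \<times> 'k" and m :: "'k poly poly"
  assumes linear_m: "linear_form m" and zero_m: "is_zero_of q m" and m_q': "eval2 m q' \<noteq> 0"
begin

definition b where "b = const2 (snd q') * var_x + const2 (- fst q') * var_y"

abbreviation "E \<equiv> expand q q'"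

lemma m_nonzero: "m \<noteq> 0" using linear_m by (simp add: linear_form_def)

lemma homogeneous_m: "homogeneous 1 m" using linear_m by (simp add: linear_form_def)

lemma homogeneous_b: "homogeneous 1 b"
  unfolding b_def by (intro homogeneous_add homogeneous_const_mult homogeneous_vars)

lemma m_q: "eval2 m q = 0" using zero_m by (simp add: is_zero_of_def)

lemma b_q': "eval2 b q' = 0" by (simp add: b_def mult.commute)

lemma b_q: "eval2 b q \<noteq> 0"
proof
  assume "eval2 b q = 0"
  then have eq: "snd q' * fst q = fst q' * snd q" by (simp add: b_def)
  obtain \<alpha> \<beta> where m: "m = const2 \<alpha> * var_x + const2 \<beta> * var_y"
    using linear_formE[OF linear_m] by blast
  have z: "\<alpha> * fst q + \<beta> * snd q = 0" using m_q by (simp add: m)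
  have "fst q * eval2 m q' = fst q' * (\<alpha> * fst q + \<beta> * snd q)"
    using eq by (simp add: m algebra_simps)
  moreover have "snd q * eval2 m q' = snd q' * (\<alpha> * fst q + \<beta> * snd q)"
    using eq by (simp add: m algebra_simps)
  ultimately have "fst q = 0" "snd q = 0" using z m_q' by auto
  then show False using zero_m by (auto simp: is_zero_of_def prod_eq_iff)
qed

lemma frame_det: "fst q * snd q' - snd q * fst q' \<noteq> 0"
  using b_q by (simp add: b_def algebra_simps)

lemma E_linear: "E (const2 \<alpha> * var_x + const2 \<beta> * var_y) =
    fps_const (\<alpha> * fst q + \<beta> * snd q) + fps_const (\<alpha> * fst q' + \<beta> * snd q') * fps_X"
  by (rule fps_ext) (simp add: expand_var_x expand_var_y algebra_simps)

lemma E_m: "E m = fps_const (eval2 m q') * fps_X"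
proof -
  obtain \<alpha> \<beta> where m: "m = const2 \<alpha> * var_x + const2 \<beta> * var_y"
    using linear_formE[OF linear_m] by blast
  have "\<alpha> * fst q + \<beta> * snd q = 0" using m_q by (simp add: m)
  then show ?thesis unfolding m E_linear by simp
qed

lemma E_b: "E b = fps_const (eval2 b q)"
  unfolding b_def E_linear by (simp add: mult.commute)

lemma vars_in_frame:
  obtains c\<^sub>1 c\<^sub>2 c\<^sub>3 c\<^sub>4 where "var_x = const2 c\<^sub>1 * m + const2 c\<^sub>2 * b" "var_y = const2 c\<^sub>3 * m + const2 c\<^sub>4 * b"
proof -
  obtain \<alpha> \<beta> where m: "m = const2 \<alpha> * var_x + const2 \<beta> * var_y"
    using linear_formE[OF linear_m] by blast
  define D where "D = \<alpha> * fst q' + \<beta> * snd q'"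
  have D: "D \<noteq> 0" using m_q' by (simp add: D_def m)
  have *: "const2 D * var_x = const2 (fst q') * m + const2 \<beta> * b"
    "const2 D * var_y = const2 (snd q') * m + const2 (- \<alpha>) * b"
    unfolding m b_def D_def var_x_def var_y_def by (simp_all add: algebra_simps)
  have inv: "v = const2 (inverse D) * (const2 D * v)" for v :: "'k poly poly"
    using D by (simp add: mult.assoc[symmetric] one_pCons[symmetric])
  have "var_x = const2 (inverse D * fst q') * m + const2 (inverse D * \<beta>) * b"
    "var_y = const2 (inverse D * snd q') * m + const2 (inverse D * - \<alpha>) * b"
    using inv[of var_x] inv[of var_y] unfolding * by (simp_all add: algebra_simps)
  then show thesis using that by blast
qed

text \<open>Division with remainder by \<open>m\<close>, with a multiple of a power of \<open>b\<close> as remainder.\<close>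

lemma form_divE:
  assumes "homogeneous (Suc e) h"
  obtains u c where "homogeneous e u" "h = m * u + const2 c * b ^ Suc e"
proof -
  obtain c\<^sub>1 c\<^sub>2 c\<^sub>3 c\<^sub>4 where vars: "var_x = const2 c\<^sub>1 * m + const2 c\<^sub>2 * b"
    "var_y = const2 c\<^sub>3 * m + const2 c\<^sub>4 * b" by (rule vars_in_frame)
  have "\<exists>u c. homogeneous e u \<and> h = m * u + const2 c * b ^ Suc e"
    using assms
  proof (induction e arbitrary: h)
    case (Suc e)
    obtain u v where uv: "homogeneous (Suc e) u" "homogeneous (Suc e) v" "h = var_x * u + var_y * v"
      using homogeneous_SucE[OF Suc.prems] .
    define w where "w = const2 c\<^sub>2 * u + const2 c\<^sub>4 * v"
    have "homogeneous (Suc e) w"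
      unfolding w_def using uv by (intro homogeneous_add homogeneous_const_mult)
    then obtain w' c where w': "homogeneous e w'" "w = m * w' + const2 c * b ^ Suc e"
      using Suc.IH by blast
    have "h = m * (const2 c\<^sub>1 * u + const2 c\<^sub>3 * v) + b * w"
      unfolding uv(3) vars w_def by (simp only: algebra_simps)
    also have "\<dots> = m * (const2 c\<^sub>1 * u + const2 c\<^sub>3 * v + b * w') + const2 c * b ^ Suc (Suc e)"
      unfolding w'(2) by (simp only: algebra_simps power_Suc)
    finally have "h = m * (const2 c\<^sub>1 * u + const2 c\<^sub>3 * v + b * w') + const2 c * b ^ Suc (Suc e)" .
    moreover have "homogeneous (Suc e) (const2 c\<^sub>1 * u + const2 c\<^sub>3 * v + b * w')"
      using uv homogeneous_mult[OF homogeneous_b w'(1)]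
      by (intro homogeneous_add homogeneous_const_mult) simp_all
    ultimately show ?case by blast
  next
    case 0
    obtain u v where uv: "homogeneous 0 u" "homogeneous 0 v" "h = var_x * u + var_y * v"
      using homogeneous_SucE[OF 0] .
    obtain c c' where "u = const2 c" "v = const2 c'" using uv(1,2) by (metis homogeneous_0E)
    then have "h = m * const2 (c\<^sub>1 * c + c\<^sub>3 * c') + const2 (c\<^sub>2 * c + c\<^sub>4 * c') * b ^ Suc 0"
      unfolding uv(3) vars by (simp add: algebra_simps smult_const_add)
    then show ?case using homogeneous_const2 by blast
  qed
  then show thesis using that by blast
qed

lemma form_expansion:
  assumes "homogeneous e h"
  obtains c where "h = (\<Sum>i\<le>e. const2 (c i) * (m ^ i * b ^ (e - i)))"
proof -
  have "\<exists>c. h = (\<Sum>i\<le>e. const2 (c i) * (m ^ i * b ^ (e - i)))"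
    using assms
  proof (induction e arbitrary: h)
    case 0
    then obtain c where "h = const2 c" by (rule homogeneous_0E)
    then show ?case by (intro exI[of _ "\<lambda>_. c"]) simp
  next
    case (Suc e)
    obtain u c0 where u: "homogeneous e u" "h = m * u + const2 c0 * b ^ Suc e"
      using form_divE[OF Suc.prems] .
    obtain c where c: "u = (\<Sum>i\<le>e. const2 (c i) * (m ^ i * b ^ (e - i)))" using Suc.IH[OF u(1)] by blast
    have "m * u = (\<Sum>i\<le>e. const2 (c i) * (m ^ Suc i * b ^ (Suc e - Suc i)))"
      unfolding c sum_distrib_left by (intro sum.cong) (simp_all add: mult_ac)
    then have "h = (\<Sum>i\<le>Suc e. const2 (case i of 0 \<Rightarrow> c0 | Suc i \<Rightarrow> c i) * (m ^ i * b ^ (Suc e - i)))"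
      unfolding u(2) sum.atMost_Suc_shift by (simp add: add.commute)
    then show ?case by blast
  qed
  then show thesis using that by blast
qed

lemma m_dvd_form:
  assumes "homogeneous (Suc e) h" "eval2 h q = 0"
  obtains u where "homogeneous e u" "h = m * u"
proof -
  obtain u c where u: "homogeneous e u" "h = m * u + const2 c * b ^ Suc e"
    using form_divE[OF assms(1)] .
  have "c * eval2 b q ^ Suc e = 0" using assms(2) unfolding u(2) by (simp add: m_q)
  then have "c = 0" using b_q by simp
  then show thesis using that u by simp
qed

lemma m_dvd_form_iff: "homogeneous e h \<Longrightarrow> m dvd h \<longleftrightarrow> eval2 h q = 0"
proof
  assume "m dvd h"
  then show "eval2 h q = 0" by (auto simp: m_q elim!: dvdE)
next
  assume h: "homogeneous e h" "eval2 h q = 0"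
  show "m dvd h"
  proof (cases e)
    case 0
    then obtain c where "h = const2 c" using h homogeneous_0E by metis
    then show ?thesis using h by simp
  next
    case (Suc e')
    then show ?thesis using m_dvd_form h by (metis dvd_triv_left)
  qed
qed

text \<open>On the line, \<open>m\<close> is a constant times \<open>t\<close> and \<open>b\<close> is a non-zero constant, so the order of \<open>t\<close> in the
  expansion of a form counts the factors \<open>m\<close>.\<close>

lemma fps_X_power_dvd_E:
  assumes "homogeneous e h"
  shows "fps_X ^ r dvd E h \<longleftrightarrow> m ^ r dvd h"
proof
  assume "m ^ r dvd h"
  then have "E (m ^ r) dvd E h" by (metis dvd_def expand_mult)
  moreover have "fps_X ^ r dvd E (m ^ r)" by (simp add: E_m power_mult_distrib)
  ultimately show "fps_X ^ r dvd E h" by (rule dvd_trans[rotated])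
next
  assume "fps_X ^ r dvd E h"
  then show "m ^ r dvd h" using assms
  proof (induction r arbitrary: e h)
    case (Suc r)
    have "E h $ 0 = 0" using Suc.prems(1) unfolding fps_X_power_dvd_iff by blast
    then have q: "eval2 h q = 0" by (simp add: expand_nth_0)
    show ?case
    proof (cases e)
      case 0
      then obtain c where "h = const2 c" using Suc.prems homogeneous_0E by metis
      then show ?thesis using q by simp
    next
      case (Suc e')
      then obtain u where u: "homogeneous e' u" "h = m * u" using m_dvd_form Suc.prems(2) q by metis
      have "fps_X * fps_X ^ r dvd fps_X * (fps_const (eval2 m q') * E u)"
        using Suc.prems(1) by (simp add: u(2) E_m mult_ac)
      then have "fps_X ^ r dvd fps_const (eval2 m q') * E u" by simp
      then have "fps_X ^ r dvd fps_const (inverse (eval2 m q')) * (fps_const (eval2 m q') * E u)"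
        by (rule dvd_mult)
      then have "fps_X ^ r dvd E u" using m_q' by (simp add: mult.assoc[symmetric])
      then show ?thesis using Suc.IH[OF _ u(1)] by (simp add: u(2) mult_dvd_mono)
    qed
  qed simp
qed

lemma E_eq_0_iff:
  assumes "homogeneous e h"
  shows "E h = 0 \<longleftrightarrow> h = 0"
proof
  assume "E h = 0"
  then show "h = 0" using assms
  proof (induction e arbitrary: h)
    case 0
    then obtain c where "h = const2 c" using homogeneous_0E by blast
    then show ?case using 0 by simp
  next
    case (Suc e)
    have "eval2 h q = 0" using Suc.prems(1) expand_nth_0[of q q' h] by simp
    then obtain u where u: "homogeneous e u" "h = m * u" using m_dvd_form Suc.prems(2) by metis
    have "E m \<noteq> 0" using m_q' by (simp add: E_m)
    then have "E u = 0" using Suc.prems(1) by (simp add: u(2))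
    then show ?case using Suc.IH u by simp
  qed
qed simp

end

lemma ex_linear_frame:
  assumes "linear_form (m :: 'k::field_char_0 poly poly)" "is_zero_of q m"
  shows "\<exists>q'. linear_frame q q' m"
proof -
  obtain q' where "eval2 m q' \<noteq> 0"
    using ex_eval2_nonzero[of m] assms(1) by (auto simp: linear_form_def)
  then show ?thesis using assms by (intro exI[of _ q']) unfold_locales
qed

lemma ex_zero_linear_form:
  assumes "linear_form m"
  obtains q where "is_zero_of q m"
proof -
  obtain \<alpha> \<beta> where m: "m = const2 \<alpha> * var_x + const2 \<beta> * var_y" "(\<alpha>, \<beta>) \<noteq> (0, 0)"
    using linear_formE[OF assms] .
  then have "is_zero_of (\<beta>, - \<alpha>) m" by (auto simp: is_zero_of_def mult.commute)
  then show thesis by (rule that)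
qed

lemma ex_linear_form_zero:
  assumes "q \<noteq> (0, 0)"
  obtains m where "linear_form m" "is_zero_of q m"
proof
  show "linear_form (const2 (snd q) * var_x + const2 (- fst q) * var_y)"
    by (rule linear_form_of_coeffs) (use assms in \<open>auto simp: prod_eq_iff\<close>)
  show "is_zero_of q (const2 (snd q) * var_x + const2 (- fst q) * var_y)"
    using assms by (simp add: is_zero_of_def mult.commute)
qed

section \<open>Factorisation and greatest common divisors of binary forms\<close>

lemma form_dehomogenization_degree:
  "homogeneous e h \<Longrightarrow> degree (poly h [:1:]) \<le> e"
proof (induction e arbitrary: h)
  case 0
  then obtain c where "h = const2 c" using homogeneous_0E by blast
  then show ?case by simp
next
  case (Suc e)
  obtain u v where uv: "homogeneous e u" "homogeneous e v" "h = var_x * u + var_y * v"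
    using homogeneous_SucE[OF Suc.prems] .
  have "poly h [:1:] = [:0, 1:] * poly u [:1:] + poly v [:1:]"
    by (simp add: uv(3) var_x_def var_y_def)
  moreover have "degree ([:0, 1:] * poly u [:1:]) \<le> Suc e"
    using degree_mult_le[of "[:0, 1:]" "poly u [:1:]"] Suc.IH[OF uv(1)] by simp
  moreover have "degree (poly v [:1:]) \<le> Suc e" using Suc.IH[OF uv(2)] by simp
  ultimately show ?case using degree_add_le by metis
qed

text \<open>Either \<open>(1, 0)\<close> is a zero, or \<open>h(x, 1)\<close> has the same degree as \<open>h\<close> and therefore a root.\<close>

lemma form_has_zero:
  fixes h :: "'k::{alg_closed_field, field_char_0} poly poly"
  assumes "homogeneous (Suc e) h"
  obtains q where "q \<noteq> (0, 0)" "eval2 h q = 0"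
proof (cases "eval2 h (1, 0) = 0")
  case True
  then show thesis using that[of "(1, 0)"] by simp
next
  case False
  obtain u v where uv: "homogeneous e u" "homogeneous e v" "h = var_x * u + var_y * v"
    using homogeneous_SucE[OF assms] .
  interpret linear_frame "(1, 0)" "(0, 1)" "var_y :: 'k poly poly"
    by unfold_locales
      (use linear_form_of_coeffs[of "0 :: 'k" 1] in \<open>simp_all add: is_zero_of_def one_pCons[symmetric]\<close>)
  obtain u c where u: "homogeneous e u" "h = var_y * u + const2 c * b ^ Suc e"
    using form_divE[OF assms] .
  have b: "b = var_x" by (simp add: b_def one_pCons[symmetric])
  have "c \<noteq> 0" using False by (simp add: u(2) b)
  have p: "poly h [:1:] = poly u [:1:] + monom c (Suc e)"
    by (simp add: u(2) b var_x_def var_y_def monom_altdef)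
  have "degree (poly u [:1:]) < degree (monom c (Suc e))"
    using form_dehomogenization_degree[OF u(1)] \<open>c \<noteq> 0\<close> by (simp add: degree_monom_eq)
  then have "degree (poly h [:1:]) = Suc e"
    unfolding p using \<open>c \<noteq> 0\<close> by (simp add: degree_add_eq_right degree_monom_eq)
  then obtain a where "poly (poly h [:1:]) a = 0" using alg_closed_imp_poly_has_root[of "poly h [:1:]"] by auto
  then show thesis using that[of "(a, 1)"] by (simp add: eval2_def)
qed

lemma form_has_linear_factor:
  fixes h :: "'k::{alg_closed_field, field_char_0} poly poly"
  assumes "homogeneous (Suc e) h"
  obtains m u where "linear_form m" "homogeneous e u" "h = m * u"
proof -
  obtain q where q: "q \<noteq> (0, 0)" "eval2 h q = 0" using form_has_zero[OF assms] .
  obtain m where m: "linear_form m" "is_zero_of q m" using ex_linear_form_zero[OF q(1)] .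
  then obtain q' where "linear_frame q q' m" using ex_linear_frame by blast
  then show thesis using linear_frame.m_dvd_form[OF _ assms q(2)] m that by metis
qed

lemma dvd_quotient_by_prime:
  fixes c :: "'a::idom"
  assumes "prime_elem m" "c dvd m * u" "\<not> m dvd c"
  shows "c dvd u"
proof -
  obtain y where y: "m * u = c * y" using assms(2) by (elim dvdE)
  then have "m dvd c * y" by (metis dvd_triv_left)
  then obtain y' where "y = m * y'" using assms(1,3) by (auto simp: prime_elem_dvd_mult_iff elim!: dvdE)
  then have "m * u = m * (c * y')" using y by (simp add: mult_ac)
  then show ?thesis using assms(1) by (auto simp: prime_elem_def)
qed

lemma form_divisor:
  fixes h :: "'k::{alg_closed_field, field_char_0} poly poly"
  assumes "homogeneous e h" "h \<noteq> 0" "c dvd h"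
  shows "is_unit c \<or> (\<exists>m. linear_form m \<and> m dvd c)"
  using assms
proof (induction e arbitrary: h)
  case 0
  then obtain a where "h = const2 a" using homogeneous_0E by blast
  then have "is_unit h" using 0 by (auto intro: is_unit_const2)
  then show ?case using 0(3) dvd_trans by blast
next
  case (Suc e)
  obtain m u where m: "linear_form m" "homogeneous e u" "h = m * u"
    using form_has_linear_factor[OF Suc.prems(1)] .
  then show ?case
    using Suc.IH[of u] Suc.prems dvd_quotient_by_prime[OF prime_elem_linear_form[OF m(1)], of c u]
    by auto
qed

text \<open>A common linear factor is split off as long as there is one; a common divisor of forms without a
  common linear factor is a unit, since every other divisor of a non-zero form has a linear factor.\<close>

lemma forms_gcd:
  fixes F :: "'k::{alg_closed_field, field_char_0} poly poly set"
  assumes "\<And>h. h \<in> F \<Longrightarrow> homogeneous e h" "h\<^sub>0 \<in> F" "h\<^sub>0 \<noteq> 0"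
  shows "\<exists>A. (\<forall>m\<in>#A. linear_form m) \<and> (\<forall>h\<in>F. prod_mset A dvd h) \<and>
    (\<forall>c. (\<forall>h\<in>F. c dvd h) \<longrightarrow> c dvd prod_mset A)"
  using assms
proof (induction e arbitrary: F h\<^sub>0)
  case 0
  obtain a where "h\<^sub>0 = const2 a" using 0 homogeneous_0E by metis
  then have "is_unit h\<^sub>0" using 0 by (auto intro: is_unit_const2)
  then have "\<forall>c. (\<forall>h\<in>F. c dvd h) \<longrightarrow> c dvd 1" using 0(2) dvd_trans by blast
  then show ?case by (intro exI[of _ "{#}"]) simp
next
  case (Suc e)
  show ?case
  proof (cases "\<exists>m. linear_form m \<and> (\<forall>h\<in>F. m dvd h)")
    case True
    then obtain m where m: "linear_form m" "\<And>h. h \<in> F \<Longrightarrow> m dvd h" by blast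
    obtain q where q: "is_zero_of q m" using ex_zero_linear_form[OF m(1)] .
    obtain q' where "linear_frame q q' m" using ex_linear_frame[OF m(1) q] by blast
    then interpret linear_frame q q' m .
    define F' where "F' = {u. homogeneous e u \<and> m * u \<in> F}"
    have F: "\<exists>u\<in>F'. h = m * u" if "h \<in> F" for h
      using m_dvd_form[OF Suc.prems(1)[OF that]] m_dvd_form_iff[OF Suc.prems(1)[OF that]] m(2)[OF that] that
      unfolding F'_def by blast
    obtain u\<^sub>0 where "u\<^sub>0 \<in> F'" "u\<^sub>0 \<noteq> 0" using F[OF Suc.prems(2)] Suc.prems(3) by auto
    then obtain A where A: "\<forall>m\<in>#A. linear_form m" "\<forall>u\<in>F'. prod_mset A dvd u"
      "\<And>c. (\<forall>u\<in>F'. c dvd u) \<Longrightarrow> c dvd prod_mset A"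
      using Suc.IH[of F' u\<^sub>0] by (auto simp: F'_def)
    have "c dvd m * prod_mset A" if c: "\<forall>h\<in>F. c dvd h" for c
    proof (cases "m dvd c")
      case True
      then obtain c' where c': "c = m * c'" by (elim dvdE)
      have "c' dvd u" if "u \<in> F'" for u
      proof -
        have "m * c' dvd m * u" using c that by (auto simp: F'_def c')
        then show ?thesis using m_nonzero by simp
      qed
      then show ?thesis using A(3) by (simp add: c' mult_dvd_mono)
    next
      case False
      have "c dvd u" if "u \<in> F'" for u
        by (rule dvd_quotient_by_prime[OF prime_elem_linear_form[OF m(1)] _ False])
          (use c that in \<open>simp add: F'_def\<close>)
      then show ?thesis using A(3) by (simp add: dvd_mult)
    qed
    moreover have "m * prod_mset A dvd h" if "h \<in> F" for h
      using F[OF that] A(2) by (auto simp: mult_dvd_mono)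
    ultimately show ?thesis using A(1) m(1) by (intro exI[of _ "add_mset m A"]) auto
  next
    case False
    have "is_unit c" if "\<forall>h\<in>F. c dvd h" for c
      using form_divisor[OF Suc.prems(1)[OF Suc.prems(2)] Suc.prems(3), of c] that Suc.prems(2) False
        dvd_trans by blast
    then show ?thesis by (intro exI[of _ "{#}"]) simp
  qed
qed

lemma PIdl_eq: "PIdl\<^bsub>B_ring\<^esub> a = {h. a dvd h}"
  unfolding cgenideal_def ring_of_type_algebra_def dvd_def by (auto simp: mult.commute)

lemma PIdl_eq_iff: "PIdl\<^bsub>B_ring\<^esub> a = PIdl\<^bsub>B_ring\<^esub> b \<longleftrightarrow> a dvd b \<and> b dvd a"
proof
  assume "PIdl\<^bsub>B_ring\<^esub> a = PIdl\<^bsub>B_ring\<^esub> b"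
  then have "a dvd h \<longleftrightarrow> b dvd h" for h unfolding PIdl_eq by (simp only: set_eq_iff mem_Collect_eq)
  from this[of a] this[of b] show "a dvd b \<and> b dvd a" by (simp only: dvd_refl)
next
  assume "a dvd b \<and> b dvd a"
  then show "PIdl\<^bsub>B_ring\<^esub> a = PIdl\<^bsub>B_ring\<^esub> b" unfolding PIdl_eq using dvd_trans by blast
qed

lemma linear_form_dvd_linear_form:
  assumes "linear_form (m :: 'k::field_char_0 poly poly)" "linear_form l" "m dvd l"
  shows "l dvd m"
proof -
  obtain q where q: "is_zero_of q m" using ex_zero_linear_form[OF assms(1)] .
  obtain q' where "linear_frame q q' m" using ex_linear_frame[OF assms(1) q] by blast
  then interpret linear_frame q q' m .
  have "homogeneous (Suc 0) l" "eval2 l q = 0"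
    using assms m_dvd_form_iff by (auto simp: linear_form_def)
  then obtain u where u: "homogeneous 0 u" "l = m * u" by (rule m_dvd_form)
  then obtain c where c: "u = const2 c" using homogeneous_0E by blast
  then have "is_unit u" using u assms(2) by (intro is_unit_const2[of c, folded c]) (auto simp: linear_form_def)
  then show ?thesis unfolding u(2) by (simp add: mult_unit_dvd_iff)
qed

lemma linear_forms_factorization:
  assumes "\<forall>m\<in>#A. linear_form (m :: 'k::field_char_0 poly poly)"
  shows "\<exists>s l f h u. linear_ideals_factorization s l f h \<and> is_unit u \<and> prod_mset A = u * h"
  using assms
proof (induction A)
  case empty
  show ?case
    by (rule exI[of _ 0]) (auto simp: linear_ideals_factorization_def intro: exI[of _ 1])
next
  case (add m A)
  then obtain s l f h u where IH: "linear_ideals_factorization s l f h" "is_unit u" "prod_mset A = u * h"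
    by auto
  then have l: "\<And>i. i < s \<Longrightarrow> linear_form (l i)" "inj_on (\<lambda>i. PIdl\<^bsub>B_ring\<^esub> (l i)) {..<s}"
    and h: "h = (\<Prod>i<s. l i ^ f i)"
    by (auto simp: linear_ideals_factorization_def)
  show ?case
  proof (cases "\<exists>i<s. PIdl\<^bsub>B_ring\<^esub> m = PIdl\<^bsub>B_ring\<^esub> (l i)")
    case True
    then obtain i where i: "i < s" "m dvd l i" "l i dvd m" unfolding PIdl_eq_iff by blast
    then obtain v w where vw: "m = l i * v" "l i = m * w" by (elim dvdE)
    have "m \<noteq> 0" using add.prems by (simp add: linear_form_def)
    moreover have "m * 1 = m * (w * v)" using vw by (metis mult.assoc mult.right_neutral)
    ultimately have "is_unit v" by (metis dvd_triv_right mult_left_cancel)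
    define f' where "f' = f(i := Suc (f i))"
    have "(\<Prod>j<s. l j ^ f' j) = l i ^ f' i * (\<Prod>j\<in>{..<s} - {i}. l j ^ f' j)"
      using i by (intro prod.remove) auto
    also have "(\<Prod>j\<in>{..<s} - {i}. l j ^ f' j) = (\<Prod>j\<in>{..<s} - {i}. l j ^ f j)"
      by (intro prod.cong) (auto simp: f'_def)
    also have "l i ^ f' i * \<dots> = l i * (l i ^ f i * (\<Prod>j\<in>{..<s} - {i}. l j ^ f j))"
      by (simp add: f'_def mult_ac)
    also have "l i ^ f i * (\<Prod>j\<in>{..<s} - {i}. l j ^ f j) = h"
      unfolding h using i by (intro prod.remove[symmetric]) auto
    finally have "(\<Prod>j<s. l j ^ f' j) = l i * h" .
    then have "linear_ideals_factorization s l f' (l i * h)"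
      using l by (auto simp: linear_ideals_factorization_def)
    moreover have "prod_mset (add_mset m A) = (u * v) * (l i * h)"
      using IH(3) by (simp add: vw(1) mult_ac)
    ultimately show ?thesis using IH(2) \<open>is_unit v\<close> by (metis is_unit_mult_iff)
  next
    case False
    define l' where "l' = l(s := m)"
    define f' where "f' = f(s := 1)"
    have "(\<Prod>i<s. l' i ^ f' i) = h"
      unfolding h by (intro prod.cong) (auto simp: l'_def f'_def)
    then have "(\<Prod>i<Suc s. l' i ^ f' i) = h * m" by (simp add: l'_def f'_def)
    moreover have "inj_on (\<lambda>i. PIdl\<^bsub>B_ring\<^esub> (l' i)) {..<Suc s}"
      using l(2) False unfolding inj_on_def l'_def by (auto simp: less_Suc_eq)
    moreover have "\<forall>i<Suc s. linear_form (l' i)"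
      using l(1) add.prems by (auto simp: l'_def less_Suc_eq)
    ultimately have "linear_ideals_factorization (Suc s) l' f' (h * m)"
      by (simp add: linear_ideals_factorization_def)
    moreover have "prod_mset (add_mset m A) = u * (h * m)" using IH(3) by (simp add: mult_ac)
    ultimately show ?thesis using IH(2) by blast
  qed
qed

text \<open>The prime element \<open>m\<close> divides no power of a linear form that generates another ideal.\<close>

lemma power_dvd_factorization_iff:
  assumes fac: "linear_ideals_factorization s l f h" and m: "linear_form (m :: 'k::field_char_0 poly poly)"
  shows "i < s \<Longrightarrow> PIdl\<^bsub>B_ring\<^esub> m = PIdl\<^bsub>B_ring\<^esub> (l i) \<Longrightarrow> m ^ r dvd h \<longleftrightarrow> r \<le> f i"
    and "\<forall>i<s. PIdl\<^bsub>B_ring\<^esub> m \<noteq> PIdl\<^bsub>B_ring\<^esub> (l i) \<Longrightarrow> m ^ r dvd h \<longleftrightarrow> r = 0"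
proof -
  have l: "\<And>i. i < s \<Longrightarrow> linear_form (l i)" and inj: "inj_on (\<lambda>i. PIdl\<^bsub>B_ring\<^esub> (l i)) {..<s}"
    and h: "h = (\<Prod>i<s. l i ^ f i)"
    using fac by (auto simp: linear_ideals_factorization_def)
  have prime: "prime_elem m" using prime_elem_linear_form[OF m] .
  have not_dvd: "\<not> m dvd (\<Prod>i\<in>K. l i ^ f i)"
    if "finite K" "\<And>i. i \<in> K \<Longrightarrow> i < s \<and> PIdl\<^bsub>B_ring\<^esub> m \<noteq> PIdl\<^bsub>B_ring\<^esub> (l i)" for K
  proof
    assume "m dvd (\<Prod>i\<in>K. l i ^ f i)"
    with that(1) have "\<exists>i\<in>K. m dvd l i ^ f i"
    proof (induction K rule: finite_induct)
      case empty
      then show ?case using prime by (simp add: prime_elem_def)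
    qed (auto simp: prime_elem_dvd_mult_iff[OF prime])
    then obtain i where "i \<in> K" "m dvd l i ^ f i" by blast
    then have "m dvd l i" using prime_elem_dvd_power[OF prime] by blast
    then show False
      using linear_form_dvd_linear_form[OF m l] that(2)[OF \<open>i \<in> K\<close>] by (auto simp: PIdl_eq_iff)
  qed
  {
    assume i: "i < s" "PIdl\<^bsub>B_ring\<^esub> m = PIdl\<^bsub>B_ring\<^esub> (l i)"
    then have dvd: "m dvd l i" "l i dvd m" by (auto simp: PIdl_eq_iff)
    define c where "c = (\<Prod>j\<in>{..<s} - {i}. l j ^ f j)"
    have h': "h = l i ^ f i * c" unfolding h c_def using i by (intro prod.remove) auto
    have c: "\<not> m dvd c"
      unfolding c_def using inj i by (intro not_dvd) (auto simp: inj_on_def)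
    show "m ^ r dvd h \<longleftrightarrow> r \<le> f i"
    proof
      assume "m ^ r dvd h"
      show "r \<le> f i"
      proof (rule ccontr)
        assume "\<not> r \<le> f i"
        then have "m ^ Suc (f i) dvd h" using \<open>m ^ r dvd h\<close> by (meson dvd_trans le_imp_power_dvd not_less_eq_eq)
        moreover have "h dvd m ^ f i * c" unfolding h' using dvd by (intro mult_dvd_mono dvd_power_same) auto
        ultimately have "m ^ f i * m dvd m ^ f i * c" by (metis dvd_trans power_Suc2)
        then show False using c m by (simp add: linear_form_def)
      qed
    next
      assume "r \<le> f i"
      then have "m ^ r dvd l i ^ f i" using dvd by (meson dvd_power_same dvd_trans le_imp_power_dvd)
      then show "m ^ r dvd h" unfolding h' by simp
    qed
  }
  {
    assume "\<forall>i<s. PIdl\<^bsub>B_ring\<^esub> m \<noteq> PIdl\<^bsub>B_ring\<^esub> (l i)"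
    then have "\<not> m dvd h" unfolding h by (intro not_dvd) auto
    then show "m ^ r dvd h \<longleftrightarrow> r = 0" by (metis dvd_power dvd_trans gr0I one_dvd power_0)
  }
qed

section \<open>A common denominator for an integral extension\<close>

text \<open>If \<open>\<tau>\<close> is integral over \<open>A\<close> of degree \<open>d\<close> and \<open>v\<close> is a common denominator of \<open>1, \<tau>, \<dots>, \<tau>\<^sup>d\<^sup>-\<^sup>1\<close>,
  then \<open>v\<close> multiplies all of \<open>J\<^sup>k A[\<tau>]\<close> into \<open>J\<^sup>k\<close>; and \<open>W \<in> J A[\<tau>]\<close> implies \<open>W\<^sup>k \<in> J\<^sup>k A[\<tau>]\<close>.\<close>

lemma (in adic_subring) common_denominator:
  fixes \<tau> W v :: 'a
  assumes d: "d > 0"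
    and integral: "\<tau> ^ d = (\<Sum>i<d. a i * \<tau> ^ i)" and a: "\<And>i. a i \<in> A"
    and W: "W = z * (\<Sum>i\<le>e. c i * \<tau> ^ i)" and z: "z \<in> J" and c: "\<And>i. c i \<in> A"
    and v: "\<And>i. i < d \<Longrightarrow> v * \<tau> ^ i \<in> A"
  shows "v * (W ^ k * \<tau> ^ i) \<in> P k"
proof -
  define M where "M k = {\<Sum>i<d. p i * \<tau> ^ i | p. \<forall>i. p i \<in> P k}" for k
  have M_zero: "0 \<in> M k" for k
    unfolding M_def using P_zero[of k] by (auto intro!: exI[of _ "\<lambda>_. 0"])
  have M_add: "x + y \<in> M k" if x: "x \<in> M k" and y: "y \<in> M k" for x y k
  proof -
    obtain p p' where p: "x = (\<Sum>i<d. p i * \<tau> ^ i)" "y = (\<Sum>i<d. p' i * \<tau> ^ i)"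
      "\<And>i. p i \<in> P k" "\<And>i. p' i \<in> P k"
      using x y unfolding M_def by blast
    then have "x + y = (\<Sum>i<d. (p i + p' i) * \<tau> ^ i)" by (simp add: distrib_right sum.distrib)
    moreover have "\<forall>i. p i + p' i \<in> P k" using p P_add by simp
    ultimately show ?thesis unfolding M_def by (intro CollectI exI conjI)
  qed
  have M_sum: "sum x K \<in> M k" if "\<And>i. i \<in> K \<Longrightarrow> x i \<in> M k" for x k and K :: "nat set"
    using that by (induction K rule: infinite_finite_induct) (auto simp: M_zero M_add)
  have mono: "x * \<tau> ^ i \<in> M k" if "x \<in> P k" for x i k
    using that
  proof (induction i arbitrary: x rule: less_induct)
    case (less i)
    show ?case
    proof (cases "i < d")
      case True
      have "x * \<tau> ^ i = (\<Sum>j<d. (if j = i then x else 0) * \<tau> ^ j)"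
        using True by (subst sum.remove[of _ i]) auto
      moreover have "\<forall>j. (if j = i then x else 0) \<in> P k" using less.prems P_zero by simp
      ultimately show ?thesis unfolding M_def by (intro CollectI exI conjI)
    next
      case False
      then have "x * \<tau> ^ i = x * \<tau> ^ (i - d) * \<tau> ^ d"
        by (simp add: mult.assoc flip: power_add)
      also have "\<dots> = (\<Sum>j<d. (x * a j) * \<tau> ^ (i - d + j))"
        unfolding integral sum_distrib_left by (intro sum.cong) (simp_all add: power_add mult_ac)
      also have "\<dots> \<in> M k"
        using False d less.prems a by (intro M_sum less.IH) (auto intro: P_mult_right)
      finally show ?thesis .
    qed
  qed
  have W_M: "W * x \<in> M (Suc k)" if x: "x \<in> M k" for x k
  proof -
    obtain p where p: "x = (\<Sum>i<d. p i * \<tau> ^ i)" "\<And>i. p i \<in> P k" using x unfolding M_def by blast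
    have "W * x = z * ((\<Sum>j\<le>e. c j * \<tau> ^ j) * (\<Sum>i<d. p i * \<tau> ^ i))"
      by (simp add: W p(1) mult.assoc)
    also have "\<dots> = (\<Sum>j\<le>e. \<Sum>i<d. z * ((c j * \<tau> ^ j) * (p i * \<tau> ^ i)))"
      unfolding sum_product by (simp only: sum_distrib_left)
    also have "\<dots> = (\<Sum>j\<le>e. \<Sum>i<d. (p i * z * c j) * \<tau> ^ (j + i))"
      by (intro sum.cong) (simp_all add: power_add mult_ac)
    also have "\<dots> \<in> M (Suc k)"
      by (intro M_sum mono P_mult_right[OF P_Suc_mult[OF p(2) z] c])
    finally show ?thesis .
  qed
  have "W ^ k * \<tau> ^ i \<in> M k"
  proof (induction k)
    case 0
    have "1 \<in> P 0" by (simp add: ideal_pow_0 one_mem)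
    then show ?case using mono[of 1 0 i] by simp
  next
    case (Suc k)
    then show ?case using W_M[OF Suc] by (simp add: mult.assoc)
  qed
  then obtain p where p: "W ^ k * \<tau> ^ i = (\<Sum>i<d. p i * \<tau> ^ i)" "\<And>i. p i \<in> P k"
    unfolding M_def by blast
  have "v * (W ^ k * \<tau> ^ i) = (\<Sum>i<d. p i * (v * \<tau> ^ i))"
    unfolding p(1) sum_distrib_left by (intro sum.cong) (simp_all add: mult_ac)
  also have "\<dots> \<in> P k" using p(2) v by (intro P_sum P_mult_right) auto
  finally show ?thesis .
qed

section \<open>Wronskians of power series\<close>

text \<open>The order of vanishing drops by exactly one under differentiation in characteristic zero, so the
  Wronskian with a unit detects the order of a power series without constant term.\<close>

lemma dvd_Wronskian_unit:
  fixes \<gamma> \<eta> :: "'k::field_char_0 fps"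
  assumes \<gamma>: "\<gamma> $ 0 \<noteq> 0" and \<eta>: "\<eta> $ 0 = 0"
    and dvd: "fps_X ^ r dvd \<gamma> * fps_deriv \<eta> - \<eta> * fps_deriv \<gamma>"
  shows "fps_X ^ Suc r dvd \<eta>"
proof -
  have "fps_X ^ Suc s dvd \<eta>" if "s \<le> r" for s
    using that
  proof (induction s)
    case 0
    show ?case using \<eta> unfolding fps_X_power_dvd_iff by simp
  next
    case (Suc s)
    then have IH: "fps_X ^ Suc s dvd \<eta>" by simp
    then have "fps_deriv \<eta> $ i = 0" if "i < s" for i
      using that unfolding fps_X_power_dvd_iff by simp
    then have "fps_X ^ s dvd fps_deriv \<eta>" unfolding fps_X_power_dvd_iff by blast
    then obtain w where w: "fps_deriv \<eta> = fps_X ^ s * w" by (elim dvdE)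
    have "w $ 0 = fps_deriv \<eta> $ s" by (simp add: w fps_X_power_mult_nth)
    then have w0: "w $ 0 = of_nat (Suc s) * \<eta> $ Suc s" by simp
    have "(\<gamma> * fps_deriv \<eta> - \<eta> * fps_deriv \<gamma>) $ s = 0"
      using dvd Suc.prems unfolding fps_X_power_dvd_iff by simp
    moreover have "fps_X ^ Suc s dvd \<eta> * fps_deriv \<gamma>" using IH by simp
    then have "(\<eta> * fps_deriv \<gamma>) $ s = 0" unfolding fps_X_power_dvd_iff by blast
    moreover have "(\<gamma> * fps_deriv \<eta>) $ s = \<gamma> $ 0 * w $ 0"
      by (simp add: w mult.left_commute[of \<gamma>] fps_X_power_mult_nth)
    ultimately have "of_nat (Suc s) * \<eta> $ Suc s = 0" using \<gamma> w0 by simp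
    then have "\<eta> $ Suc s = 0" by (simp only: mult_eq_0_iff of_nat_eq_0_iff) simp
    then show ?case using IH by (rule fps_X_power_dvd_Suc[rotated])
  qed
  then show ?thesis by simp
qed

text \<open>If all \<open>\<gamma>\<^sub>i\<close> are multiples of one series modulo \<open>t\<^sup>r\<^sup>+\<^sup>1\<close>, then their Wronskians vanish modulo \<open>t\<^sup>r\<close>; for
  the converse, compare each \<open>\<gamma>\<^sub>i\<close> with the unit \<open>\<gamma>\<^sub>j\<close>.\<close>

lemma Wronskians_dvd_iff:
  fixes \<gamma> :: "nat \<Rightarrow> 'k::field_char_0 fps"
  assumes j: "j < n" "\<gamma> j $ 0 \<noteq> 0"
  shows "(\<forall>a<n. \<forall>b<n. fps_X ^ r dvd \<gamma> a * fps_deriv (\<gamma> b) - \<gamma> b * fps_deriv (\<gamma> a)) \<longleftrightarrow>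
    (\<forall>i<n. fps_X ^ Suc r dvd fps_const (\<gamma> j $ 0) * \<gamma> i - fps_const (\<gamma> i $ 0) * \<gamma> j)"
    (is "?L \<longleftrightarrow> ?R")
proof
  assume L: ?L
  show ?R
  proof (intro allI impI)
    fix i assume "i < n"
    let ?\<eta> = "fps_const (\<gamma> j $ 0) * \<gamma> i - fps_const (\<gamma> i $ 0) * \<gamma> j"
    have "\<gamma> j * fps_deriv ?\<eta> - ?\<eta> * fps_deriv (\<gamma> j) =
        fps_const (\<gamma> j $ 0) * (\<gamma> j * fps_deriv (\<gamma> i) - \<gamma> i * fps_deriv (\<gamma> j))"
      by (simp add: algebra_simps)
    then have "fps_X ^ r dvd \<gamma> j * fps_deriv ?\<eta> - ?\<eta> * fps_deriv (\<gamma> j)"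
      using L j(1) \<open>i < n\<close> by simp
    then show "fps_X ^ Suc r dvd ?\<eta>"
      using j(2) by (intro dvd_Wronskian_unit[of "\<gamma> j"]) simp_all
  qed
next
  assume R: ?R
  define \<sigma> where "\<sigma> = fps_const (inverse (\<gamma> j $ 0)) * \<gamma> j"
  define \<epsilon> where "\<epsilon> i = \<gamma> i - fps_const (\<gamma> i $ 0) * \<sigma>" for i
  have \<epsilon>: "fps_X ^ Suc r dvd \<epsilon> i" if "i < n" for i
  proof -
    let ?c = "fps_const (inverse (\<gamma> j $ 0))"
    have one: "?c * fps_const (\<gamma> j $ 0) = 1" using j(2) by simp
    have "?c * (fps_const (\<gamma> j $ 0) * \<gamma> i - fps_const (\<gamma> i $ 0) * \<gamma> j) =
        (?c * fps_const (\<gamma> j $ 0)) * \<gamma> i - fps_const (\<gamma> i $ 0) * (?c * \<gamma> j)"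
      by (simp only: right_diff_distrib mult.assoc mult.left_commute)
    then have "\<epsilon> i = ?c * (fps_const (\<gamma> j $ 0) * \<gamma> i - fps_const (\<gamma> i $ 0) * \<gamma> j)"
      unfolding one by (simp add: \<epsilon>_def \<sigma>_def)
    then show ?thesis using R that by (simp only: dvd_mult)
  qed
  have \<epsilon>': "fps_X ^ r dvd \<epsilon> i" "fps_X ^ r dvd fps_deriv (\<epsilon> i)" if "i < n" for i
    using \<epsilon>[OF that] unfolding fps_X_power_dvd_iff by simp_all
  show ?L
  proof (intro allI impI)
    fix a b assume ab: "a < n" "b < n"
    have \<gamma>: "\<gamma> i = fps_const (\<gamma> i $ 0) * \<sigma> + \<epsilon> i" for i by (simp add: \<epsilon>_def)
    let ?p = "fps_const (\<gamma> a $ 0)" and ?q = "fps_const (\<gamma> b $ 0)"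
    have "\<gamma> a * fps_deriv (\<gamma> b) - \<gamma> b * fps_deriv (\<gamma> a) =
        (?p * \<sigma> + \<epsilon> a) * (?q * fps_deriv \<sigma> + fps_deriv (\<epsilon> b))
        - (?q * \<sigma> + \<epsilon> b) * (?p * fps_deriv \<sigma> + fps_deriv (\<epsilon> a))"
      by (subst (1 2) \<gamma>[of a], subst (1 2) \<gamma>[of b]) simp
    also have "\<dots> = ?p * \<sigma> * fps_deriv (\<epsilon> b) + \<epsilon> a * (?q * fps_deriv \<sigma> + fps_deriv (\<epsilon> b))
        - (?q * \<sigma> * fps_deriv (\<epsilon> a) + \<epsilon> b * (?p * fps_deriv \<sigma> + fps_deriv (\<epsilon> a)))"
      by (simp add: algebra_simps)
    also have "fps_X ^ r dvd \<dots>"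
      using \<epsilon>'[OF ab(1)] \<epsilon>'[OF ab(2)] by (intro dvd_diff dvd_add dvd_mult dvd_mult2)
    finally show "fps_X ^ r dvd \<gamma> a * fps_deriv (\<gamma> b) - \<gamma> b * fps_deriv (\<gamma> a)" .
  qed
qed

section \<open>Values of forms\<close>

definition form_values :: "nat \<Rightarrow> (nat \<Rightarrow> 'k::field poly poly) \<Rightarrow> nat \<Rightarrow> 'k poly poly set" where
  "form_values n g e = {at_forms F g | F. is_form n e F}"

definition monomial_value :: "(nat \<Rightarrow> 'r::comm_ring_1) \<Rightarrow> (nat \<Rightarrow>\<^sub>0 nat) \<Rightarrow> 'r" where
  "monomial_value p m = (\<Prod>i\<in>Poly_Mapping.keys m. p i ^ Poly_Mapping.lookup m i)"

definition monomial_degree :: "(nat \<Rightarrow>\<^sub>0 nat) \<Rightarrow> nat" where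
  "monomial_degree m = (\<Sum>i\<in>Poly_Mapping.keys m. Poly_Mapping.lookup m i)"

lemma monomial_superset:
  assumes "finite S" "Poly_Mapping.keys m \<subseteq> S"
  shows "monomial_value p m = (\<Prod>i\<in>S. p i ^ Poly_Mapping.lookup m i)"
    and "monomial_degree m = (\<Sum>i\<in>S. Poly_Mapping.lookup m i)"
  using assms unfolding monomial_value_def monomial_degree_def
  by (auto intro!: prod.mono_neutral_left sum.mono_neutral_left simp: in_keys_iff)

lemma monomial_add:
  "monomial_value p (m + m') = monomial_value p m * monomial_value p m'"
  "monomial_degree (m + m') = monomial_degree m + monomial_degree m'"
proof -
  let ?S = "Poly_Mapping.keys m \<union> Poly_Mapping.keys m'"
  have "Poly_Mapping.keys (m + m') \<subseteq> ?S" by (rule Poly_Mapping.keys_add)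
  then show "monomial_value p (m + m') = monomial_value p m * monomial_value p m'"
    "monomial_degree (m + m') = monomial_degree m + monomial_degree m'"
    by (simp_all add: monomial_superset[of ?S] lookup_add power_add prod.distrib sum.distrib)
qed

lemma subst_eq: "subst \<phi> F p = (\<Sum>m\<in>Poly_Mapping.keys F. \<phi> (Poly_Mapping.lookup F m) * monomial_value p m)"
  by (simp add: subst_def monomial_value_def)

lemma is_form_iff: "is_form n e F \<longleftrightarrow>
  (\<forall>m\<in>Poly_Mapping.keys F. Poly_Mapping.keys m \<subseteq> {..<n} \<and> monomial_degree m = e)"
  by (auto simp: is_form_def in_vars_def monomial_degree_def)

lemma form_values_zero: "0 \<in> form_values n g e"
  unfolding form_values_def by (auto intro!: exI[of _ 0] simp: subst_def is_form_iff)

lemma form_values_add: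
  assumes "a \<in> form_values n g e" "b \<in> form_values n g e"
  shows "a + b \<in> form_values n g e"
proof -
  obtain F G where FG: "a = at_forms F g" "b = at_forms G g" "is_form n e F" "is_form n e G"
    using assms by (auto simp: form_values_def)
  let ?S = "Poly_Mapping.keys F \<union> Poly_Mapping.keys G"
  have keys: "Poly_Mapping.keys (F + G) \<subseteq> ?S" by (rule Poly_Mapping.keys_add)
  have *: "at_forms H g = (\<Sum>m\<in>?S. const2 (Poly_Mapping.lookup H m) * monomial_value g m)"
    if "Poly_Mapping.keys H \<subseteq> ?S" for H
    unfolding subst_eq using that by (intro sum.mono_neutral_left) (auto simp: in_keys_iff)
  have "at_forms (F + G) g = a + b"
    unfolding FG(1,2) by (simp add: *[OF keys] *[of F] *[of G] lookup_add sum.distrib smult_const_add)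
  moreover have "is_form n e (F + G)" using FG(3,4) keys by (auto simp: is_form_iff)
  ultimately show ?thesis
    unfolding form_values_def by (intro CollectI exI[of _ "F + G"] conjI) simp_all
qed

lemma form_values_sum:
  "(\<And>i. i \<in> K \<Longrightarrow> a i \<in> form_values n g e) \<Longrightarrow> sum a K \<in> form_values n g e"
  by (induction K rule: infinite_finite_induct) (auto simp: form_values_zero form_values_add)

lemma form_values_monomial:
  assumes "Poly_Mapping.keys m \<subseteq> {..<n}"
  shows "const2 c * monomial_value g m \<in> form_values n g (monomial_degree m)"
proof (cases "c = 0")
  case True
  then show ?thesis by (simp add: form_values_zero)
next
  case False
  then have "at_forms (Poly_Mapping.single m c) g = const2 c * monomial_value g m"
    by (simp add: subst_eq)
  moreover have "is_form n (monomial_degree m) (Poly_Mapping.single m c)"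
    using assms False by (simp add: is_form_iff)
  ultimately show ?thesis unfolding form_values_def by (metis (mono_tags, lifting) mem_Collect_eq)
qed

lemma form_values_mult:
  assumes "a \<in> form_values n g e" "b \<in> form_values n g e'"
  shows "a * b \<in> form_values n g (e + e')"
proof -
  obtain F G where FG: "a = at_forms F g" "b = at_forms G g" "is_form n e F" "is_form n e' G"
    using assms by (auto simp: form_values_def)
  have "a * b = (\<Sum>m\<in>Poly_Mapping.keys F. \<Sum>m'\<in>Poly_Mapping.keys G.
      const2 (Poly_Mapping.lookup F m * Poly_Mapping.lookup G m') * monomial_value g (m + m'))"
    unfolding FG(1,2) subst_eq sum_product monomial_add
    by (intro sum.cong) (simp_all add: mult_ac)
  also have "\<dots> \<in> form_values n g (e + e')"
  proof (intro form_values_sum)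
    fix m m' assume mm: "m \<in> Poly_Mapping.keys F" "m' \<in> Poly_Mapping.keys G"
    then have "Poly_Mapping.keys m \<subseteq> {..<n}" "Poly_Mapping.keys m' \<subseteq> {..<n}"
      "monomial_degree (m + m') = e + e'"
      using FG(3,4) unfolding is_form_iff monomial_add by auto
    moreover from this have "Poly_Mapping.keys (m + m') \<subseteq> {..<n}"
      using Poly_Mapping.keys_add[of m m'] by blast
    ultimately show "const2 (Poly_Mapping.lookup F m * Poly_Mapping.lookup G m') * monomial_value g (m + m')
        \<in> form_values n g (e + e')"
      using form_values_monomial by metis
  qed
  finally show ?thesis .
qed

lemma form_values_const: "const2 c \<in> form_values n g 0"
  using form_values_monomial[of 0 n c g] by (simp add: monomial_value_def monomial_degree_def)

lemma form_values_one: "1 \<in> form_values n g 0"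
  using form_values_const[of 1] by (simp add: one_pCons)

lemma form_values_gen: "i < n \<Longrightarrow> g i \<in> form_values n g 1"
  using form_values_monomial[of "Poly_Mapping.single i 1" n 1 g]
  by (simp add: monomial_value_def monomial_degree_def flip: one_pCons)

lemma form_values_const_mult: "a \<in> form_values n g e \<Longrightarrow> const2 c * a \<in> form_values n g e"
  using form_values_mult[OF form_values_const] by fastforce

lemma form_values_uminus: "a \<in> form_values n g e \<Longrightarrow> - a \<in> form_values n g e"
proof -
  assume "a \<in> form_values n g e"
  then have "const2 (- 1) * a \<in> form_values n g e" by (rule form_values_const_mult)
  moreover have "const2 (- 1) = (- 1 :: 'a poly poly)" by (simp add: one_pCons)
  ultimately show ?thesis by (simp only: mult_minus1)
qed

lemma form_values_diff:
  "a \<in> form_values n g e \<Longrightarrow> b \<in> form_values n g e \<Longrightarrow> a - b \<in> form_values n g e"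
  using form_values_add[of a n g e "- b"] form_values_uminus[of b n g e] by simp

lemma form_values_power: "a \<in> form_values n g e \<Longrightarrow> a ^ k \<in> form_values n g (e * k)"
proof (induction k)
  case (Suc k)
  then show ?case using form_values_mult[of a n g e "a ^ k"] by simp
qed (simp add: form_values_one)

lemma form_values_induct [consumes 1, case_names zero const gen add mult]:
  assumes h: "h \<in> form_values n g e"
    and zero: "\<And>e. P e 0" and const: "\<And>c. P 0 (const2 c)" and gen: "\<And>i. i < n \<Longrightarrow> P 1 (g i)"
    and add: "\<And>e a b. P e a \<Longrightarrow> P e b \<Longrightarrow> P e (a + b)"
    and mult: "\<And>e e' a b. P e a \<Longrightarrow> P e' b \<Longrightarrow> P (e + e') (a * b)"
  shows "P e h"
proof -
  obtain F where F: "h = at_forms F g" "is_form n e F" using h by (auto simp: form_values_def)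
  have one: "P 0 1" using const[of 1] by (simp add: one_pCons)
  have pow: "P k (g i ^ k)" if "i < n" for i k
  proof (induction k)
    case (Suc k)
    then show ?case using mult[OF gen[OF that] Suc] by simp
  qed (simp add: one)
  have "P (\<Sum>i\<in>K. k i) (\<Prod>i\<in>K. g i ^ k i)" if "finite K" "K \<subseteq> {..<n}" for K and k :: "nat \<Rightarrow> nat"
    using that by (induction K rule: finite_induct) (auto simp: one intro: mult pow)
  then have mon: "P (monomial_degree m) (monomial_value g m)" if "Poly_Mapping.keys m \<subseteq> {..<n}" for m
    unfolding monomial_degree_def monomial_value_def using that by simp
  have sum: "P e (sum a K)" if "\<And>i. i \<in> K \<Longrightarrow> P e (a i)" for a and K :: "(nat \<Rightarrow>\<^sub>0 nat) set"
    using that by (induction K rule: infinite_finite_induct) (auto simp: zero add)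
  show ?thesis unfolding F(1) subst_eq
  proof (rule sum)
    fix m assume "m \<in> Poly_Mapping.keys F"
    then have "Poly_Mapping.keys m \<subseteq> {..<n}" "monomial_degree m = e" using F(2) by (auto simp: is_form_iff)
    then show "P e (const2 (Poly_Mapping.lookup F m) * monomial_value g m)"
      using mult[OF const mon] by (metis add_0)
  qed
qed

lemma eval2_at_forms: "eval2 (at_forms F g) q = at_point F (Psi g q)"
proof -
  have sum: "eval2 (sum a K) q = (\<Sum>i\<in>K. eval2 (a i) q)" for a and K :: "(nat \<Rightarrow>\<^sub>0 nat) set"
    by (induction K rule: infinite_finite_induct) simp_all
  have prod: "eval2 (prod a K) q = (\<Prod>i\<in>K. eval2 (a i) q)" for a and K :: "nat set"
    by (induction K rule: infinite_finite_induct) simp_all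
  show ?thesis unfolding subst_def sum by (simp add: prod Psi_def)
qed

section \<open>Local rings as rings of fractions\<close>

text \<open>For the graded rings of all binary forms and of the forms in the \<open>g\<^sub>i\<close>, these are the local rings of the
  projective line and of the image curve.\<close>

definition fractions_at :: "(nat \<Rightarrow> 'k::field poly poly set) \<Rightarrow> 'k \<times> 'k \<Rightarrow> 'k poly poly fract set" where
  "fractions_at V q = {Fract a c | a c e. a \<in> V e \<and> c \<in> V e \<and> eval2 c q \<noteq> 0}"

lemma fractions_atI: "a \<in> V e \<Longrightarrow> c \<in> V e \<Longrightarrow> eval2 c q \<noteq> 0 \<Longrightarrow> Fract a c \<in> fractions_at V q"
  unfolding fractions_at_def by blast

lemma fractions_atE:
  assumes "u \<in> fractions_at V q"
  obtains a c e where "u = Fract a c" "a \<in> V e" "c \<in> V e" "eval2 c q \<noteq> 0" "c \<noteq> 0"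
proof -
  obtain a c e where "u = Fract a c" "a \<in> V e" "c \<in> V e" "eval2 c q \<noteq> 0"
    using assms unfolding fractions_at_def by blast
  moreover from this have "c \<noteq> 0" by auto
  ultimately show thesis using that by blast
qed

lemma subring_set_fractions_at:
  assumes one: "1 \<in> V 0" and add: "\<And>e a b. a \<in> V e \<Longrightarrow> b \<in> V e \<Longrightarrow> a + b \<in> V e"
    and uminus: "\<And>e a. a \<in> V e \<Longrightarrow> - a \<in> V e"
    and mult: "\<And>e e' a b. a \<in> V e \<Longrightarrow> b \<in> V e' \<Longrightarrow> a * b \<in> V (e + e')"
  shows "subring_set (fractions_at V q)"
proof
  have "0 \<in> V 0" using add[OF one uminus[OF one]] by simp
  then show "0 \<in> fractions_at V q" using fractions_atI[of 0 V 0 1 q] one by (simp add: Zero_fract_def)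
  show "1 \<in> fractions_at V q" using fractions_atI[of 1 V 0 1 q] one by (simp add: One_fract_def)
  fix u v assume u: "u \<in> fractions_at V q"
  obtain a c e where ac: "u = Fract a c" "a \<in> V e" "c \<in> V e" "eval2 c q \<noteq> 0" "c \<noteq> 0"
    using u by (rule fractions_atE)
  show "- u \<in> fractions_at V q"
    using fractions_atI[of "- a" V e c q] uminus[OF ac(2)] ac by simp
  assume v: "v \<in> fractions_at V q"
  obtain a' c' e' where ac': "v = Fract a' c'" "a' \<in> V e'" "c' \<in> V e'" "eval2 c' q \<noteq> 0" "c' \<noteq> 0"
    using v by (rule fractions_atE)
  have "a * c' + a' * c \<in> V (e + e')"
    using mult[OF ac(2) ac'(3)] mult[OF ac'(2) ac(3)] add by (simp add: add.commute)
  then show "u + v \<in> fractions_at V q"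
    using fractions_atI[of "a * c' + a' * c" V "e + e'" "c * c'" q] mult[OF ac(3) ac'(3)] ac ac' by simp
  show "u * v \<in> fractions_at V q"
    using fractions_atI[of "a * a'" V "e + e'" "c * c'" q] mult[OF ac(2) ac'(2)] mult[OF ac(3) ac'(3)] ac ac'
    by simp
qed

lemma local_ring_P1_eq: "local_ring_P1 q = subring_on (fractions_at (\<lambda>e. {h. homogeneous e h}) q)"
proof -
  have "{Fract a b | a b e. homogeneous e a \<and> homogeneous e b \<and> eval2 b q \<noteq> 0} =
      fractions_at (\<lambda>e. {h. homogeneous e h}) q"
    unfolding fractions_at_def by simp
  then show ?thesis by (simp add: local_ring_P1_def subring_on_def)
qed

lemma local_ring_C_eq: "local_ring_C n g (Psi g q) = subring_on (fractions_at (form_values n g) q)"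
proof -
  have "{Fract (at_forms F g) (at_forms G g) | F G e.
      is_form n e F \<and> is_form n e G \<and> at_point G (Psi g q) \<noteq> 0} = fractions_at (form_values n g) q"
    unfolding fractions_at_def form_values_def eval2_at_forms[symmetric] by blast
  then show ?thesis by (simp add: local_ring_C_def subring_on_def)
qed

context linear_frame
begin

text \<open>The expansion of a form that does not vanish at \<open>q\<close> is invertible, so the expansion extends to the
  fractions in the local ring at \<open>q\<close>.\<close>

definition frac_exp :: "'k poly poly fract \<Rightarrow> 'k fps" where
  "frac_exp u = (THE \<alpha>. \<exists>a c e. homogeneous e a \<and> homogeneous e c \<and> eval2 c q \<noteq> 0 \<and>
     u = Fract a c \<and> \<alpha> = E a * inverse (E c))"

lemma E_unit: "eval2 c q \<noteq> 0 \<Longrightarrow> E c * inverse (E c) = 1"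
  using inverse_mult_eq_1'[of "E c"] by (simp add: expand_nth_0)

lemma frac_exp_Fract:
  assumes "homogeneous e a" "homogeneous e c" "eval2 c q \<noteq> 0"
  shows "frac_exp (Fract a c) = E a * inverse (E c)"
  unfolding frac_exp_def
proof (rule the_equality)
  show "\<exists>a' c' e. homogeneous e a' \<and> homogeneous e c' \<and> eval2 c' q \<noteq> 0 \<and> Fract a c = Fract a' c' \<and>
      E a * inverse (E c) = E a' * inverse (E c')"
    using assms by blast
  fix \<alpha> assume "\<exists>a' c' e. homogeneous e a' \<and> homogeneous e c' \<and> eval2 c' q \<noteq> 0 \<and>
      Fract a c = Fract a' c' \<and> \<alpha> = E a' * inverse (E c')"
  then obtain a' c' where *: "eval2 c' q \<noteq> 0" "Fract a c = Fract a' c'" "\<alpha> = E a' * inverse (E c')"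
    by blast
  then have "c \<noteq> 0" "c' \<noteq> 0" using assms(3) by auto
  then have "a * c' = a' * c" using * by (simp add: eq_fract)
  then have "E a * E c' = E a' * E c" by (metis expand_mult)
  then have "E a * inverse (E c) * (E c' * inverse (E c')) = E a' * inverse (E c') * (E c * inverse (E c))"
    by (metis (no_types, lifting) mult.assoc mult.commute)
  then show "\<alpha> = E a * inverse (E c)" using E_unit assms(3) * by simp
qed

lemma frac_exp_nth_0:
  assumes "homogeneous e a" "homogeneous e c" "eval2 c q \<noteq> 0"
  shows "frac_exp (Fract a c) $ 0 = eval2 a q / eval2 c q"
  using frac_exp_Fract[OF assms] assms by (simp add: expand_nth_0 field_simps)

end

section \<open>Height two means that there is no common zero\<close>

lemma primeideal_multiples:
  assumes "prime_elem (m :: 'k::field poly poly)"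
  shows "primeideal {h. m dvd h} B_ring"
proof (rule primeidealI)
  show "ideal {h. m dvd h} B_ring" unfolding ideal_iff by auto
  show "cring (B_ring :: 'k poly poly ring)" by (rule cring_from_type_algebra)
  have "1 \<notin> {h. m dvd h}" using assms by (simp add: prime_elem_def)
  then show "carrier B_ring \<noteq> {h. m dvd h}" by (auto simp: ring_of_type_algebra_def)
qed (use assms in \<open>auto simp: ring_of_type_algebra_def prime_elem_dvd_mult_iff\<close>)

lemma expand_eq_0_imp_eval2:
  assumes "expand q q' h = 0"
  shows "eval2 h (fst q + fst q', snd q + snd q') = 0"
proof -
  let ?L = "\<lambda>h. poly (map_poly (\<lambda>a. pcompose a [:fst q, fst q':]) h) [:snd q, snd q':]"
  have "poly (?L h) 1 = eval2 h (fst q + fst q', snd q + snd q')"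
  proof (induction h)
    case (pCons a p)
    then show ?case by (simp add: map_poly_pCons poly_pcompose eval2_def distrib_right)
  qed (simp add: eval2_def)
  moreover have "?L h = 0" using assms by (simp add: expand_def)
  ultimately show ?thesis by simp
qed

text \<open>If all powers of \<open>m\<close> divide \<open>h\<close>, then \<open>h\<close> vanishes to infinite order at a zero of \<open>m\<close> along every
  line through it.\<close>

lemma linear_form_power_dvd_bounded:
  fixes m :: "'k::field_char_0 poly poly"
  assumes m: "linear_form m" and dvd: "\<And>r. m ^ r dvd h"
  shows "h = 0"
proof (rule ccontr)
  assume "h \<noteq> 0"
  then obtain p where p: "eval2 h p \<noteq> 0" by (rule ex_eval2_nonzero)
  obtain q where q: "is_zero_of q m" using ex_zero_linear_form[OF m] .
  define q' where "q' = (fst p - fst q, snd p - snd q)"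
  have "expand q q' m $ 0 = 0" using q by (simp add: expand_nth_0 is_zero_of_def)
  then have "fps_X ^ 1 dvd expand q q' m" unfolding fps_X_power_dvd_iff by simp
  then have "fps_X ^ r dvd expand q q' m ^ r" for r using dvd_power_same[of fps_X] by simp
  moreover have "expand q q' m ^ r dvd expand q q' h" for r
    using dvd[of r] by (metis dvd_def expand_mult expand_power)
  ultimately have "fps_X ^ r dvd expand q q' h" for r using dvd_trans by blast
  then have "expand q q' h $ r = 0" for r
    using fps_X_power_dvd_iff[of "Suc r" "expand q q' h"] by blast
  then have "expand q q' h = 0" by (simp add: fps_eq_iff)
  then show False using expand_eq_0_imp_eval2[of q q' h] p by (simp add: q'_def)
qed

text \<open>Every element of \<open>P\<close> is divisible by \<open>m\<close>, and the quotient lies in \<open>P\<close> again because \<open>m\<close> does not.\<close>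

lemma prime_below_linear_form:
  fixes m :: "'k::field_char_0 poly poly"
  assumes P: "primeideal P B_ring" and m: "linear_form m" and sub: "P \<subseteq> {h. m dvd h}" and "m \<notin> P"
  shows "P = {0}"
proof -
  interpret primeideal P B_ring by (rule P)
  have mem: "\<exists>b\<in>P. a = m ^ r * b" if "a \<in> P" for a r
  proof (induction r)
    case (Suc r)
    then obtain b where b: "b \<in> P" "a = m ^ r * b" by blast
    then obtain b' where b': "b = m * b'" using sub by (auto elim!: dvdE)
    then have "b' \<in> P"
      using I_prime[of m b'] b(1) \<open>m \<notin> P\<close> by (auto simp: ring_of_type_algebra_def)
    then show ?case using b b' by (intro bexI[of _ b']) simp_all
  qed (use that in simp)
  have "a = 0" if "a \<in> P" for a
    using linear_form_power_dvd_bounded[OF m] mem[OF that] by (metis dvd_triv_left)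
  moreover have "ideal P (B_ring :: 'k poly poly ring)" by (rule primeideal.axioms(1)[OF P])
  then have "0 \<in> P" unfolding ideal_iff by blast
  ultimately show ?thesis by blast
qed

lemma prime_height_linear_form:
  fixes m :: "'k::field_char_0 poly poly"
  assumes m: "linear_form m"
  shows "prime_height B_ring {h. m dvd h} \<le> enat 1"
  unfolding prime_height_def
proof (rule chain_sup_le[where rank = "\<lambda>P. if P = {0} then 0 else 1"], goal_cases)
  case (2 P Q)
  have "m \<notin> P"
  proof
    assume "m \<in> P"
    moreover have "ideal P (B_ring :: 'k poly poly ring)" using 2 by (auto dest: primeideal.axioms(1))
    ultimately have "{h. m dvd h} \<subseteq> P" unfolding ideal_iff by (auto simp: mult.commute elim!: dvdE)
    then show False using 2 by blast
  qed
  then have "P = {0}" using 2 m by (intro prime_below_linear_form) auto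
  then show ?case using 2 by auto
qed simp

text \<open>A common zero would give a linear form dividing all \<open>g\<^sub>i\<close>, and hence a prime of height at most one above
  the ideal.\<close>

lemma height_two_no_common_zero:
  fixes g :: "nat \<Rightarrow> 'k::field_char_0 poly poly"
  assumes hom: "\<And>i. i < n \<Longrightarrow> homogeneous d (g i)"
    and height: "ideal_height B_ring (Ideal (g ` {..<n})) = 2" and q: "q \<noteq> (0, 0)"
  shows "\<exists>i<n. eval2 (g i) q \<noteq> 0"
proof (rule ccontr)
  assume "\<not> ?thesis"
  then have zero: "eval2 (g i) q = 0" if "i < n" for i using that by blast
  obtain m where m: "linear_form m" "is_zero_of q m" using ex_linear_form_zero[OF q] .
  obtain q' where "linear_frame q q' m" using ex_linear_frame[OF m] by blast
  then have "g ` {..<n} \<subseteq> {h. m dvd h}"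
    using linear_frame.m_dvd_form_iff hom zero by fastforce
  moreover have prime: "primeideal {h. m dvd h} B_ring"
    by (rule primeideal_multiples[OF prime_elem_linear_form[OF m(1)]])
  ultimately have "Ideal (g ` {..<n}) \<subseteq> {h. m dvd h}"
    by (intro Ideal_minimal primeideal.axioms(1))
  then have "ideal_height B_ring (Ideal (g ` {..<n})) \<le> prime_height B_ring {h. m dvd h}"
    unfolding ideal_height_def using prime by (intro Inf_lower) blast
  also have "\<dots> \<le> enat 1" by (rule prime_height_linear_form[OF m(1)])
  finally show False unfolding height by (simp add: numeral_eq_enat)
qed

lemma height_two_degree_pos:
  fixes g :: "nat \<Rightarrow> 'k::field_char_0 poly poly"
  assumes hom: "\<And>i. i < n \<Longrightarrow> homogeneous d (g i)"
    and height: "ideal_height B_ring (Ideal (g ` {..<n})) = 2"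
  shows "d > 0"
proof (rule ccontr)
  assume "\<not> d > 0"
  obtain i where i: "i < n" "eval2 (g i) (1, 0) \<noteq> 0"
    using height_two_no_common_zero[OF hom height, of "(1, 0)"] by auto
  then obtain c where c: "g i = const2 c" using hom[OF i(1)] \<open>\<not> d > 0\<close> homogeneous_0E by auto
  then have "is_unit (g i)" using i(2) by (auto intro: is_unit_const2)
  then obtain v where v: "v * g i = 1" by (auto simp: mult.commute elim!: dvdE)
  have "\<not> primeideal P B_ring" if "Ideal (g ` {..<n}) \<subseteq> P" for P
  proof
    assume P: "primeideal P (B_ring :: 'k poly poly ring)"
    then have id: "ideal P (B_ring :: 'k poly poly ring)" by (rule primeideal.axioms(1))
    have "g i \<in> P" using that i(1) Ideal_superset[of "g ` {..<n}"] by auto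
    then have "v * g i \<in> P" using id unfolding ideal_iff by blast
    then have "h * 1 \<in> P" for h using id unfolding ideal_iff v by blast
    then have "P = carrier B_ring" by (auto simp: ring_of_type_algebra_def)
    then show False using primeideal.I_notcarr[OF P] by simp
  qed
  then have none: "{prime_height B_ring P | P. primeideal P B_ring \<and> Ideal (g ` {..<n}) \<subseteq> P} = {}"
    by blast
  have "ideal_height B_ring (Ideal (g ` {..<n})) = (\<infinity> :: enat)"
    unfolding ideal_height_def none by (simp add: top_enat_def)
  then show False unfolding height by simp
qed

section \<open>The multiplicity of a branch as an order of vanishing\<close>

lemma mult_divide_cancel:
  fixes a :: "'a::field"
  assumes "a \<noteq> 0"
  shows "a * b / c * (x / a) = x * b / c" "x * (b * a) / (c * a) = x * (b / c)"
  using assms by simp_all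

lemma to_fract_power: "to_fract (a ^ k) = to_fract a ^ k"
  by (induction k) simp_all

locale parametrisation =
  fixes d n :: nat and g :: "nat \<Rightarrow> 'k::{alg_closed_field, field_char_0} poly poly"
  assumes d_pos: "d > 0" and hom: "i < n \<Longrightarrow> homogeneous d (g i)"
    and no_common_zero: "q \<noteq> (0, 0) \<Longrightarrow> \<exists>i<n. eval2 (g i) q \<noteq> 0"
    and birational: "birational_onto_image n g"
begin

lemma form_values_homogeneous: "h \<in> form_values n g e \<Longrightarrow> homogeneous (d * e) h"
  by (induction rule: form_values_induct)
    (auto simp: homogeneous_zero homogeneous_const2 hom distrib_left
      intro: homogeneous_add homogeneous_mult)

text \<open>If the coordinate with the index \<open>j\<close> does not vanish at \<open>\<Psi>(q)\<close>, these are the linear forms in the \<open>g\<^sub>i\<close>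
  that cut out this point.\<close>

definition point_form :: "nat \<Rightarrow> 'k \<times> 'k \<Rightarrow> nat \<Rightarrow> 'k poly poly" where
  "point_form j q i = const2 (eval2 (g j) q) * g i - const2 (eval2 (g i) q) * g j"

lemma homogeneous_point_form: "i < n \<Longrightarrow> j < n \<Longrightarrow> homogeneous d (point_form j q i)"
  unfolding point_form_def by (intro homogeneous_diff homogeneous_const_mult hom)

lemma eval2_point_form: "eval2 (point_form j q i) q = 0"
  by (simp add: point_form_def mult.commute)

text \<open>Otherwise all \<open>g\<^sub>i\<close> would be multiples of \<open>g\<^sub>j\<close> and share its zeros.\<close>

lemma ex_point_form_nonzero:
  assumes j: "j < n" "eval2 (g j) q \<noteq> 0"
  shows "\<exists>i<n. point_form j q i \<noteq> 0"
proof (rule ccontr)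
  assume "\<not> ?thesis"
  then have eq: "const2 (eval2 (g j) q) * g i = const2 (eval2 (g i) q) * g j" if "i < n" for i
    using that by (auto simp: point_form_def)
  have "homogeneous (Suc (d - 1)) (g j)" using hom[OF j(1)] d_pos by simp
  then obtain q' where q': "q' \<noteq> (0, 0)" "eval2 (g j) q' = 0" by (rule form_has_zero)
  have "eval2 (g i) q' = 0" if "i < n" for i
    using arg_cong[OF eq[OF that], of "\<lambda>h. eval2 h q'"] q'(2) j(2) by simp
  then show False using no_common_zero[OF q'(1)] by blast
qed

lemma ex_point_form_order:
  assumes m: "linear_form m" "is_zero_of q m" and j: "j < n" "eval2 (g j) q \<noteq> 0"
  obtains e where "e > 0" "\<And>i. i < n \<Longrightarrow> m ^ e dvd point_form j q i"
    "\<exists>i<n. \<not> m ^ Suc e dvd point_form j q i"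
proof -
  obtain q' where "linear_frame q q' m" using ex_linear_frame[OF m] by blast
  then have one: "m dvd point_form j q i" if "i < n" for i
    using linear_frame.m_dvd_form_iff[OF _ homogeneous_point_form[OF that j(1)]] eval2_point_form by blast
  define Q where "Q r \<longleftrightarrow> (\<exists>i<n. \<not> m ^ r dvd point_form j q i)" for r
  obtain i where "i < n" "point_form j q i \<noteq> 0" using ex_point_form_nonzero[OF j] by blast
  then have "\<exists>r. Q r" unfolding Q_def using linear_form_power_dvd_bounded[OF m(1)] by blast
  then have least: "Q (LEAST r. Q r)" by (rule LeastI_ex)
  have "\<not> Q 0" "\<not> Q 1" using one by (auto simp: Q_def)
  then have "(LEAST r. Q r) \<noteq> 0" "(LEAST r. Q r) \<noteq> 1" using least by metis+
  then obtain e where e: "(LEAST r. Q r) = Suc e" "e > 0" by (cases "LEAST r. Q r") auto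
  have "\<not> Q e" using not_less_Least[of e Q] e(1) by simp
  then show thesis using that[of e] e least by (simp add: Q_def)
qed

context
  fixes q m j e i\<^sub>0
  assumes m: "linear_form m" "is_zero_of q m" and j: "j < n" "eval2 (g j) q \<noteq> 0"
    and e: "e > 0" "\<And>i. i < n \<Longrightarrow> m ^ e dvd point_form j q i"
    and i\<^sub>0: "i\<^sub>0 < n" "\<not> m ^ Suc e dvd point_form j q i\<^sub>0"
begin

text \<open>The form \<open>G\<close> has the smallest order at \<open>q\<close> among the linear forms in the \<open>g\<^sub>i\<close> that vanish there.  The quotient
  \<open>z = G / g\<^sub>j\<close> lies in the maximal ideal of the local ring.  With a linear form \<open>b\<close> that does not divide
  \<open>G\<close> and \<open>\<tau> = m / b\<close>, the forms \<open>G\<close> and \<open>g\<^sub>j\<close> become polynomials in \<open>\<tau>\<close> after division by \<open>b\<^sup>d\<close>, and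
  \<open>G / b\<^sup>d - z g\<^sub>j / b\<^sup>d = 0\<close> is an equation for \<open>\<tau>\<close> whose leading coefficient is a unit.  Birationality
  gives a common denominator of the powers of \<open>\<tau>\<close>.\<close>

lemma branch_multiplicity_order: "branch_multiplicity n g q = real e"
proof -
  define G where "G = point_form j q i\<^sub>0"
  have homG: "homogeneous d G" unfolding G_def by (rule homogeneous_point_form[OF i\<^sub>0(1) j(1)])
  have "G \<noteq> 0" using i\<^sub>0(2) by (auto simp: G_def)
  then obtain q' where q': "eval2 G q' \<noteq> 0" by (rule ex_eval2_nonzero)
  have "m dvd m ^ e" using e(1) by (simp add: dvd_power)
  then have "m dvd G" using e(2)[OF i\<^sub>0(1)] dvd_trans unfolding G_def by blast
  then have "eval2 m q' \<noteq> 0" using q' by (auto elim!: dvdE)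
  then interpret linear_frame q q' m using m by unfold_locales
  define V where "V = form_values n g"
  define A where "A = fractions_at V q"
  define A' where "A' = fractions_at (\<lambda>e. {h. homogeneous e h}) q"
  define \<tau> where "\<tau> = Fract m b"
  have V_mult: "\<And>e e' a b. a \<in> V e \<Longrightarrow> b \<in> V e' \<Longrightarrow> a * b \<in> V (e + e')"
    unfolding V_def by (rule form_values_mult)
  have V_hom: "homogeneous (d * e) h" if "h \<in> V e" for e h
    using that unfolding V_def by (rule form_values_homogeneous)
  have A: "subring_set A"
    unfolding A_def V_def
    by (rule subring_set_fractions_at)
      (auto intro: form_values_one form_values_add form_values_uminus form_values_mult)
  have A': "subring_set A'"
    unfolding A'_def by (rule subring_set_fractions_at)
      (auto intro: homogeneous_one homogeneous_add homogeneous_uminus homogeneous_mult)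
  have A'I: "Fract a c \<in> A'" if "homogeneous k a" "homogeneous k c" "eval2 c q \<noteq> 0" for a c k
    unfolding A'_def using that fractions_atI[of a "\<lambda>e. {h. homogeneous e h}" k c q] by simp
  have A'E: "\<exists>a c k. u = Fract a c \<and> homogeneous k a \<and> homogeneous k c \<and> eval2 c q \<noteq> 0 \<and> c \<noteq> 0"
    if "u \<in> A'" for u
    using that unfolding A'_def by (elim fractions_atE) blast
  have AI: "Fract a c \<in> A" if "a \<in> V k" "c \<in> V k" "eval2 c q \<noteq> 0" for a c k
    unfolding A_def using that by (rule fractions_atI)
  have AE: "\<exists>a c k. u = Fract a c \<and> a \<in> V k \<and> c \<in> V k \<and> eval2 c q \<noteq> 0 \<and> c \<noteq> 0"
    if "u \<in> A" for u
    using that unfolding A_def by (elim fractions_atE) blast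
  interpret loc: parametrised_local_ring A A' frac_exp \<tau>
  proof (intro parametrised_local_ring.intro parametrised_local_ring_axioms.intro A A')
    show "A \<subseteq> A'" using AE A'I V_hom by blast
    show "frac_exp 1 = 1"
      unfolding One_fract_def using frac_exp_Fract[OF homogeneous_one homogeneous_one] by simp
    fix u v assume "u \<in> A'" "v \<in> A'"
    then obtain a c k a' c' k' where
      u: "u = Fract a c" "homogeneous k a" "homogeneous k c" "eval2 c q \<noteq> 0" "c \<noteq> 0" and
      v: "v = Fract a' c'" "homogeneous k' a'" "homogeneous k' c'" "eval2 c' q \<noteq> 0" "c' \<noteq> 0"
      using A'E by metis
    have num: "homogeneous (k + k') (a * c' + a' * c)" "homogeneous (k + k') (a * a')"
      and den: "homogeneous (k + k') (c * c')" "eval2 (c * c') q \<noteq> 0"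
      using u v homogeneous_mult[OF u(2) v(3)] homogeneous_mult[OF v(2) u(3)] homogeneous_mult[OF u(2) v(2)]
        homogeneous_mult[OF u(3) v(3)] by (simp_all add: homogeneous_add add.commute)
    have inv: "inverse (E c * E c') = inverse (E c) * inverse (E c')" by (simp add: fps_inverse_mult)
    have "frac_exp (u + v) = (E a * E c' + E a' * E c) * (inverse (E c) * inverse (E c'))"
      unfolding u(1) v(1) add_fract[OF u(5) v(5)] frac_exp_Fract[OF num(1) den] by (simp add: inv)
    also have "\<dots> = E a * inverse (E c) * (E c' * inverse (E c')) + E a' * inverse (E c') * (E c * inverse (E c))"
      by (simp only: algebra_simps)
    finally show "frac_exp (u + v) = frac_exp u + frac_exp v"
      using u v by (simp add: frac_exp_Fract E_unit)
    show "frac_exp (u * v) = frac_exp u * frac_exp v"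
      unfolding u(1) v(1) mult_fract frac_exp_Fract[OF num(2) den] frac_exp_Fract[OF u(2-4)]
        frac_exp_Fract[OF v(2-4)] expand_mult inv by (simp only: mult_ac)
  next
    fix c
    have "Fract (const2 c) 1 \<in> A"
      using AI[of "const2 c" 0 1] form_values_const[of c n g] form_values_one[of n g] unfolding V_def by simp
    moreover have "frac_exp (Fract (const2 c) 1) = fps_const c"
      using frac_exp_Fract[OF homogeneous_const2 homogeneous_one, of c] by simp
    ultimately show "\<exists>a\<in>A. frac_exp a = fps_const c" by blast
  next
    fix u assume u: "u \<in> A" "frac_exp u $ 0 \<noteq> 0"
    then obtain a c k where ac: "u = Fract a c" "a \<in> V k" "c \<in> V k" "eval2 c q \<noteq> 0" "c \<noteq> 0"
      using AE by blast
    then have a: "eval2 a q \<noteq> 0" using u(2) frac_exp_nth_0[OF V_hom V_hom] by fastforce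
    then have "Fract c a \<in> A" using ac AI by blast
    moreover have "a \<noteq> 0" using a by auto
    then have "u * Fract c a = 1" using ac by (simp add: One_fract_def eq_fract)
    ultimately show "\<exists>v\<in>A. u * v = 1" by blast
  next
    fix u assume u: "u \<in> A'" "frac_exp u $ 0 \<noteq> 0"
    then obtain a c k where ac: "u = Fract a c" "homogeneous k a" "homogeneous k c" "eval2 c q \<noteq> 0" "c \<noteq> 0"
      using A'E by blast
    then have a: "eval2 a q \<noteq> 0" using u(2) frac_exp_nth_0 by fastforce
    then have "Fract c a \<in> A'" using ac A'I by blast
    moreover have "a \<noteq> 0" using a by auto
    then have "u * Fract c a = 1" using ac by (simp add: One_fract_def eq_fract)
    ultimately show "\<exists>v\<in>A'. u * v = 1" by blast
  next
    show "\<tau> \<in> A'" unfolding \<tau>_def by (rule A'I[OF homogeneous_m homogeneous_b b_q])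
    have "frac_exp \<tau> = fps_X ^ 1 * fps_const (eval2 m q' * inverse (eval2 b q))"
      unfolding \<tau>_def frac_exp_Fract[OF homogeneous_m homogeneous_b b_q]
      by (simp add: E_m E_b fps_const_inverse mult_ac)
    moreover have "fps_const (eval2 m q' * inverse (eval2 b q)) $ 0 \<noteq> 0" using m_q' b_q by simp
    ultimately show "has_order 1 (frac_exp \<tau>)" unfolding has_order_iff by blast
  next
    fix u assume u: "u \<in> A'" "frac_exp u $ 0 = 0"
    then obtain a c k where ac: "u = Fract a c" "homogeneous k a" "homogeneous k c" "eval2 c q \<noteq> 0" "c \<noteq> 0"
      using A'E by blast
    then have a: "eval2 a q = 0" using u(2) frac_exp_nth_0 by fastforce
    show "\<exists>v\<in>A'. u = \<tau> * v"
    proof (cases k)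
      case 0
      then obtain c' where "a = const2 c'" using ac(2) homogeneous_0E by blast
      then have "u = \<tau> * 0" using a ac(1) by (simp add: fract_collapse)
      then show ?thesis using subring_set.zero_mem[OF A'] by blast
    next
      case (Suc k')
      then obtain a' where a': "homogeneous k' a'" "a = m * a'" using m_dvd_form ac(2) a by metis
      have "homogeneous k (b * a')" using homogeneous_mult[OF homogeneous_b a'(1)] Suc by simp
      then have "Fract (b * a') c \<in> A'" using A'I ac by blast
      moreover have "b \<noteq> 0" using b_q by auto
      then have "u = \<tau> * Fract (b * a') c" using ac by (simp add: \<tau>_def a'(2) eq_fract mult_ac)
      ultimately show ?thesis by blast
    qed
  qed
  have mem_max: "u \<in> max_ideal (subring_on A) \<longleftrightarrow> u \<in> A \<and> frac_exp u $ 0 = 0" for u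
    unfolding loc.max_ideal_A by simp
  define z where "z = Fract G (g j)"
  define W where "W = Fract G (b ^ d)"
  have gj: "g j \<in> V 1" unfolding V_def by (rule form_values_gen[OF j(1)])
  have GV: "G \<in> V 1"
    unfolding G_def point_form_def V_def
    by (intro form_values_diff form_values_const_mult form_values_gen i\<^sub>0 j)
  have z_A: "z \<in> A" unfolding z_def by (rule AI[OF GV gj j(2)])
  have z_exp: "frac_exp z = E G * inverse (E (g j))"
    unfolding z_def by (rule frac_exp_Fract[OF homG hom[OF j(1)] j(2)])
  have bd: "homogeneous d (b ^ d)" "eval2 (b ^ d) q \<noteq> 0"
    using homogeneous_power[OF homogeneous_b, of d] b_q by simp_all
  have W_exp: "frac_exp W = E G * inverse (E (b ^ d))"
    unfolding W_def by (rule frac_exp_Fract[OF homG bd])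
  have orderG: "has_order e (E G)"
  proof -
    have 1: "fps_X ^ e dvd E G"
      using e(2)[OF i\<^sub>0(1)] fps_X_power_dvd_E[OF homG] by (simp add: G_def)
    have "\<not> fps_X ^ Suc e dvd E G"
      using i\<^sub>0(2) fps_X_power_dvd_E[OF homG, of "Suc e"] unfolding G_def by blast
    then have "E G $ e \<noteq> 0" using 1 fps_X_power_dvd_Suc by blast
    then show ?thesis using 1 by (simp add: has_order_def)
  qed
  have order_quot: "has_order e (E G * inverse (E c))" if "eval2 c q \<noteq> 0" for c
  proof -
    have "has_order 0 (inverse (E c))" using that by (simp add: has_order_def expand_nth_0)
    then show ?thesis using has_order_mult[OF orderG] by fastforce
  qed
  have z_max: "z \<in> max_ideal (subring_on A)"
    using frac_exp_nth_0[OF homG hom[OF j(1)] j(2)] eval2_point_form[of j q i\<^sub>0] z_A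
    by (simp add: mem_max z_def G_def)
  \<comment> \<open>Modulo \<open>t\<^sup>e\<close> all \<open>g\<^sub>i\<close> are proportional to \<open>g\<^sub>j\<close>, so a form in the \<open>g\<^sub>i\<close> that vanishes at \<open>q\<close> has order at least \<open>e\<close>.\<close>
  define \<sigma> where "\<sigma> = fps_const (inverse (eval2 (g j) q)) * E (g j)"
  have congruent: "fps_X ^ e dvd E h - fps_const (eval2 h q) * \<sigma> ^ k" if "h \<in> V k" for h k
    using that unfolding V_def
  proof (induction rule: form_values_induct)
    case (gen i)
    have pf: "E (point_form j q i) = fps_const (eval2 (g j) q) * E (g i) - fps_const (eval2 (g i) q) * E (g j)"
      by (simp add: point_form_def)
    have one: "fps_const (inverse (eval2 (g j) q)) * fps_const (eval2 (g j) q) = 1"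
      using j(2) by simp
    have "fps_const (inverse (eval2 (g j) q)) * E (point_form j q i) =
        (fps_const (inverse (eval2 (g j) q)) * fps_const (eval2 (g j) q)) * E (g i) -
          fps_const (eval2 (g i) q) * \<sigma>"
      unfolding \<sigma>_def pf by (simp only: right_diff_distrib mult.assoc mult.left_commute)
    then have "E (g i) - fps_const (eval2 (g i) q) * \<sigma> ^ 1 =
        fps_const (inverse (eval2 (g j) q)) * E (point_form j q i)"
      unfolding one by simp
    moreover have "fps_X ^ e dvd E (point_form j q i)"
      using e(2)[OF gen] fps_X_power_dvd_E[OF homogeneous_point_form[OF gen j(1)]] by simp
    ultimately show ?case by (simp only: dvd_mult)
  next
    case (add k a c)
    have "E (a + c) - fps_const (eval2 (a + c) q) * \<sigma> ^ k =
        (E a - fps_const (eval2 a q) * \<sigma> ^ k) + (E c - fps_const (eval2 c q) * \<sigma> ^ k)"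
      by (simp add: algebra_simps flip: fps_const_add)
    then show ?case using add by (simp only: dvd_add)
  next
    case (mult k k' a c)
    have "E (a * c) - fps_const (eval2 (a * c) q) * \<sigma> ^ (k + k') =
        E a * (E c - fps_const (eval2 c q) * \<sigma> ^ k') +
          (fps_const (eval2 c q) * \<sigma> ^ k') * (E a - fps_const (eval2 a q) * \<sigma> ^ k)"
      by (simp add: power_add algebra_simps flip: fps_const_mult)
    then show ?case using mult by (simp only: dvd_add dvd_mult)
  qed simp_all
  have order_ge: "fps_X ^ e dvd frac_exp u" if u: "u \<in> A" "frac_exp u $ 0 = 0" for u
  proof -
    obtain a c k where ac: "u = Fract a c" "a \<in> V k" "c \<in> V k" "eval2 c q \<noteq> 0"
      using AE u(1) by blast
    then have "eval2 a q = 0" using u(2) frac_exp_nth_0[OF V_hom V_hom] by fastforce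
    then have "fps_X ^ e dvd E a" using congruent[OF ac(2)] by simp
    then show ?thesis unfolding ac(1) frac_exp_Fract[OF V_hom[OF ac(2)] V_hom[OF ac(3)] ac(4)] by simp
  qed
  \<comment> \<open>As \<open>\<tau>\<close> is a fraction \<open>s / t\<close> of forms in the \<open>g\<^sub>i\<close>, a power of \<open>t\<close> is a common denominator; division by a
    power of \<open>g\<^sub>j\<close> makes it an element of the local ring.\<close>
  have "b \<noteq> 0" using b_q by auto
  have "\<tau> \<in> function_field_P1"
    unfolding function_field_P1_def \<tau>_def using homogeneous_m homogeneous_b \<open>b \<noteq> 0\<close> by blast
  then have "\<tau> \<in> function_field_C n g" using birational by (simp add: birational_onto_image_def)
  then obtain s t D where st: "\<tau> = Fract s t" "s \<in> V D" "t \<in> V D" "t \<noteq> 0"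
    unfolding function_field_C_def V_def form_values_def by blast
  define v where "v = Fract (t ^ d) (g j ^ (D * d))"
  have gjD: "g j ^ (D * d) \<in> V (D * d)" "eval2 (g j ^ (D * d)) q \<noteq> 0" "g j \<noteq> 0"
    using form_values_power[of "g j" n g 1 "D * d"] gj j(2) by (auto simp: V_def)
  have st_V: "s ^ i * t ^ (d - i) \<in> V (D * d)" if "i \<le> d" for i
  proof -
    have "s ^ i * t ^ (d - i) \<in> V (D * i + D * (d - i))"
      using st(2,3) unfolding V_def by (intro form_values_mult form_values_power)
    then show ?thesis using that by (simp flip: distrib_left)
  qed
  have v_\<tau>: "v * \<tau> ^ i \<in> A" if "i \<le> d" for i
  proof -
    have t: "to_fract t ^ i \<noteq> 0" using st(4) by simp
    have "to_fract t ^ d = to_fract t ^ i * to_fract t ^ (d - i)" using that by (simp flip: power_add)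
    then have "v * \<tau> ^ i = to_fract t ^ i * to_fract t ^ (d - i) / to_fract (g j ^ (D * d)) *
        (to_fract s ^ i / to_fract t ^ i)"
      by (simp only: v_def st(1) Fract_conv_to_fract to_fract_power power_divide)
    also have "\<dots> = to_fract s ^ i * to_fract t ^ (d - i) / to_fract (g j ^ (D * d))"
      by (rule mult_divide_cancel(1)[OF t])
    finally have "v * \<tau> ^ i = Fract (s ^ i * t ^ (d - i)) (g j ^ (D * d))"
      by (simp only: Fract_conv_to_fract to_fract_mult to_fract_power)
    then show ?thesis using AI[OF st_V[OF that] gjD(1,2)] by simp
  qed
  have v_A: "v \<in> A" using v_\<tau>[of 0] by simp
  have v_nonzero: "frac_exp v \<noteq> 0"
  proof -
    have tV: "t ^ d \<in> V (D * d)" using st_V[of 0] by simp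
    have "E t \<noteq> 0" using E_eq_0_iff[OF V_hom[OF st(3)]] st(4) by simp
    then have "E (t ^ d) \<noteq> 0" by simp
    moreover have "inverse (E (g j ^ (D * d))) \<noteq> 0"
      using E_unit[OF gjD(2)] by (metis mult_zero_right zero_neq_one)
    ultimately show ?thesis
      unfolding v_def frac_exp_Fract[OF V_hom[OF tV] V_hom[OF gjD(1)] gjD(2)]
      by (simp only: mult_eq_0_iff simp_thms)
  qed
  \<comment> \<open>Dividing \<open>G\<close> and \<open>g\<^sub>j\<close> by \<open>b\<^sup>d\<close> turns them into polynomials in \<open>\<tau>\<close>.\<close>
  define \<kappa> where "\<kappa> c = Fract (const2 c) 1" for c :: 'k
  have \<kappa>_A: "\<kappa> c \<in> A" for c
    using AI[of "const2 c" 0 1] form_values_const[of c n g] form_values_one[of n g] unfolding V_def \<kappa>_def by simp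
  have \<kappa>_exp: "frac_exp (\<kappa> c) = fps_const c" for c
    using frac_exp_Fract[OF homogeneous_const2 homogeneous_one, of c] by (simp add: \<kappa>_def)
  have dehomogenise: "Fract (\<Sum>i\<le>d. const2 (c i) * (m ^ i * b ^ (d - i))) (b ^ d) = (\<Sum>i\<le>d. \<kappa> (c i) * \<tau> ^ i)" for c
  proof -
    have "to_fract (const2 (c i) * (m ^ i * b ^ (d - i))) / to_fract (b ^ d) = \<kappa> (c i) * \<tau> ^ i" if "i \<le> d" for i
    proof -
      have b: "to_fract b ^ (d - i) \<noteq> 0" using \<open>b \<noteq> 0\<close> by simp
      have "to_fract b ^ d = to_fract b ^ i * to_fract b ^ (d - i)" using that by (simp flip: power_add)
      then have "to_fract (const2 (c i) * (m ^ i * b ^ (d - i))) / to_fract (b ^ d) =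
          to_fract (const2 (c i)) * (to_fract m ^ i * to_fract b ^ (d - i)) /
            (to_fract b ^ i * to_fract b ^ (d - i))"
        by (simp only: to_fract_mult to_fract_power)
      also have "\<dots> = to_fract (const2 (c i)) * (to_fract m ^ i / to_fract b ^ i)"
        by (rule mult_divide_cancel(2)[OF b])
      also have "\<dots> = \<kappa> (c i) * \<tau> ^ i"
        by (simp only: \<kappa>_def \<tau>_def Fract_conv_to_fract to_fract_1 power_divide div_by_1)
      finally show ?thesis .
    qed
    then show ?thesis
      unfolding Fract_conv_to_fract[of "sum _ _"] to_fract_sum sum_divide_distrib by (intro sum.cong) auto
  qed
  obtain c\<^sub>G where c\<^sub>G: "G = (\<Sum>i\<le>d. const2 (c\<^sub>G i) * (m ^ i * b ^ (d - i)))"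
    using form_expansion[OF homG] .
  obtain c\<^sub>g where c\<^sub>g: "g j = (\<Sum>i\<le>d. const2 (c\<^sub>g i) * (m ^ i * b ^ (d - i)))"
    using form_expansion[OF hom[OF j(1)]] .
  have "c\<^sub>G d \<noteq> 0"
  proof -
    have eval_sum: "eval2 (sum a K) q' = (\<Sum>i\<in>K. eval2 (a i) q')" for a and K :: "nat set"
      by (induction K rule: infinite_finite_induct) simp_all
    have "eval2 G q' = (\<Sum>i\<le>d. c\<^sub>G i * (eval2 m q' ^ i * eval2 b q' ^ (d - i)))"
      by (subst c\<^sub>G) (simp add: eval_sum)
    also have "\<dots> = (\<Sum>i\<in>{d}. c\<^sub>G i * (eval2 m q' ^ i * eval2 b q' ^ (d - i)))"
      by (rule sum.mono_neutral_right) (auto simp: b_q' power_0_left)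
    finally show ?thesis using q' by auto
  qed
  have W_eq: "W = (\<Sum>i\<le>d. \<kappa> (c\<^sub>G i) * \<tau> ^ i)"
    unfolding W_def by (subst c\<^sub>G) (rule dehomogenise)
  have W_z: "W = z * (\<Sum>i\<le>d. \<kappa> (c\<^sub>g i) * \<tau> ^ i)"
  proof -
    have "W = z * Fract (g j) (b ^ d)"
      unfolding W_def z_def using gjD(3) \<open>b \<noteq> 0\<close> by (simp add: eq_fract)
    also have "Fract (g j) (b ^ d) = (\<Sum>i\<le>d. \<kappa> (c\<^sub>g i) * \<tau> ^ i)"
      by (subst c\<^sub>g) (rule dehomogenise)
    finally show ?thesis .
  qed
  define r where "r i = \<kappa> (c\<^sub>G i) - z * \<kappa> (c\<^sub>g i)" for i
  have r_A: "r i \<in> A" for i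
    unfolding r_def by (intro loc.A.diff_mem loc.A.mult_mem \<kappa>_A z_A)
  have A'_mem: "x \<in> A'" if "x \<in> A" for x using that loc.A_subset by blast
  have "frac_exp (r d) $ 0 = c\<^sub>G d - frac_exp z $ 0 * c\<^sub>g d"
    unfolding r_def using A'_mem[OF \<kappa>_A] A'_mem[OF z_A] A'_mem[OF loc.A.mult_mem[OF z_A \<kappa>_A]]
    by (simp add: loc.\<phi>_diff loc.\<phi>_mult \<kappa>_exp)
  then have "frac_exp (r d) $ 0 \<noteq> 0" using z_max \<open>c\<^sub>G d \<noteq> 0\<close> by (simp add: mem_max)
  then obtain w where w: "w \<in> A" "r d * w = 1" using loc.unit_A[OF r_A] by blast
  have "(\<Sum>i\<le>d. r i * \<tau> ^ i) = (\<Sum>i\<le>d. \<kappa> (c\<^sub>G i) * \<tau> ^ i) - z * (\<Sum>i\<le>d. \<kappa> (c\<^sub>g i) * \<tau> ^ i)"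
    by (simp only: r_def left_diff_distrib sum_subtractf sum_distrib_left mult.assoc)
  then have "(\<Sum>i\<le>d. r i * \<tau> ^ i) = 0" unfolding W_eq[symmetric] W_z[symmetric] by simp
  then have lead: "r d * \<tau> ^ d = - (\<Sum>i<d. r i * \<tau> ^ i)"
    by (simp add: lessThan_Suc_atMost[symmetric] eq_neg_iff_add_eq_0 add.commute)
  have integral: "\<tau> ^ d = (\<Sum>i<d. (- w * r i) * \<tau> ^ i)"
  proof -
    have "\<tau> ^ d = (r d * w) * \<tau> ^ d" unfolding w(2) by simp
    also have "\<dots> = w * (r d * \<tau> ^ d)" by (simp only: mult_ac)
    also have "\<dots> = (\<Sum>i<d. (- w * r i) * \<tau> ^ i)"
      unfolding lead by (simp add: sum_distrib_left sum_negf mult.assoc)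
    finally show ?thesis .
  qed
  have fW: "v * (W ^ k * \<tau> ^ i) \<in> ideal_pow (subring_on A) (max_ideal (subring_on A)) k" for k i
  proof (rule loc.A.common_denominator[OF d_pos integral _ W_z z_max \<kappa>_A])
    show "- w * r i \<in> A" for i by (intro loc.A.mult_mem loc.A.uminus_mem w(1) r_A)
    show "v * \<tau> ^ i \<in> A" if "i < d" for i using v_\<tau> that by simp
  qed
  have "parametrised_branch A A' frac_exp \<tau> v W z e"
  proof (intro parametrised_branch.intro parametrised_branch_axioms.intro)
    show "W \<in> A'" unfolding W_def by (rule A'I[OF homG bd])
    show "has_order e (frac_exp z)" unfolding z_exp by (rule order_quot[OF j(2)])
    show "has_order e (frac_exp W)" unfolding W_exp by (rule order_quot[OF bd(2)])
  qed (fact loc.parametrised_local_ring_axioms e(1) order_ge z_A v_A v_nonzero fW)+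
  then show ?thesis
    unfolding branch_multiplicity_def branch_def local_ring_C_eq local_ring_P1_eq
      A_def[unfolded V_def, symmetric] A'_def[symmetric]
    by (rule parametrised_branch.branch_multiplicity_eq)
qed

end

end

section \<open>Jacobian minors and the order of vanishing\<close>

lemma homogeneous_dx_dy:
  assumes "homogeneous (Suc e) h"
  shows "homogeneous e (dx h)" "homogeneous e (dy h)"
proof -
  have h: "Suc i + j = Suc e" if "coeff (coeff h j) (Suc i) \<noteq> 0" for i j
    using assms that unfolding homogeneous_def by blast
  have h': "i + Suc j = Suc e" if "coeff (coeff h (Suc j)) i \<noteq> 0" for i j
    using assms that unfolding homogeneous_def by blast
  show "homogeneous e (dx h)"
    unfolding homogeneous_def using h by (auto simp: coeff_pderiv)
  show "homogeneous e (dy h)"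
    unfolding homogeneous_def using h' by (auto simp: coeff_pderiv dy_def of_nat_poly)
qed

lemma is_gcd_of_ideal_Ideal_iff:
  "is_gcd_of_ideal (Ideal T) h \<longleftrightarrow>
     (\<forall>a\<in>T. h dvd a) \<and> (\<forall>c. (\<forall>a\<in>T. c dvd a) \<longrightarrow> c dvd (h :: 'r::comm_ring_1))"
proof -
  have *: "(\<forall>a\<in>S. c dvd a) \<longleftrightarrow> (\<forall>a\<in>Ideal S. c dvd a)" for S and c :: 'r
  proof
    assume "\<forall>a\<in>S. c dvd a"
    then have "S \<subseteq> {a. c dvd a}" by blast
    moreover have "ideal {a. c dvd a} (ring_of_type_algebra :: 'r ring)" unfolding ideal_iff by auto
    ultimately show "\<forall>a\<in>Ideal S. c dvd a" using Ideal_minimal by blast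
  next
    assume "\<forall>a\<in>Ideal S. c dvd a"
    then show "\<forall>a\<in>S. c dvd a" using Ideal_superset by blast
  qed
  show ?thesis unfolding is_gcd_of_ideal_def *[of T]
  proof
    assume "\<exists>S. Ideal S = Ideal T \<and> (\<forall>a\<in>S. h dvd a) \<and> (\<forall>c. (\<forall>a\<in>S. c dvd a) \<longrightarrow> c dvd h)"
    then obtain S where "Ideal S = Ideal T" "\<forall>a\<in>S. h dvd a" "\<forall>c. (\<forall>a\<in>S. c dvd a) \<longrightarrow> c dvd h"
      by blast
    then show "(\<forall>a\<in>Ideal T. h dvd a) \<and> (\<forall>c. (\<forall>a\<in>Ideal T. c dvd a) \<longrightarrow> c dvd h)"
      unfolding *[of S] by simp
  next
    assume "(\<forall>a\<in>Ideal T. h dvd a) \<and> (\<forall>c. (\<forall>a\<in>Ideal T. c dvd a) \<longrightarrow> c dvd h)"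
    then show "\<exists>S. Ideal S = Ideal T \<and> (\<forall>a\<in>S. h dvd a) \<and> (\<forall>c. (\<forall>a\<in>S. c dvd a) \<longrightarrow> c dvd h)"
      unfolding *[of T, symmetric] by blast
  qed
qed

text \<open>By Euler's identity, the matrix with the columns \<open>(d g\<^sub>i, g\<^sub>i')\<close>, where the prime is the derivative
  along the line, is the Jacobian matrix multiplied by a matrix with constant determinant.\<close>

lemma (in linear_frame) Wronskian_eq_jac_minor:
  assumes "homogeneous e (g a)" "homogeneous e (g c)"
  shows "fps_const (of_nat e) * (E (g a) * fps_deriv (E (g c)) - E (g c) * fps_deriv (E (g a))) =
    fps_const (fst q * snd q' - snd q * fst q') * E (jac_minor g a c)"
proof -
  let ?x = "E var_x" and ?y = "E var_y"
  have euler: "fps_const (of_nat e) * E (g i) = ?x * E (dx (g i)) + ?y * E (dy (g i))"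
    if "homogeneous e (g i)" for i
    using arg_cong[OF euler_identity[OF that], of E] by simp
  have "fps_const (of_nat e) * (E (g a) * fps_deriv (E (g c)) - E (g c) * fps_deriv (E (g a))) =
      (fps_const (of_nat e) * E (g a)) * fps_deriv (E (g c)) -
      (fps_const (of_nat e) * E (g c)) * fps_deriv (E (g a))"
    by (simp only: right_diff_distrib mult.assoc)
  also have "\<dots> = (?x * fps_const (snd q') - ?y * fps_const (fst q')) * E (jac_minor g a c)"
    unfolding euler[OF assms(1)] euler[OF assms(2)] fps_deriv_expand jac_minor_def expand_diff expand_mult
    by (simp only: algebra_simps)
  also have "?x * fps_const (snd q') - ?y * fps_const (fst q') = fps_const (fst q * snd q' - snd q * fst q')"
    by (rule fps_ext) (simp add: expand_var_x expand_var_y algebra_simps)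
  finally show ?thesis .
qed

lemma fps_X_power_dvd_const_mult:
  "c \<noteq> 0 \<Longrightarrow> fps_X ^ r dvd fps_const c * \<alpha> \<longleftrightarrow> fps_X ^ r dvd (\<alpha> :: 'k::field fps)"
  unfolding fps_X_power_dvd_iff by simp

context parametrisation
begin

definition "minors = {jac_minor g a b | a b. a < b \<and> b < n}"

lemma homogeneous_jac_minor:
  assumes "a < n" "b < n"
  shows "homogeneous (d - 1 + (d - 1)) (jac_minor g a b)"
proof -
  have "homogeneous (Suc (d - 1)) (g a)" "homogeneous (Suc (d - 1)) (g b)"
    using hom assms d_pos by simp_all
  then show ?thesis
    unfolding jac_minor_def by (intro homogeneous_diff homogeneous_mult homogeneous_dx_dy)
qed

text \<open>Along the line the minors are the Wronskians of the expansions of the \<open>g\<^sub>i\<close> up to constants.\<close>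

lemma power_dvd_minors_iff:
  assumes m: "linear_form m" "is_zero_of q m" and j: "j < n" "eval2 (g j) q \<noteq> 0"
  shows "(\<forall>h\<in>minors. m ^ r dvd h) \<longleftrightarrow> (\<forall>i<n. m ^ Suc r dvd point_form j q i)"
proof -
  obtain q' where "linear_frame q q' m" using ex_linear_frame[OF m] by blast
  then interpret linear_frame q q' m .
  have minor: "m ^ r dvd jac_minor g a b \<longleftrightarrow>
      fps_X ^ r dvd E (g a) * fps_deriv (E (g b)) - E (g b) * fps_deriv (E (g a))"
    if "a < n" "b < n" for a b
  proof -
    have "of_nat d \<noteq> (0 :: 'k)" using d_pos by simp
    then show ?thesis
      using fps_X_power_dvd_E[OF homogeneous_jac_minor[OF that], of r]
        fps_X_power_dvd_const_mult[OF frame_det, of r "E (jac_minor g a b)"]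
        fps_X_power_dvd_const_mult[of "of_nat d :: 'k" r]
      unfolding Wronskian_eq_jac_minor[of d g a b, OF hom[OF that(1)] hom[OF that(2)], symmetric] by blast
  qed
  have "(\<forall>h\<in>minors. m ^ r dvd h) \<longleftrightarrow> (\<forall>a<n. \<forall>b<n. m ^ r dvd jac_minor g a b)"
  proof
    assume L: "\<forall>h\<in>minors. m ^ r dvd h"
    show "\<forall>a<n. \<forall>b<n. m ^ r dvd jac_minor g a b"
    proof (intro allI impI)
      fix a b assume ab: "a < n" "b < n"
      consider "a < b" | "a = b" | "b < a" by linarith
      then show "m ^ r dvd jac_minor g a b"
      proof cases
        case 3
        then have "m ^ r dvd jac_minor g b a" using L ab unfolding minors_def by blast
        moreover have "jac_minor g a b = - jac_minor g b a" by (simp add: jac_minor_def)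
        ultimately show ?thesis by simp
      qed (use L ab in \<open>auto simp: jac_minor_def minors_def\<close>)
    qed
  next
    assume "\<forall>a<n. \<forall>b<n. m ^ r dvd jac_minor g a b"
    then show "\<forall>h\<in>minors. m ^ r dvd h" by (auto simp: minors_def)
  qed
  also have "\<dots> \<longleftrightarrow> (\<forall>a<n. \<forall>b<n. fps_X ^ r dvd E (g a) * fps_deriv (E (g b)) - E (g b) * fps_deriv (E (g a)))"
    using minor by blast
  also have "\<dots> \<longleftrightarrow> (\<forall>i<n. fps_X ^ Suc r dvd fps_const (E (g j) $ 0) * E (g i) - fps_const (E (g i) $ 0) * E (g j))"
    using j by (intro Wronskians_dvd_iff) (simp_all add: expand_nth_0)
  also have "\<dots> \<longleftrightarrow> (\<forall>i<n. fps_X ^ Suc r dvd E (point_form j q i))"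
    by (simp add: point_form_def expand_nth_0)
  also have "\<dots> \<longleftrightarrow> (\<forall>i<n. m ^ Suc r dvd point_form j q i)"
    using fps_X_power_dvd_E[OF homogeneous_point_form[OF _ j(1)]] by blast
  finally show ?thesis .
qed

lemma power_dvd_minors_iff_multiplicity:
  assumes m: "linear_form m" "is_zero_of q m"
  obtains e where "e > 0" "branch_multiplicity n g q = real e"
    "\<And>r. (\<forall>h\<in>minors. m ^ r dvd h) \<longleftrightarrow> Suc r \<le> e"
proof -
  have "q \<noteq> (0, 0)" using m(2) by (simp add: is_zero_of_def)
  then obtain j where j: "j < n" "eval2 (g j) q \<noteq> 0" using no_common_zero by blast
  obtain e where e: "e > 0" "\<And>i. i < n \<Longrightarrow> m ^ e dvd point_form j q i"
    "\<exists>i<n. \<not> m ^ Suc e dvd point_form j q i" by (rule ex_point_form_order[OF m j]) (rule that)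
  then obtain i\<^sub>0 where i\<^sub>0: "i\<^sub>0 < n" "\<not> m ^ Suc e dvd point_form j q i\<^sub>0" by blast
  have "(\<forall>h\<in>minors. m ^ r dvd h) \<longleftrightarrow> Suc r \<le> e" for r
    unfolding power_dvd_minors_iff[OF m j]
  proof
    assume R: "\<forall>i<n. m ^ Suc r dvd point_form j q i"
    show "Suc r \<le> e"
    proof (rule ccontr)
      assume "\<not> Suc r \<le> e"
      then have "m ^ Suc e dvd m ^ Suc r" by (intro le_imp_power_dvd) simp
      then show False using R i\<^sub>0 dvd_trans by blast
    qed
  next
    assume "Suc r \<le> e"
    then have "m ^ Suc r dvd m ^ e" by (rule le_imp_power_dvd)
    then show "\<forall>i<n. m ^ Suc r dvd point_form j q i" using e(2) dvd_trans by blast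
  qed
  then show thesis using that[OF e(1) branch_multiplicity_order[OF m j e(1,2) i\<^sub>0]] by blast
qed

lemma ex_minors_gcd: "\<exists>h s l f. is_gcd_of_ideal (Ideal minors) h \<and> linear_ideals_factorization s l f h"
proof -
  have m: "linear_form (const2 0 * var_x + const2 1 * var_y :: 'k poly poly)"
    by (rule linear_form_of_coeffs) simp
  obtain q where q: "is_zero_of q (const2 0 * var_x + const2 1 * var_y :: 'k poly poly)"
    using ex_zero_linear_form[OF m] .
  obtain e where e: "\<And>r. (\<forall>h\<in>minors. (const2 0 * var_x + const2 1 * var_y) ^ r dvd h) \<longleftrightarrow> Suc r \<le> e"
    by (rule power_dvd_minors_iff_multiplicity[OF m q]) (rule that)
  have "\<not> (\<forall>h\<in>minors. (const2 0 * var_x + const2 1 * var_y) ^ e dvd h)" using e[of e] by simp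
  then obtain h\<^sub>0 where h\<^sub>0: "h\<^sub>0 \<in> minors" "h\<^sub>0 \<noteq> 0" by (metis dvd_0_right)
  have hom_minors: "homogeneous (d - 1 + (d - 1)) h" if "h \<in> minors" for h
  proof -
    obtain a b where "h = jac_minor g a b" "a < b" "b < n" using \<open>h \<in> minors\<close> unfolding minors_def by blast
    then show ?thesis using homogeneous_jac_minor[of a b] by simp
  qed
  have "\<exists>A. (\<forall>m\<in>#A. linear_form m) \<and> (\<forall>h\<in>minors. prod_mset A dvd h) \<and>
      (\<forall>c. (\<forall>h\<in>minors. c dvd h) \<longrightarrow> c dvd prod_mset A)"
    by (rule forms_gcd[OF hom_minors h\<^sub>0])
  then obtain A where A: "\<forall>m\<in>#A. linear_form m" "\<forall>h\<in>minors. prod_mset A dvd h"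
    "\<forall>c. (\<forall>h\<in>minors. c dvd h) \<longrightarrow> c dvd prod_mset A"
    by (elim exE conjE)
  obtain s l f h u where fac: "linear_ideals_factorization s l f h" "is_unit u" "prod_mset A = u * h"
    using linear_forms_factorization[OF A(1)] by blast
  have "h dvd a" if "a \<in> minors" for a
    using A(2)[rule_format, OF that] unfolding fac(3) by (rule dvd_mult_right)
  moreover have "c dvd h" if "\<forall>a\<in>minors. c dvd a" for c
    using A(3)[rule_format, OF that[rule_format]] fac(2,3) by (simp only: dvd_mult_unit_iff')
  ultimately have "is_gcd_of_ideal (Ideal minors) h" unfolding is_gcd_of_ideal_Ideal_iff by blast
  then show ?thesis using fac(1) by blast
qed

lemma branch_multiplicity_gcd:
  assumes h: "is_gcd_of_ideal (Ideal minors) h" and fac: "linear_ideals_factorization s l f h"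
    and m: "linear_form m" "is_zero_of q m"
  shows "i < s \<Longrightarrow> PIdl\<^bsub>B_ring\<^esub> m = PIdl\<^bsub>B_ring\<^esub> (l i) \<Longrightarrow> branch_multiplicity n g q = real (f i + 1)"
    and "\<forall>i<s. PIdl\<^bsub>B_ring\<^esub> m \<noteq> PIdl\<^bsub>B_ring\<^esub> (l i) \<Longrightarrow> branch_multiplicity n g q = 1"
proof -
  obtain e where e: "e > 0" "branch_multiplicity n g q = real e"
    "\<And>r. (\<forall>a\<in>minors. m ^ r dvd a) \<longleftrightarrow> Suc r \<le> e"
    by (rule power_dvd_minors_iff_multiplicity[OF m]) (rule that)
  have gcd: "\<forall>a\<in>minors. h dvd a" "\<And>c. (\<forall>a\<in>minors. c dvd a) \<Longrightarrow> c dvd h"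
    using h unfolding is_gcd_of_ideal_Ideal_iff by blast+
  have dvd: "m ^ r dvd h \<longleftrightarrow> Suc r \<le> e" for r
    using gcd e(3)[of r] dvd_trans by blast
  {
    assume i: "i < s" "PIdl\<^bsub>B_ring\<^esub> m = PIdl\<^bsub>B_ring\<^esub> (l i)"
    have "r \<le> f i \<longleftrightarrow> Suc r \<le> e" for r
      using power_dvd_factorization_iff(1)[OF fac m(1) i, of r] dvd[of r] by simp
    from this[of "f i"] this[of "e - 1"] have "e = f i + 1" using e(1) by linarith
    then show "branch_multiplicity n g q = real (f i + 1)" using e(2) by simp
  }
  {
    assume "\<forall>i<s. PIdl\<^bsub>B_ring\<^esub> m \<noteq> PIdl\<^bsub>B_ring\<^esub> (l i)"
    then have "r = 0 \<longleftrightarrow> Suc r \<le> e" for r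
      using power_dvd_factorization_iff(2)[OF fac m(1), of r] dvd[of r] by simp
    from this[of 1] this[of 0] have "e = 1" by linarith
    then show "branch_multiplicity n g q = 1" using e(2) by simp
  }
qed

end

theorem theorem7p2:
  fixes d n :: nat
    and g :: "nat \<Rightarrow> 'k::{alg_closed_field, field_char_0} poly poly"
  assumes "\<And>i. i < n \<Longrightarrow> homogeneous d (g i)"
    and "minimally_generated_by B_ring (Idl\<^bsub>B_ring\<^esub> (g ` {..<n})) n g"
    and "ideal_height B_ring (Idl\<^bsub>B_ring\<^esub> (g ` {..<n})) = 2"
    and "birational_onto_image n g"
  shows "(\<exists>h s l f. is_gcd_of_ideal (Fitt0 (kaehler_differentials (coord_ring n g))) h \<and>
                    linear_ideals_factorization s l f h) \<and>
         (\<forall>h s l f. is_gcd_of_ideal (Fitt0 (kaehler_differentials (coord_ring n g))) h \<and>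
                    linear_ideals_factorization s l f h \<longrightarrow>
            (\<forall>m q. linear_form m \<and> is_zero_of q m \<longrightarrow>
               (\<forall>i<s. PIdl\<^bsub>B_ring\<^esub> m = PIdl\<^bsub>B_ring\<^esub> (l i) \<longrightarrow>
                       branch_multiplicity n g q = real (f i + 1)) \<and>
               ((\<forall>i<s. PIdl\<^bsub>B_ring\<^esub> m \<noteq> PIdl\<^bsub>B_ring\<^esub> (l i)) \<longrightarrow>
                       branch_multiplicity n g q = 1))) \<and>
         Fitt0 (kaehler_differentials (coord_ring n g)) = minors_ideal 2 (jacobian_transposed n g)"
proof -
  interpret parametrisation d n g
  proof
    show "d > 0" by (rule height_two_degree_pos[OF assms(1,3)])
    show "homogeneous d (g i)" if "i < n" for i by (rule assms(1)[OF that])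
    show "\<exists>i<n. eval2 (g i) q \<noteq> 0" if "q \<noteq> (0, 0)" for q
      by (rule height_two_no_common_zero[OF assms(1,3) that])
    show "birational_onto_image n g" by (rule assms(4))
  qed
  have fitt: "Fitt0 (kaehler_differentials (coord_ring n g)) = Ideal minors"
    by (simp only: Fitt0_kaehler_differentials minors_ideal_jacobian minors_def)
  show ?thesis
    unfolding fitt minors_ideal_jacobian minors_def[symmetric]
    using ex_minors_gcd branch_multiplicity_gcd by blast
qed

end
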